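(* Let $\alpha\in\operatorname{D}^\sigma_\pi$ with $\sigma\in[0,1)$. The embedding $\operatorname{H}^1_{\pi,\alpha}(B)\hookrightarrow\operatorname{L}^2_\pi(B)$ is compact.
   Context: Let $n\in\{1,2\}$ and let $B=[-1,1)^n$ be the periodicity box: functions on $B$ are identified with functions on $\mathbb{R}^n$ that are $2$-periodic in each variable, and the subscript $\pi$ indicates spaces of periodic functions. If $n=1$, $\Gamma=\{-1/2,1/2\}$; if $n=2$, $\Gamma\subset B$ is a smooth closed curve bounding a smooth domain $\Omega$. Put $d(x,\Gamma)=\inf_{y\in\Gamma}|x-y|$. For $\sigma\in[0,1)$, $\operatorname{D}^\sigma_\pi$ is the set of bounded periodic functions $\alpha:B\to[0,\infty)$ which vanish exactly on $\Gamma$ (no vanishing is required if $\sigma=0$), satisfy $\frac1c d(x,\Gamma)^\sigma\le\alpha(x)\le c\,d(x,\Gamma)^\sigma$ for $x\in B$ and some constant $1\le c<\infty$, and are otherwise smooth on $B\setminus\Gamma$ (at least Hölder continuous of exponent $\sigma$). $\operatorname{H}^1_{\pi,\alpha}(B)=\{u\in\operatorname{L}^2_\pi(B): |\nabla u|\in\operatorname{L}^1_\pi(B),\ \int_B\alpha|\nabla u|^2dx<\infty\}$ (distributional periodic gradient), with norm $(\|u\|_2^2+\|\sqrt\alpha\,\nabla u\|_2^2)^{1/2}$. *)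

theory Defs
  imports "HOL-Analysis.Analysis"
begin

text \<open>
  The ambient space is an arbitrary Euclidean space, with \<open>n = DIM('a)\<close>. Functions on the
  periodicity box are represented by their periodic extensions to the whole space. Elements of the
  function spaces below are functions rather than classes modulo equality almost everywhere, so
  that the norms are seminorms, which vanish exactly on the null functions.
\<close>

definition per_box :: "'a::euclidean_space set" where
  "per_box = {x. \<forall>b\<in>Basis. -1 \<le> x \<bullet> b \<and> x \<bullet> b < 1}"

definition periodic :: "('a::euclidean_space \<Rightarrow> 'b) \<Rightarrow> bool" where
  "periodic f \<longleftrightarrow> (\<forall>x. \<forall>b\<in>Basis. f (x + 2 *\<^sub>R b) = f x)"

definition periodize :: "'a::euclidean_space set \<Rightarrow> 'a set" where
  "periodize S = {y + (\<Sum>b\<in>Basis. (2 * of_int (k b)) *\<^sub>R b) | y (k :: 'a \<Rightarrow> int). y \<in> S}"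


primrec times_differentiable ::
    "nat \<Rightarrow> ('a::real_normed_vector \<Rightarrow> 'b::real_normed_vector) \<Rightarrow> bool" where
  "times_differentiable 0 f \<longleftrightarrow> continuous_on UNIV f"
| "times_differentiable (Suc k) f \<longleftrightarrow>
     (\<forall>x. f differentiable at x) \<and>
     (\<forall>v. times_differentiable k (\<lambda>x. frechet_derivative f (at x) v))"

definition smooth :: "('a::real_normed_vector \<Rightarrow> 'b::real_normed_vector) \<Rightarrow> bool" where
  "smooth f \<longleftrightarrow> (\<forall>k. times_differentiable k f)"


definition smooth_closed_curve :: "'a::euclidean_space set \<Rightarrow> bool" where
  "smooth_closed_curve \<Gamma> \<longleftrightarrow>
     (\<exists>\<gamma> :: real \<Rightarrow> 'a. smooth \<gamma> \<and> (\<forall>t. \<gamma> (t + 1) = \<gamma> t) \<and> inj_on \<gamma> {0..<1} \<and>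
        (\<forall>t. vector_derivative \<gamma> (at t) \<noteq> 0) \<and> \<Gamma> = \<gamma> ` {0..<1})"

text \<open>
  Smoothness of the domain bounded by \<open>\<Gamma>\<close> is smoothness of its boundary \<open>\<Gamma>\<close>, which is an embedded
  curve.
\<close>
definition interface :: "'a::euclidean_space set \<Rightarrow> bool" where
  "interface \<Gamma> \<longleftrightarrow>
     (if DIM('a) = 1 then \<Gamma> = {x. \<exists>b\<in>Basis. x = (-1/2) *\<^sub>R b \<or> x = (1/2) *\<^sub>R b}
      else \<Gamma> \<subseteq> per_box \<and> smooth_closed_curve \<Gamma> \<and>
           (\<exists>\<Omega>. open \<Omega> \<and> connected \<Omega> \<and> bounded \<Omega> \<and> frontier \<Omega> = \<Gamma>))"


text \<open>
  Here \<open>d(x, \<Gamma>)\<^sup>\<sigma>\<close> is read with \<open>0\<^sup>0 = 1\<close>, whereas \<open>0 powr 0 = 0\<close>.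
\<close>
definition dist_pow :: "'a::euclidean_space set \<Rightarrow> real \<Rightarrow> 'a \<Rightarrow> real" where
  "dist_pow \<Gamma> \<sigma> x = (if \<sigma> = 0 then 1 else infdist x \<Gamma> powr \<sigma>)"

text \<open>
  The exponent \<open>0\<close> gives mere continuity.
\<close>
definition loc_hoelder_on :: "real \<Rightarrow> 'a::euclidean_space set \<Rightarrow> ('a \<Rightarrow> real) \<Rightarrow> bool" where
  "loc_hoelder_on \<sigma> S f \<longleftrightarrow>
     continuous_on S f \<and>
     (\<forall>x\<in>S. \<exists>e>0. \<exists>C. \<forall>y \<in> S \<inter> ball x e. \<forall>z \<in> S \<inter> ball x e.
        \<bar>f y - f z\<bar> \<le> C * norm (y - z) powr \<sigma>)"

text \<open>
  Away from \<open>\<Gamma>\<close> and its translates the functions are required to be ``smooth (at least Hoelder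
  continuous of exponent \<open>\<sigma>\<close>)''. This is read as the minimal requirement it names, in its local form;
  the class thus contains all functions (with the remaining properties) which are infinitely often
  differentiable there, as well as all which are globally Hoelder continuous.
\<close>
definition D_per :: "'a::euclidean_space set \<Rightarrow> real \<Rightarrow> ('a \<Rightarrow> real) set" where
  "D_per \<Gamma> \<sigma> = {\<alpha>. periodic \<alpha> \<and> bounded (range \<alpha>) \<and> (\<forall>x. 0 \<le> \<alpha> x) \<and>
     (\<sigma> \<noteq> 0 \<longrightarrow> (\<forall>x\<in>per_box. \<alpha> x = 0 \<longleftrightarrow> x \<in> \<Gamma>)) \<and>
     (\<exists>c\<ge>1. \<forall>x\<in>per_box. 1 / c * dist_pow \<Gamma> \<sigma> x \<le> \<alpha> x \<and> \<alpha> x \<le> c * dist_pow \<Gamma> \<sigma> x) \<and>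
     loc_hoelder_on \<sigma> (- periodize \<Gamma>) \<alpha>}"


definition L1_per :: "('a::euclidean_space \<Rightarrow> 'b::euclidean_space) set" where
  "L1_per = {f. periodic f \<and> f \<in> borel_measurable lebesgue \<and> set_integrable lebesgue per_box f}"

definition L2_per :: "('a::euclidean_space \<Rightarrow> real) set" where
  "L2_per = {f. periodic f \<and> f \<in> borel_measurable lebesgue \<and>
     set_integrable lebesgue per_box (\<lambda>x. (f x)\<^sup>2)}"

definition L2_norm :: "('a::euclidean_space \<Rightarrow> 'b::real_normed_vector) \<Rightarrow> real" where
  "L2_norm f = sqrt (set_lebesgue_integral lebesgue per_box (\<lambda>x. (norm (f x))\<^sup>2))"

definition has_per_gradient :: "('a::euclidean_space \<Rightarrow> real) \<Rightarrow> ('a \<Rightarrow> 'a) \<Rightarrow> bool" where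
  "has_per_gradient u g \<longleftrightarrow> g \<in> L1_per \<and>
     (\<forall>\<phi> :: 'a \<Rightarrow> real. smooth \<phi> \<and> periodic \<phi> \<longrightarrow> (\<forall>b\<in>Basis.
        set_lebesgue_integral lebesgue per_box (\<lambda>x. u x * frechet_derivative \<phi> (at x) b) =
        - set_lebesgue_integral lebesgue per_box (\<lambda>x. (g x \<bullet> b) * \<phi> x)))"

text \<open>
  The gradient is determined almost everywhere, so the choice does not affect the space and the
  norm below.
\<close>
definition per_gradient :: "('a::euclidean_space \<Rightarrow> real) \<Rightarrow> 'a \<Rightarrow> 'a" where
  "per_gradient u = (SOME g. has_per_gradient u g)"

definition H1_per :: "('a::euclidean_space \<Rightarrow> real) \<Rightarrow> ('a \<Rightarrow> real) set" where
  "H1_per \<alpha> = {u \<in> L2_per. (\<exists>g. has_per_gradient u g) \<and>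
     set_integrable lebesgue per_box (\<lambda>x. \<alpha> x * (norm (per_gradient u x))\<^sup>2)}"

definition H1_norm :: "('a::euclidean_space \<Rightarrow> real) \<Rightarrow> ('a \<Rightarrow> real) \<Rightarrow> real" where
  "H1_norm \<alpha> u = sqrt ((L2_norm u)\<^sup>2 + (L2_norm (\<lambda>x. sqrt (\<alpha> x) *\<^sub>R per_gradient u x))\<^sup>2)"


text \<open>
  Compact embedding of one (semi)normed space of functions into another: the inclusion is
  bounded, and bounded sequences have convergent subsequences.
\<close>
definition compact_embedding ::
    "('a \<Rightarrow> real) set \<Rightarrow> (('a \<Rightarrow> real) \<Rightarrow> real) \<Rightarrow> ('a \<Rightarrow> real) set \<Rightarrow> (('a \<Rightarrow> real) \<Rightarrow> real) \<Rightarrow> bool" where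
  "compact_embedding X norm_X Y norm_Y \<longleftrightarrow>
     X \<subseteq> Y \<and> (\<exists>C. \<forall>u\<in>X. norm_Y u \<le> C * norm_X u) \<and>
     (\<forall>u :: nat \<Rightarrow> 'a \<Rightarrow> real. range u \<subseteq> X \<and> bounded (range (\<lambda>k. norm_X (u k))) \<longrightarrow>
        (\<exists>v\<in>Y. \<exists>r :: nat \<Rightarrow> nat. strict_mono r \<and>
           (\<lambda>k. norm_Y (\<lambda>x. u (r k) x - v x)) \<longlonglongrightarrow> 0))"

end

theory Submission
  imports Defs "HOL-Complex_Analysis.Great_Picard" "HOL-Real_Asymp.Real_Asymp"
begin

text \<open>
  A function \<open>u\<close> with weak gradient \<open>g\<close> satisfies \<open>u (x + h b) - u x = \<integral>\<^sub>0\<^sup>h g (x + s b) \<bullet> b ds\<close> for almost all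
  \<open>x\<close>. On a square \<open>Q\<close> of side \<open>r\<close>, joining two points through either of the two remaining corners of
  their coordinate rectangle gives two bounds of their difference of \<open>u\<close>, and multiplying these yields the
  Poincare-Sobolev inequality \<open>\<integral>\<^sub>Q \<integral>\<^sub>Q \<bar>u x - u y\<bar>\<^sup>2 \<le> 4 r\<^sup>2 (\<integral>\<^sub>Q \<bar>g\<bar>)\<^sup>2\<close>. By Cauchy-Schwarz the right-hand side is at most
  \<open>4 r\<^sup>2 \<integral>\<^sub>Q \<alpha> \<bar>g\<bar>\<^sup>2 \<integral>\<^sub>Q 1/\<alpha>\<close>. Since \<open>\<Gamma>\<close> has codimension one and \<open>\<sigma> < 1\<close>, the function \<open>1/\<alpha>\<close> is integrable,
  so \<open>\<integral>\<^sub>Q 1/\<alpha>\<close> is uniformly small over the squares of a fine grid. Hence, up to a small multiple of the energy, the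
  \<open>L\<^sup>2\<close> norm is controlled by the finitely many integrals of \<open>u\<close> over the grid squares, and a subsequence along which all
  these integrals converge is Cauchy in \<open>L\<^sup>2\<close>.
\<close>

section \<open>Lebesgue measure restricted to a set\<close>

text \<open>Through Cauchy-Schwarz with an integrable \<open>1/\<alpha>\<close> the energy controls
  the gradient only in \<open>L^1\<close>, and in the plane \<open>W^{1,1}\<close> embeds into
  \<open>L^2\<close> at the critical exponent: the inequality on squares is invariant under scaling
  and gives no compactness by itself. Smallness has to come from the weight. It does, because the
  double integral on the left is twice the area of the square times the squared \<open>L^2\<close>
  distance of \<open>u\<close> to its mean, so the factor \<open>r^2\<close> cancels and only the
  integral of \<open>1/\<alpha>\<close> over the square remains in front of the energy. Two
  technical points shape the rest. The weak gradient is known only through smooth periodic test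
  functions, so pointwise identities are recovered from explicit test functions that approximate
  indicators of boxes. And the null set excluded from the line formula depends on \<open>h\<close>,
  while the corner argument needs the formula for almost all pairs of points; hence periodic Borel
  representatives and a careful exchange of almost-everywhere quantifiers.\<close>

definition lborel_on :: "'a::euclidean_space set \<Rightarrow> 'a measure" where
  "lborel_on A = density lborel (\<lambda>x. ennreal (indicator A x))"

text \<open>With a density instead of a restricted space the underlying space is \<open>UNIV\<close>
  and the sigma-algebra is \<open>borel\<close> for every \<open>A\<close>. Measurability side
  conditions then never mention \<open>A\<close>, and results on product measures and finite
  measures apply unchanged.\<close>

lemma sets_lborel_on [measurable_cong, simp]: "sets (lborel_on A) = sets borel"
  by (simp add: lborel_on_def)

lemma space_lborel_on [simp]: "space (lborel_on A) = UNIV"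
  by (simp add: lborel_on_def)

lemma nn_integral_lborel_on:
  assumes [measurable]: "A \<in> sets borel" "f \<in> borel_measurable borel"
  shows "(\<integral>\<^sup>+x. f x \<partial>lborel_on A) = (\<integral>\<^sup>+x\<in>A. f x \<partial>lborel)"
  unfolding lborel_on_def by (subst nn_integral_density) (auto intro!: nn_integral_cong split: split_indicator)

lemma integral_lborel_on:
  fixes f :: "'a::euclidean_space \<Rightarrow> 'b::{banach, second_countable_topology}"
  assumes [measurable]: "A \<in> sets borel" "f \<in> borel_measurable borel"
  shows "integral\<^sup>L (lborel_on A) f = (LINT x:A|lborel. f x)"
  unfolding lborel_on_def set_lebesgue_integral_def by (subst integral_density) auto

lemma integrable_lborel_on:
  fixes f :: "'a::euclidean_space \<Rightarrow> 'b::{banach, second_countable_topology}"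
  assumes [measurable]: "A \<in> sets borel" "f \<in> borel_measurable borel"
  shows "integrable (lborel_on A) f \<longleftrightarrow> set_integrable lborel A f"
  unfolding lborel_on_def set_integrable_def by (subst integrable_density) auto

lemma AE_lborel_on:
  assumes [measurable]: "A \<in> sets borel"
  shows "(AE x in lborel_on A. P x) \<longleftrightarrow> (AE x in lborel. x \<in> A \<longrightarrow> P x)"
  unfolding lborel_on_def by (subst AE_density) (auto simp: indicator_def)

lemma emeasure_lborel_on:
  assumes [measurable]: "A \<in> sets borel" "X \<in> sets borel"
  shows "emeasure (lborel_on A) X = emeasure lborel (A \<inter> X)"
proof -
  have "emeasure (lborel_on A) X = (\<integral>\<^sup>+x. ennreal (indicator A x) * indicator X x \<partial>lborel)"
    unfolding lborel_on_def by (rule emeasure_density) auto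
  also have "\<dots> = (\<integral>\<^sup>+x. indicator (A \<inter> X) x \<partial>lborel)"
    by (intro nn_integral_cong) (auto split: split_indicator)
  finally show ?thesis by simp
qed

lemma finite_measure_lborel_on:
  assumes "A \<in> sets borel" "emeasure lborel A < \<infinity>"
  shows "finite_measure (lborel_on A)"
  using assms by (intro finite_measureI) (simp add: emeasure_lborel_on)

section \<open>Smooth periodic test functions\<close>

text \<open>A syntactic class that contains the test functions below and is closed under directional
  derivatives. Closure turns smoothness, which quantifies over all iterated derivatives, into one
  induction.\<close>

inductive elementary :: "('a::euclidean_space \<Rightarrow> real) \<Rightarrow> bool" where
  const: "elementary (\<lambda>x. c)"
| inner: "elementary (\<lambda>x. x \<bullet> b)"
| add: "elementary f \<Longrightarrow> elementary g \<Longrightarrow> elementary (\<lambda>x. f x + g x)"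
| mult: "elementary f \<Longrightarrow> elementary g \<Longrightarrow> elementary (\<lambda>x. f x * g x)"
| exp: "elementary f \<Longrightarrow> elementary (\<lambda>x. exp (f x))"
| sin: "elementary f \<Longrightarrow> elementary (\<lambda>x. sin (f x))"
| cos: "elementary f \<Longrightarrow> elementary (\<lambda>x. cos (f x))"

lemma elementary_sum:
  "finite A \<Longrightarrow> (\<And>i. i \<in> A \<Longrightarrow> elementary (f i)) \<Longrightarrow> elementary (\<lambda>x. \<Sum>i\<in>A. f i x)"
  by (induction A rule: finite_induct) (auto intro: elementary.intros)

lemma elementary_has_derivative:
  assumes "elementary f"
  shows "\<exists>f'. (\<forall>x. (f has_derivative f' x) (at x)) \<and> (\<forall>v. elementary (\<lambda>x. f' x v))"
  using assms
proof induction
  case (const c)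
  then show ?case
    by (intro exI[of _ "\<lambda>x v. 0"]) (auto intro: elementary.intros)
next
  case (inner b)
  then show ?case
    by (intro exI[of _ "\<lambda>x v. v \<bullet> b"]) (auto intro!: elementary.intros derivative_eq_intros)
next
  case (add f g)
  then obtain f' g' where "\<forall>x. (f has_derivative f' x) (at x)" "\<forall>v. elementary (\<lambda>x. f' x v)"
    "\<forall>x. (g has_derivative g' x) (at x)" "\<forall>v. elementary (\<lambda>x. g' x v)" by blast
  then show ?case
    by (intro exI[of _ "\<lambda>x v. f' x v + g' x v"]) (auto intro!: elementary.intros derivative_eq_intros)
next
  case (mult f g)
  then obtain f' g' where "\<forall>x. (f has_derivative f' x) (at x)" "\<forall>v. elementary (\<lambda>x. f' x v)"
    "\<forall>x. (g has_derivative g' x) (at x)" "\<forall>v. elementary (\<lambda>x. g' x v)" by blast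
  with mult show ?case
    by (intro exI[of _ "\<lambda>x v. f x * g' x v + f' x v * g x"])
       (auto intro!: elementary.intros has_derivative_mult)
next
  case (exp f)
  then obtain f' where "\<forall>x. (f has_derivative f' x) (at x)" "\<forall>v. elementary (\<lambda>x. f' x v)" by blast
  with exp show ?case
    by (intro exI[of _ "\<lambda>x v. exp (f x) * f' x v"]) (auto intro!: elementary.intros derivative_eq_intros)
next
  case (sin f)
  then obtain f' where "\<forall>x. (f has_derivative f' x) (at x)" "\<forall>v. elementary (\<lambda>x. f' x v)" by blast
  with sin show ?case
    by (intro exI[of _ "\<lambda>x v. cos (f x) * f' x v"]) (auto intro!: elementary.intros derivative_eq_intros)
next
  case (cos f)
  then obtain f' where "\<forall>x. (f has_derivative f' x) (at x)" "\<forall>v. elementary (\<lambda>x. f' x v)" by blast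
  note f' = this
  \<comment> \<open>The class has no rule for negation, hence the explicit factor
    \<open>-1\<close>.\<close>
  have "elementary (\<lambda>x. (-1) * (sin (f x) * f' x v))" for v
    using cos.hyps f' by (intro elementary.mult elementary.const elementary.sin) auto
  with f' show ?case
    by (intro exI[of _ "\<lambda>x v. (-1) * (sin (f x) * f' x v)"]) (auto intro!: derivative_eq_intros)
qed

lemma elementary_smooth: "elementary f \<Longrightarrow> smooth f"
proof -
  have "elementary f \<Longrightarrow> times_differentiable k f" for k
  proof (induction k arbitrary: f)
    case 0
    then show ?case
      using elementary_has_derivative[of f]
      by (auto intro!: continuous_at_imp_continuous_on dest: has_derivative_continuous)
  next
    case (Suc k)
    from elementary_has_derivative[OF Suc.prems] obtain f' where
      f': "\<And>x. (f has_derivative f' x) (at x)" "\<And>v. elementary (\<lambda>x. f' x v)" by blast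
    then have "frechet_derivative f (at x) = f' x" for x
      by (metis frechet_derivative_at)
    with f' Suc.IH show ?case
      by (auto simp: differentiable_def)
  qed
  then show "elementary f \<Longrightarrow> smooth f"
    by (simp add: smooth_def)
qed

text \<open>The function \<open>cos (pi * t)\<close> is even, has period 2 and decreases on
  \<open>[0, 1]\<close>, so it orders points by their distance from the midpoint modulo 2. The
  endpoints are excluded to make both comparisons strict, as the limits of the exponentials
  require.\<close>

lemma cos_less_iff_in_interval:
  fixes x l u :: real
  assumes "-1 < x" "x < 1" "-1 \<le> l" "l < u" "u \<le> 1" "x \<noteq> l" "x \<noteq> u"
  shows "l < x \<and> x < u \<Longrightarrow> cos (pi * ((u - l) / 2)) < cos (pi * (x - (l + u) / 2))"
    and "\<not> (l < x \<and> x < u) \<Longrightarrow> cos (pi * (x - (l + u) / 2)) < cos (pi * ((u - l) / 2))"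
proof -
  define w where "w = (u - l) / 2"
  define d where "d = \<bar>x - (l + u) / 2\<bar>"
  have w: "0 < w" "w \<le> 1" using assms by (auto simp: w_def)
  have d0: "0 \<le> d" by (simp add: d_def)
  have cd: "cos (pi * (x - (l + u) / 2)) = cos (pi * d)"
    using cos_abs_real[of "pi * (x - (l + u) / 2)"] by (simp add: d_def abs_mult)
  {
    assume "l < x \<and> x < u"
    then have "d < w" by (auto simp: d_def w_def abs_if field_simps)
    then have "cos (pi * w) < cos (pi * d)"
      using w d0 by (intro cos_monotone_0_pi) (auto simp: mult_le_cancel_left1)
    then show "cos (pi * ((u - l) / 2)) < cos (pi * (x - (l + u) / 2))"
      by (simp add: cd w_def)
  next
    assume "\<not> (l < x \<and> x < u)"
    \<comment> \<open>The midpoint has absolute value at most \<open>1 - w\<close> and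
      \<open>\<bar>x\<bar> < 1\<close>, hence \<open>d < 2 - w\<close>; this keeps the reflected
      distance \<open>2 - d\<close> above \<open>w\<close> when \<open>d > 1\<close>.\<close>
    then have dw: "w < d" "d < 2 - w"
      using assms by (auto simp: d_def w_def abs_if field_simps)
    have "cos (pi * d) < cos (pi * w)"
    proof (cases "d \<le> 1")
      case True
      then show ?thesis using w dw by (intro cos_monotone_0_pi) (auto simp: mult_le_cancel_left1)
    next
      case False
      have "cos (pi * d) = cos (pi * (2 - d))"
        by (simp add: right_diff_distrib cos_diff mult.commute[of pi 2])
      also have "\<dots> < cos (pi * w)"
        using w dw False by (intro cos_monotone_0_pi) (auto simp: mult_le_cancel_left1)
      finally show ?thesis .
    qed
    then show "cos (pi * (x - (l + u) / 2)) < cos (pi * ((u - l) / 2))"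
      by (simp add: cd w_def)
  }
qed

text \<open>
  The inner exponential tends to \<open>0\<close> if \<open>x \<bullet> b\<close> lies between \<open>l \<bullet> b\<close> and \<open>u \<bullet> b\<close> modulo \<open>2\<close>, and to
  infinity if it lies outside, so these functions tend to the indicator of the periodized box.
\<close>
definition box_bump :: "'a::euclidean_space \<Rightarrow> 'a \<Rightarrow> nat \<Rightarrow> 'a \<Rightarrow> real" where
  "box_bump l u k x =
     exp (- (\<Sum>b\<in>Basis. exp (- real k * (cos (pi * (x \<bullet> b - (l \<bullet> b + u \<bullet> b) / 2))
        - cos (pi * ((u \<bullet> b - l \<bullet> b) / 2))))))"

lemma box_bump_smooth: "smooth (box_bump l u k)"
proof -
  let ?c = "\<lambda>b. - ((l \<bullet> b + u \<bullet> b) / 2)" and ?d = "\<lambda>b. - cos (pi * ((u \<bullet> b - l \<bullet> b) / 2))"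
  have "box_bump l u k = (\<lambda>x. exp ((-1) * (\<Sum>b\<in>Basis. exp ((- real k) *
     (cos (pi * (x \<bullet> b + ?c b)) + ?d b)))))"
    by (auto simp: box_bump_def fun_eq_iff)
  moreover have "elementary \<dots>"
    by (intro elementary.exp elementary.mult elementary.const elementary_sum elementary.add
        elementary.cos elementary.inner finite_Basis)
  ultimately show ?thesis by (metis elementary_smooth)
qed

lemma box_bump_periodic: "periodic (box_bump l u k)"
proof -
  have "cos (pi * ((x + 2 *\<^sub>R c) \<bullet> b - m)) = cos (pi * (x \<bullet> b - m))"
    if "b \<in> Basis" "c \<in> Basis" for x b c :: 'a and m
  proof (cases "c = b")
    case True
    then have "pi * ((x + 2 *\<^sub>R c) \<bullet> b - m) = pi * (x \<bullet> b - m) + 2 * pi"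
      using that by (simp add: inner_add_left algebra_simps)
    then show ?thesis by (metis cos_periodic)
  next
    case False
    then show ?thesis using that by (simp add: inner_add_left inner_Basis)
  qed
  then show ?thesis by (auto simp: periodic_def box_bump_def cong: sum.cong)
qed

lemma box_bump_bounds: "0 \<le> box_bump l u k x" "box_bump l u k x \<le> 1"
  by (auto simp: box_bump_def intro!: sum_nonneg)

lemma box_bump_measurable [measurable]: "box_bump l u k \<in> borel_measurable borel"
  unfolding box_bump_def by measurable

lemma box_bump_tendsto:
  fixes l u x :: "'a::euclidean_space"
  assumes lu: "\<And>b. b \<in> Basis \<Longrightarrow> -1 \<le> l \<bullet> b \<and> l \<bullet> b < u \<bullet> b \<and> u \<bullet> b \<le> 1"
    and x: "\<And>b. b \<in> Basis \<Longrightarrow> -1 < x \<bullet> b \<and> x \<bullet> b < 1 \<and> x \<bullet> b \<noteq> l \<bullet> b \<and> x \<bullet> b \<noteq> u \<bullet> b"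
  shows "(\<lambda>k. box_bump l u k x) \<longlonglongrightarrow> indicator (box l u) x"
proof -
  define a where "a b = cos (pi * (x \<bullet> b - (l \<bullet> b + u \<bullet> b) / 2)) - cos (pi * ((u \<bullet> b - l \<bullet> b) / 2))" for b
  have bb: "box_bump l u k x = exp (- (\<Sum>b\<in>Basis. exp (- real k * a b)))" for k
    by (simp add: box_bump_def a_def)
  show ?thesis
  proof (cases "x \<in> box l u")
    case True
    then have pos: "a b > 0" if "b \<in> Basis" for b
      using lu[OF that] x[OF that] cos_less_iff_in_interval(1)[of "x \<bullet> b" "l \<bullet> b" "u \<bullet> b"] that
      by (auto simp: a_def mem_box)
    have "(\<lambda>k. exp (- real k * a b)) \<longlonglongrightarrow> 0" if "b \<in> Basis" for b
    proof -
      have "a b > 0" using pos that .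
      then show ?thesis by real_asymp
    qed
    then have "(\<lambda>k. exp (- (\<Sum>b\<in>Basis. exp (- real k * a b)))) \<longlonglongrightarrow> exp (- (\<Sum>b\<in>(Basis::'a set). 0))"
      by (intro tendsto_intros) auto
    with True show ?thesis by (simp add: bb)
  next
    case False
    then obtain b where b: "b \<in> Basis" "\<not> (l \<bullet> b < x \<bullet> b \<and> x \<bullet> b < u \<bullet> b)"
      by (auto simp: mem_box)
    then have "a b < 0"
      using lu[OF b(1)] x[OF b(1)] cos_less_iff_in_interval(2)[of "x \<bullet> b" "l \<bullet> b" "u \<bullet> b"]
      by (auto simp: a_def)
    then have "(\<lambda>k. exp (- exp (- real k * a b))) \<longlonglongrightarrow> 0"
      by real_asymp
    \<comment> \<open>All summands are nonnegative, so the exploding one alone forces the limit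
      0.\<close>
    moreover have "\<forall>k. norm (box_bump l u k x) \<le> exp (- exp (- real k * a b))"
      unfolding bb using b(1) by (auto intro!: member_le_sum)
    ultimately have "(\<lambda>k. box_bump l u k x) \<longlonglongrightarrow> 0"
      by (rule Lim_null_comparison[OF always_eventually, rotated])
    with False show ?thesis by simp
  qed
qed

section \<open>Testing against indicators of boxes\<close>

lemma per_box_measurable [measurable]: "per_box \<in> sets borel"
proof -
  have "per_box = (\<Inter>b\<in>Basis. {x::'a. -1 \<le> x \<bullet> b} \<inter> {x. x \<bullet> b < 1})"
    by (auto simp: per_box_def)
  also have "\<dots> \<in> sets borel"
    by (intro sets.countable_INT'' sets.finite_INT) (auto simp: countable_finite)
  finally show ?thesis .
qed

lemma per_box_Int_box:
  fixes l u x :: "'a::euclidean_space"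
  assumes "\<And>b. b \<in> Basis \<Longrightarrow> x \<bullet> b \<noteq> -1"
  shows "x \<in> per_box \<and> x \<in> box l u \<longleftrightarrow>
    x \<in> box (\<Sum>b\<in>Basis. max (-1) (l \<bullet> b) *\<^sub>R b) (\<Sum>b\<in>Basis. min 1 (u \<bullet> b) *\<^sub>R b)"
  using assms by (force simp: per_box_def mem_box)

lemma AE_lborel_inner_neq_all:
  fixes c :: "'a::euclidean_space \<Rightarrow> real"
  shows "AE x in lborel. \<forall>b\<in>Basis. x \<bullet> b \<noteq> c b"
  by (intro AE_finite_allI finite_Basis AE_lborel_inner_neq)

text \<open>The box is clipped to \<open>per_box\<close> first: the bumps are known to converge to
  its indicator only for boxes inside, and almost everywhere on \<open>per_box\<close> clipping
  changes nothing. The limit is then taken by dominated convergence with majorant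
  \<open>\<bar>F\<bar>\<close>, as the bumps lie between 0 and 1.\<close>

lemma set_integral_box_bump_limit:
  fixes F :: "'a::euclidean_space \<Rightarrow> real"
  assumes F: "set_integrable lborel per_box F"
    and test: "\<And>\<phi>. smooth \<phi> \<Longrightarrow> periodic \<phi> \<Longrightarrow> (LINT x:per_box|lborel. F x * \<phi> x) = 0"
  shows "(LINT x:per_box|lborel. F x * indicator (box l u) x) = 0"
proof -
  have Fm: "(\<lambda>x. indicator per_box x *\<^sub>R F x) \<in> borel_measurable lborel"
    using F by (auto simp: set_integrable_def)
  define l' where "l' = (\<Sum>b\<in>Basis. max (-1) (l \<bullet> b) *\<^sub>R b)"
  define u' where "u' = (\<Sum>b\<in>Basis. min 1 (u \<bullet> b) *\<^sub>R b)"
  note lu'[simp] = l'_def[THEN arg_cong, of "\<lambda>l. l \<bullet> b" for b] u'_def[THEN arg_cong, of "\<lambda>l. l \<bullet> b" for b]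
  have eq: "AE x in lborel. x \<in> per_box \<longrightarrow> (x \<in> box l u \<longleftrightarrow> x \<in> box l' u')"
    using AE_lborel_inner_neq_all[of "\<lambda>_. -1"]
    by eventually_elim (use per_box_Int_box[of _ l u] in \<open>auto simp: l'_def u'_def\<close>)
  have lim: "(LINT x:per_box|lborel. F x * indicator (box l' u') x) = 0"
  proof (cases "\<forall>b\<in>Basis. l' \<bullet> b < u' \<bullet> b")
    \<comment> \<open>Clipping may leave an empty box, for which the strict inequality required by
      \<open>box_bump_tendsto\<close> fails.\<close>
    case False
    then have "box l' u' = {}" unfolding box_eq_empty by (meson not_le)
    then show ?thesis by simp
  next
    case True
    have "(\<lambda>k. LINT x|lborel. indicator per_box x *\<^sub>R F x * box_bump l' u' k x) \<longlonglongrightarrow>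
      (LINT x|lborel. indicator per_box x *\<^sub>R F x * indicator (box l' u') x)"
    proof (rule integral_dominated_convergence)
      show "integrable lborel (\<lambda>x. norm (indicator per_box x *\<^sub>R F x))"
        using F by (auto simp: set_integrable_def)
      show "AE x in lborel. (\<lambda>k. indicator per_box x *\<^sub>R F x * box_bump l' u' k x)
          \<longlonglongrightarrow> indicator per_box x *\<^sub>R F x * indicator (box l' u') x"
        using AE_lborel_inner_neq_all[of "\<lambda>_. -1"] AE_lborel_inner_neq_all[of "\<lambda>b. l' \<bullet> b"]
          AE_lborel_inner_neq_all[of "\<lambda>b. u' \<bullet> b"]
      proof eventually_elim
        case (elim x)
        show ?case
        proof (cases "x \<in> per_box")
          case T: True
          have "(\<lambda>k. box_bump l' u' k x) \<longlonglongrightarrow> indicator (box l' u') x"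
          proof (rule box_bump_tendsto)
            fix b :: 'a assume b: "b \<in> Basis"
            show "-1 \<le> l' \<bullet> b \<and> l' \<bullet> b < u' \<bullet> b \<and> u' \<bullet> b \<le> 1"
              using True b by (auto simp: l'_def u'_def)
            show "-1 < x \<bullet> b \<and> x \<bullet> b < 1 \<and> x \<bullet> b \<noteq> l' \<bullet> b \<and> x \<bullet> b \<noteq> u' \<bullet> b"
              using elim T b by (force simp: per_box_def less_le)
          qed
          then show ?thesis by (intro tendsto_intros)
        qed simp
      qed
      show "AE x in lborel. norm (indicator per_box x *\<^sub>R F x * box_bump l' u' k x)
          \<le> norm (indicator per_box x *\<^sub>R F x)" for k
        using box_bump_bounds[of l' u' k] by (auto simp: abs_mult intro!: mult_left_le)
    qed (use Fm in measurable)
    moreover have "(LINT x|lborel. indicator per_box x *\<^sub>R F x * box_bump l' u' k x) = 0" for k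
      using test[OF box_bump_smooth box_bump_periodic, of l' u' k]
      by (simp add: set_lebesgue_integral_def mult.assoc)
    ultimately have "(LINT x|lborel. indicator per_box x *\<^sub>R F x * indicator (box l' u') x) = 0"
      by (simp add: LIMSEQ_const_iff)
    then show ?thesis by (simp add: set_lebesgue_integral_def mult.assoc)
  qed
  have "(LINT x:per_box|lborel. F x * indicator (box l u) x) =
      (LINT x:per_box|lborel. F x * indicator (box l' u') x)"
    unfolding set_lebesgue_integral_def
  proof (rule integral_cong_AE)
    show "AE x in lborel. indicator per_box x *\<^sub>R (F x * indicator (box l u) x) =
        indicator per_box x *\<^sub>R (F x * indicator (box l' u') x)"
      using eq by eventually_elim (auto simp: indicator_def)
  qed (use Fm in \<open>simp_all flip: mult.assoc\<close>)
  with lim show ?thesis by simp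
qed

lemma enn2real_inject: "enn2real a = enn2real b \<Longrightarrow> a \<noteq> top \<Longrightarrow> b \<noteq> top \<Longrightarrow> a = b"
  by (cases a; cases b) auto

text \<open>The positive and the negative part of \<open>F\<close>, cut off outside the box, are
  densities of two measures. These agree on open boxes, which generate the Borel sets and are stable
  under intersection; so the measures agree, and densities are unique almost everywhere.\<close>

lemma periodic_du_Bois_Reymond:
  fixes F :: "'a::euclidean_space \<Rightarrow> real"
  assumes F: "set_integrable lborel per_box F"
    and test: "\<And>\<phi>. smooth \<phi> \<Longrightarrow> periodic \<phi> \<Longrightarrow> (LINT x:per_box|lborel. F x * \<phi> x) = 0"
  shows "AE x in lborel. x \<in> per_box \<longrightarrow> F x = 0"
proof -
  define f where "f x = indicator per_box x * F x" for x
  have f: "integrable lborel f" using F by (simp add: f_def[abs_def] set_integrable_def)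
  then have [measurable]: "f \<in> borel_measurable lborel" by auto
  let ?p = "\<lambda>x. ennreal (f x)" and ?n = "\<lambda>x. ennreal (- f x)"
  have fin: "(\<integral>\<^sup>+x. ?p x \<partial>lborel) < \<infinity>" "(\<integral>\<^sup>+x. ?n x \<partial>lborel) < \<infinity>"
    using f by (auto simp: real_integrable_def top.not_eq_extremum)
  have "density lborel ?p = density lborel ?n"
  proof (rule measure_eqI_generator_eq)
    let ?E = "range (\<lambda>(a, b). box a b::'a set)"
    show "Int_stable ?E" by (auto simp: Int_stable_def box_Int_box)
    show "?E \<subseteq> Pow UNIV" "sets (density lborel ?p) = sigma_sets UNIV ?E"
      "sets (density lborel ?n) = sigma_sets UNIV ?E"
      by (simp_all add: borel_eq_box)
    let ?A = "\<lambda>n::nat. box (- (real n *\<^sub>R One)) (real n *\<^sub>R One) :: 'a set"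
    show "range ?A \<subseteq> ?E" "(\<Union>i. ?A i) = UNIV"
      unfolding UN_box_eq_UNIV by auto
    show "emeasure (density lborel ?p) (?A i) \<noteq> \<infinity>" for i
    proof -
      have "emeasure (density lborel ?p) (?A i) \<le> (\<integral>\<^sup>+x. ?p x \<partial>lborel)"
        by (auto simp: emeasure_density intro!: nn_integral_mono split: split_indicator)
      with fin show ?thesis by (auto simp: top_unique)
    qed
    fix X assume "X \<in> ?E"
    then obtain l u where X: "X = box l u" by auto
    have fX: "integrable lborel (\<lambda>x. f x * indicator X x)"
      using integrable_real_mult_indicator[OF _ f, of X] X by simp
    have "(LINT x|lborel. f x * indicator X x) = 0"
      using set_integral_box_bump_limit[OF F test, of l u]
      by (simp add: f_def set_lebesgue_integral_def mult.assoc X)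
    then have "enn2real (\<integral>\<^sup>+x. ennreal (f x * indicator X x) \<partial>lborel) =
        enn2real (\<integral>\<^sup>+x. ennreal (- (f x * indicator X x)) \<partial>lborel)"
      by (simp add: real_lebesgue_integral_def[OF fX])
    then have "(\<integral>\<^sup>+x. ennreal (f x * indicator X x) \<partial>lborel) =
        (\<integral>\<^sup>+x. ennreal (- (f x * indicator X x)) \<partial>lborel)"
      using fX by (intro enn2real_inject) (auto simp: real_integrable_def)
    moreover have "ennreal (f x * indicator X x) = ?p x * indicator X x"
      "ennreal (- (f x * indicator X x)) = ?n x * indicator X x" for x
      by (auto split: split_indicator)
    ultimately show "emeasure (density lborel ?p) X = emeasure (density lborel ?n) X"
      by (simp add: emeasure_density X)
  qed
  then have "AE x in lborel. ?p x = ?n x"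
    by (intro sigma_finite_measure.density_unique[OF sigma_finite_lborel]) auto
  then show ?thesis
  proof eventually_elim
    case (elim x)
    then have "f x = 0"
      by (cases "f x \<ge> 0") (auto simp: ennreal_neg ennreal_eq_0_iff)
    then show ?case by (auto simp: f_def)
  qed
qed

section \<open>Periodic functions\<close>

lemma periodic_int_shift:
  assumes "periodic f" "b \<in> Basis"
  shows "f (x + (2 * of_int m) *\<^sub>R b) = f x"
proof -
  have nat: "f (x + (2 * real n) *\<^sub>R b) = f x" for x n
  proof (induction n)
    case (Suc n)
    have "x + (2 * real (Suc n)) *\<^sub>R b = (x + (2 * real n) *\<^sub>R b) + 2 *\<^sub>R b"
      by (simp add: algebra_simps)
    moreover have "f ((x + (2 * real n) *\<^sub>R b) + 2 *\<^sub>R b) = f (x + (2 * real n) *\<^sub>R b)"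
      using assms unfolding periodic_def by blast
    ultimately show ?case using Suc by metis
  qed simp
  show ?thesis
  proof (cases m)
    case (nonneg n)
    then show ?thesis using nat[of x n] by simp
  next
    case (neg n)
    let ?y = "x + (2 * of_int m) *\<^sub>R b"
    have "?y + (2 * real (Suc n)) *\<^sub>R b = x + (2 * of_int m + 2 * real (Suc n)) *\<^sub>R b"
      by (simp only: scaleR_add_left add.assoc)
    also have "\<dots> = x" using neg by simp
    finally show ?thesis using nat[of ?y "Suc n"] by metis
  qed
qed

lemma periodic_lattice_shift:
  fixes x :: "'a::euclidean_space"
  assumes "periodic f"
  shows "f (x + (\<Sum>b\<in>Basis. (2 * of_int (k b)) *\<^sub>R b)) = f x"
proof -
  have "finite B \<Longrightarrow> B \<subseteq> Basis \<Longrightarrow> f (x + (\<Sum>b\<in>B. (2 * of_int (k b)) *\<^sub>R b)) = f x" for B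
  proof (induction B rule: finite_induct)
    case (insert c B)
    have "x + (\<Sum>b\<in>insert c B. (2 * of_int (k b)) *\<^sub>R b) =
        (x + (\<Sum>b\<in>B. (2 * of_int (k b)) *\<^sub>R b)) + (2 * of_int (k c)) *\<^sub>R c"
      using insert by (simp add: algebra_simps)
    also have "f \<dots> = f (x + (\<Sum>b\<in>B. (2 * of_int (k b)) *\<^sub>R b))"
      using insert by (intro periodic_int_shift[OF assms]) auto
    finally show ?case using insert by simp
  qed simp
  then show ?thesis by simp
qed

text \<open>The representative of \<open>x\<close> modulo the lattice of periods. Composing with it
  makes any function on the box periodic and preserves Borel measurability; a translation followed
  by folding is a translation of the torus.\<close>

definition fold_box :: "'a::euclidean_space \<Rightarrow> 'a" where
  "fold_box x = x + (\<Sum>b\<in>Basis. (2 * of_int (- \<lfloor>(x \<bullet> b + 1) / 2\<rfloor>)) *\<^sub>R b)"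

lemma fold_box_inner:
  "b \<in> Basis \<Longrightarrow> fold_box x \<bullet> b = x \<bullet> b - 2 * of_int \<lfloor>(x \<bullet> b + 1) / 2\<rfloor>"
  by (simp add: fold_box_def inner_add_left inner_sum_left_Basis del: of_int_minus)

lemma fold_box_in_per_box [simp]: "fold_box x \<in> per_box"
  unfolding per_box_def
proof safe
  fix b :: 'a assume b: "b \<in> Basis"
  show "-1 \<le> fold_box x \<bullet> b" "fold_box x \<bullet> b < 1"
    using floor_correct[of "(x \<bullet> b + 1) / 2"] unfolding fold_box_inner[OF b] by (simp_all add: field_simps)
qed

lemma fold_box_id: "x \<in> per_box \<Longrightarrow> fold_box x = x"
proof (rule euclidean_eqI)
  fix b :: 'a assume b: "b \<in> Basis" and "x \<in> per_box"
  then have "\<lfloor>(x \<bullet> b + 1) / 2\<rfloor> = 0"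
    by (intro floor_unique) (auto simp: per_box_def field_simps)
  then show "fold_box x \<bullet> b = x \<bullet> b" by (simp add: fold_box_inner b)
qed

lemma periodic_fold_box: "periodic f \<Longrightarrow> f (fold_box x) = f x"
  unfolding fold_box_def by (rule periodic_lattice_shift)

lemma fold_box_periodic: "periodic fold_box"
  unfolding periodic_def
proof (intro allI ballI, rule euclidean_eqI)
  fix x b c :: 'a assume b: "b \<in> Basis" and c: "c \<in> Basis"
  have "((x + 2 *\<^sub>R b) \<bullet> c + 1) / 2 = (x \<bullet> c + 1) / 2 + of_int (if b = c then 1 else 0)"
    using b c by (auto simp: inner_add_left inner_Basis)
  then have "\<lfloor>((x + 2 *\<^sub>R b) \<bullet> c + 1) / 2\<rfloor> = \<lfloor>(x \<bullet> c + 1) / 2\<rfloor> + (if b = c then 1 else 0)"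
    by (metis floor_add_int)
  then show "fold_box (x + 2 *\<^sub>R b) \<bullet> c = fold_box x \<bullet> c"
    using b c by (auto simp: fold_box_inner inner_add_left inner_Basis)
qed

lemma periodic_comp_fold_box: "periodic (\<lambda>x. f (fold_box x))"
  using fold_box_periodic unfolding periodic_def by metis

lemma fold_box_measurable [measurable]: "fold_box \<in> borel_measurable borel"
  unfolding fold_box_def by measurable

section \<open>Null sets, representatives and integrals under translations of the torus\<close>

lemma nn_integral_lborel_shift:
  fixes f :: "'a::euclidean_space \<Rightarrow> ennreal"
  assumes [measurable]: "f \<in> borel_measurable borel"
  shows "(\<integral>\<^sup>+x. f (x + c) \<partial>lborel) = (\<integral>\<^sup>+x. f x \<partial>lborel)"
  by (subst (2) lborel_distr_plus[of c, symmetric]) (simp add: nn_integral_distr add.commute)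

lemma AE_lborel_shift:
  fixes c :: "'a::euclidean_space"
  assumes "AE x in lborel. P x"
  shows "AE x in lborel. P (x + c)"
proof -
  have "AE x in distr lborel borel ((+) c). P x"
    using assms by (simp only: lborel_distr_plus)
  then show ?thesis
    using AE_distrD[of "(+) c" lborel borel P] by (simp add: add.commute)
qed

text \<open>Folding is piecewise a lattice translation. Translations preserve null sets, and there
  are only countably many lattice vectors.\<close>

lemma AE_fold_box:
  fixes P :: "'a::euclidean_space \<Rightarrow> bool"
  assumes "AE x in lborel. x \<in> per_box \<longrightarrow> P x"
  shows "AE x in lborel. P (fold_box x)"
proof -
  let ?v = "\<lambda>k::'a \<Rightarrow> int. \<Sum>b\<in>Basis. (2 * of_int (k b)) *\<^sub>R b"
  \<comment> \<open>The functions \<open>'a \<Rightarrow> int\<close> form an uncountable set;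
    keeping only those that are fixed outside \<open>Basis\<close> retains every lattice vector and
    makes the index set countable.\<close>
  define K where "K = (Basis \<rightarrow>\<^sub>E (UNIV :: int set) :: ('a \<Rightarrow> int) set)"
  have "countable K"
    unfolding K_def by (intro countable_PiE) auto
  then have "AE x in lborel. \<forall>k\<in>K. x + ?v k \<in> per_box \<longrightarrow> P (x + ?v k)"
    by (simp add: AE_ball_countable AE_lborel_shift[OF assms])
  then show ?thesis
  proof eventually_elim
    case (elim x)
    let ?k = "restrict (\<lambda>b. - \<lfloor>(x \<bullet> b + 1) / 2\<rfloor>) Basis"
    have "fold_box x = x + ?v ?k" by (simp add: fold_box_def)
    moreover have "?k \<in> K" by (simp add: K_def)
    then have "x + ?v ?k \<in> per_box \<longrightarrow> P (x + ?v ?k)" using elim by blast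
    ultimately show ?case using fold_box_in_per_box[of x] by simp
  qed
qed

lemma lebesgue_measurable_ex_borel:
  fixes f :: "'a::euclidean_space \<Rightarrow> 'b::euclidean_space"
  assumes "f \<in> borel_measurable lebesgue"
  obtains f' where "f' \<in> borel_measurable borel" "AE x in lborel. f x = f' x"
proof -
  have "\<exists>g\<in>borel_measurable lborel. AE x in lborel. f x \<bullet> b = g x" for b
    using assms by (intro completion_ex_borel_measurable_real) auto
  then obtain g where g: "\<And>b. g b \<in> borel_measurable lborel" "\<And>b. AE x in lborel. f x \<bullet> b = g b x"
    by metis
  show ?thesis
  proof
    show "(\<lambda>x. \<Sum>b\<in>Basis. g b x *\<^sub>R b) \<in> borel_measurable borel"
      using g(1) by (auto simp: measurable_lborel1 intro!: borel_measurable_sum borel_measurable_scaleR)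
    have "AE x in lborel. \<forall>b\<in>Basis. f x \<bullet> b = g b x"
      using g(2) by (intro AE_finite_allI) auto
    then show "AE x in lborel. f x = (\<Sum>b\<in>Basis. g b x *\<^sub>R b)"
      by eventually_elim (auto intro!: euclidean_eqI[where 'a='b])
  qed
qed

text \<open>A Borel representative of a periodic function need not be periodic; folding repairs this
  on a null set. Borel measurability matters because translates such as \<open>u (x + s b)\<close>
  have to be jointly measurable in \<open>x\<close> and \<open>s\<close>.\<close>

lemma periodic_ex_borel:
  fixes f :: "'a::euclidean_space \<Rightarrow> 'b::euclidean_space"
  assumes "f \<in> borel_measurable lebesgue" "periodic f"
  obtains f' where "f' \<in> borel_measurable borel" "periodic f'" "AE x in lborel. f x = f' x"
proof -
  obtain h where h[measurable]: "h \<in> borel_measurable borel" and fh: "AE x in lborel. f x = h x"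
    using lebesgue_measurable_ex_borel[OF assms(1)] .
  show ?thesis
  proof
    show "(\<lambda>x. h (fold_box x)) \<in> borel_measurable borel" by measurable
    have "AE x in lborel. f (fold_box x) = h (fold_box x)"
      by (intro AE_fold_box) (use fh in eventually_elim, auto)
    then show "AE x in lborel. f x = h (fold_box x)"
      by (simp add: periodic_fold_box[OF assms(2)])
  qed (rule periodic_comp_fold_box)
qed

text \<open>The part of the shifted box that sticks out beyond 1 in direction \<open>b\<close> is
  moved back by one period and fills exactly the strip left uncovered at the other side. The bound
  \<open>h \<le> 2\<close> keeps the overhang within one period.\<close>

lemma nn_integral_per_box_shift:
  fixes f :: "'a::euclidean_space \<Rightarrow> ennreal"
  assumes [measurable]: "f \<in> borel_measurable borel" and per: "periodic f"
    and b: "b \<in> Basis" and h: "0 \<le> h" "h \<le> 2"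
  shows "(\<integral>\<^sup>+x. f (x + h *\<^sub>R b) \<partial>lborel_on per_box) = (\<integral>\<^sup>+x. f x \<partial>lborel_on per_box)"
proof -
  have pb: "x \<in> per_box \<longleftrightarrow> (\<forall>c\<in>Basis - {b}. -1 \<le> x \<bullet> c \<and> x \<bullet> c < 1) \<and> -1 \<le> x \<bullet> b \<and> x \<bullet> b < 1"
    for x :: 'a using b by (auto simp: per_box_def)
  have pbs: "y - t *\<^sub>R b \<in> per_box \<longleftrightarrow>
    (\<forall>c\<in>Basis - {b}. -1 \<le> y \<bullet> c \<and> y \<bullet> c < 1) \<and> t - 1 \<le> y \<bullet> b \<and> y \<bullet> b < t + 1" for y :: 'a and t
  proof -
    have e1: "(y - t *\<^sub>R b) \<bullet> c = y \<bullet> c" if "c \<in> Basis - {b}" for c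
      using b that by (auto simp: inner_diff_left inner_Basis)
    have e2: "(y - t *\<^sub>R b) \<bullet> b = y \<bullet> b - t"
      using b by (simp add: inner_diff_left)
    have "(\<forall>c\<in>Basis - {b}. -1 \<le> (y - t *\<^sub>R b) \<bullet> c \<and> (y - t *\<^sub>R b) \<bullet> c < 1) \<longleftrightarrow>
        (\<forall>c\<in>Basis - {b}. -1 \<le> y \<bullet> c \<and> y \<bullet> c < 1)"
      by (intro ball_cong refl) (simp only: e1)
    then show ?thesis unfolding pb e2 by (simp only: le_diff_eq diff_less_eq) argo
  qed
  \<comment> \<open>\<open>?A\<close> is the part of the box covered by the shifted one,
    \<open>?C\<close> the remaining strip, whose translate by \<open>2 b\<close> is the
    overhang.\<close>
  let ?A = "\<lambda>y. indicator per_box y * (if h - 1 \<le> y \<bullet> b then 1 else 0 :: ennreal)"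
  let ?C = "\<lambda>y. indicator per_box y * (if y \<bullet> b < h - 1 then 1 else 0 :: ennreal)"
  have "(\<integral>\<^sup>+x. f (x + h *\<^sub>R b) \<partial>lborel_on per_box) =
      (\<integral>\<^sup>+x. f (x + h *\<^sub>R b) * indicator per_box ((x + h *\<^sub>R b) - h *\<^sub>R b) \<partial>lborel)"
    by (subst nn_integral_lborel_on) simp_all
  also have "\<dots> = (\<integral>\<^sup>+y. f y * indicator per_box (y - h *\<^sub>R b) \<partial>lborel)"
    by (rule nn_integral_lborel_shift[where f="\<lambda>y. f y * indicator per_box (y - h *\<^sub>R b)"]) measurable
  also have "\<dots> = (\<integral>\<^sup>+y. f y * ?A y + f y * ?C (y - 2 *\<^sub>R b) \<partial>lborel)"
  proof (intro nn_integral_cong)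
    fix y :: 'a
    have "(y - 2 *\<^sub>R b) \<bullet> b = y \<bullet> b - 2" using b by (simp add: inner_diff_left)
    then show "f y * indicator per_box (y - h *\<^sub>R b) = f y * ?A y + f y * ?C (y - 2 *\<^sub>R b)"
      using h pb[of y] pbs[of y h] pbs[of y 2] by (auto simp: indicator_def)
  qed
  also have "\<dots> = (\<integral>\<^sup>+y. f y * ?A y \<partial>lborel) + (\<integral>\<^sup>+y. f y * ?C (y - 2 *\<^sub>R b) \<partial>lborel)"
    by (intro nn_integral_add) measurable
  also have "(\<integral>\<^sup>+y. f y * ?C (y - 2 *\<^sub>R b) \<partial>lborel) =
      (\<integral>\<^sup>+y. f (y + 2 *\<^sub>R b) * ?C ((y + 2 *\<^sub>R b) - 2 *\<^sub>R b) \<partial>lborel)"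
    by (rule nn_integral_lborel_shift[where f="\<lambda>y. f y * ?C (y - 2 *\<^sub>R b)", symmetric]) measurable
  also have "\<dots> = (\<integral>\<^sup>+y. f y * ?C y \<partial>lborel)"
    using per b by (simp add: periodic_def)
  also have "(\<integral>\<^sup>+y. f y * ?A y \<partial>lborel) + (\<integral>\<^sup>+y. f y * ?C y \<partial>lborel) =
      (\<integral>\<^sup>+y. f y * ?A y + f y * ?C y \<partial>lborel)"
    by (intro nn_integral_add[symmetric]) measurable
  also have "\<dots> = (\<integral>\<^sup>+x. f x \<partial>lborel_on per_box)"
    by (auto simp: nn_integral_lborel_on intro!: nn_integral_cong)
  finally show ?thesis .
qed

text \<open>Translations of the torus preserve measure. As an equality of image measures this
  transfers Bochner integrals and integrability at once, without splitting into positive and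
  negative parts.\<close>

lemma distr_fold_box_shift:
  fixes b :: "'a::euclidean_space"
  assumes b: "b \<in> Basis" and h: "0 \<le> h" "h \<le> 2"
  shows "distr (lborel_on per_box) borel (\<lambda>x. fold_box (x + h *\<^sub>R b)) = lborel_on per_box"
proof (rule measure_eqI)
  fix X :: "'a set" assume "X \<in> sets (distr (lborel_on per_box) borel (\<lambda>x. fold_box (x + h *\<^sub>R b)))"
  then have [measurable]: "X \<in> sets borel" by simp
  have "emeasure (distr (lborel_on per_box) borel (\<lambda>x. fold_box (x + h *\<^sub>R b))) X =
      (\<integral>\<^sup>+y. indicator X y \<partial>distr (lborel_on per_box) borel (\<lambda>x. fold_box (x + h *\<^sub>R b)))"
    by (intro nn_integral_indicator[symmetric]) simp
  also have "\<dots> = (\<integral>\<^sup>+x. indicator X (fold_box (x + h *\<^sub>R b)) \<partial>lborel_on per_box)"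
    by (intro nn_integral_distr) measurable
  also have "\<dots> = (\<integral>\<^sup>+x. indicator X (fold_box x) \<partial>lborel_on per_box)"
    using b h by (intro nn_integral_per_box_shift[where f="\<lambda>x. indicator X (fold_box x)"] periodic_comp_fold_box) measurable
  also have "\<dots> = (\<integral>\<^sup>+x. indicator X x \<partial>lborel_on per_box)"
    by (intro nn_integral_cong_AE) (simp add: AE_lborel_on fold_box_id)
  also have "\<dots> = emeasure (lborel_on per_box) X" by simp
  finally show "emeasure (distr (lborel_on per_box) borel (\<lambda>x. fold_box (x + h *\<^sub>R b))) X =
      emeasure (lborel_on per_box) X" .
qed simp

lemma
  fixes f :: "'a::euclidean_space \<Rightarrow> real"
  assumes [measurable]: "f \<in> borel_measurable borel" and per: "periodic f"
    and b: "b \<in> Basis" and h: "0 \<le> h" "h \<le> 2"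
  shows integral_per_box_shift:
      "(LINT x|lborel_on per_box. f (x + h *\<^sub>R b)) = (LINT x|lborel_on per_box. f x)"
    and integrable_per_box_shift:
      "integrable (lborel_on per_box) (\<lambda>x. f (x + h *\<^sub>R b)) \<longleftrightarrow> integrable (lborel_on per_box) f"
proof -
  let ?T = "\<lambda>x. fold_box (x + h *\<^sub>R b)"
  have [simp]: "f (?T x) = f (x + h *\<^sub>R b)" for x
    using periodic_fold_box[OF per] .
  show "(LINT x|lborel_on per_box. f (x + h *\<^sub>R b)) = (LINT x|lborel_on per_box. f x)"
    using integral_distr[of ?T "lborel_on per_box" borel f] by (simp add: distr_fold_box_shift[OF b h])
  show "integrable (lborel_on per_box) (\<lambda>x. f (x + h *\<^sub>R b)) \<longleftrightarrow> integrable (lborel_on per_box) f"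
    using integrable_distr_eq[of ?T "lborel_on per_box" borel f] by (simp add: distr_fold_box_shift[OF b h])
qed

section \<open>Weak derivatives and line integrals\<close>

lemma has_derivative_shift:
  assumes "(f has_derivative f') (at (x + v))"
  shows "((\<lambda>y. f (y + v)) has_derivative f') (at x)"
proof -
  have "((\<lambda>y. y + v) has_derivative (\<lambda>h. h)) (at x)"
    by (auto intro!: derivative_eq_intros)
  from has_derivative_compose[OF this assms] show ?thesis .
qed

lemma frechet_derivative_shift:
  assumes "\<And>x. f differentiable at x"
  shows "frechet_derivative (\<lambda>y. f (y + v)) (at x) = frechet_derivative f (at (x + v))"
  using assms[of "x + v"] frechet_derivative_works has_derivative_shift frechet_derivative_at by metis

lemma smooth_shift:
  assumes "smooth f"
  shows "smooth (\<lambda>x. f (x + v))"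
proof -
  have "times_differentiable k f \<Longrightarrow> times_differentiable k (\<lambda>x. f (x + v))" for k and f :: "'a \<Rightarrow> 'b"
  proof (induction k arbitrary: f)
    case 0
    then show ?case
      by (auto intro!: continuous_on_compose2[of UNIV f] continuous_intros)
  next
    case (Suc k)
    then have d: "f differentiable at x" for x by simp
    have "(\<lambda>y. f (y + v)) differentiable at x" for x
      using d[of "x + v"] unfolding differentiable_def by (blast intro: has_derivative_shift)
    moreover have "times_differentiable k (\<lambda>x. frechet_derivative (\<lambda>y. f (y + v)) (at x) w)" for w
      unfolding frechet_derivative_shift[OF d] using Suc.prems by (intro Suc.IH) simp
    ultimately show ?case by simp
  qed
  with assms show ?thesis by (simp add: smooth_def)
qed

lemma smooth_differentiable: "smooth f \<Longrightarrow> f differentiable at x"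
proof -
  assume "smooth f"
  then have "times_differentiable (Suc 0) f" by (simp only: smooth_def)
  then show ?thesis by simp
qed

lemma smooth_continuous: "smooth f \<Longrightarrow> continuous_on UNIV f"
  by (auto simp: smooth_def dest: spec[of _ 0])

lemma smooth_continuous_derivative:
  assumes "smooth f"
  shows "continuous_on UNIV (\<lambda>x. frechet_derivative f (at x) v)"
proof -
  have "times_differentiable (Suc 0) f" using assms by (simp only: smooth_def)
  then show ?thesis by simp
qed

lemma periodic_shift: "periodic f \<Longrightarrow> periodic (\<lambda>x. f (x + v))"
proof -
  assume p: "periodic f"
  have "x + 2 *\<^sub>R b + v = (x + v) + 2 *\<^sub>R b" for x b :: 'a
    by (simp add: algebra_simps)
  with p show ?thesis unfolding periodic_def by metis
qed

lemma periodic_derivative: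
  assumes "periodic f" "smooth f"
  shows "periodic (\<lambda>x. frechet_derivative f (at x) v)"
  unfolding periodic_def
proof safe
  fix x b :: 'a assume "b \<in> Basis"
  then have "(\<lambda>y. f (y + 2 *\<^sub>R b)) = f" using assms(1) by (auto simp: periodic_def)
  then show "frechet_derivative f (at (x + 2 *\<^sub>R b)) v = frechet_derivative f (at x) v"
    using frechet_derivative_shift[of f "2 *\<^sub>R b" x] smooth_differentiable[OF assms(2)] by simp
qed

lemma per_box_subset_cbox: "per_box \<subseteq> cbox (- One) (One :: 'a::euclidean_space)"
  by (force simp: per_box_def mem_box)

lemma periodic_continuous_bounded:
  fixes f :: "'a::euclidean_space \<Rightarrow> real"
  assumes "periodic f" "continuous_on UNIV f"
  obtains C where "\<And>x. \<bar>f x\<bar> \<le> C"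
proof -
  have "bounded (f ` cbox (- One) One)"
    by (intro compact_imp_bounded compact_continuous_image continuous_on_subset[OF assms(2)]) auto
  then obtain C where C: "\<And>x. x \<in> cbox (- One) One \<Longrightarrow> \<bar>f x\<bar> \<le> C"
    by (auto simp: bounded_iff)
  have "\<bar>f x\<bar> \<le> C" for x
    using C[OF subsetD[OF per_box_subset_cbox fold_box_in_per_box]] periodic_fold_box[OF assms(1), of x] by metis
  then show ?thesis using that by blast
qed

lemma emeasure_per_box_finite: "emeasure lborel (per_box :: 'a::euclidean_space set) < \<infinity>"
proof -
  have "emeasure lborel (per_box :: 'a set) \<le> emeasure lborel (cbox (- One) (One :: 'a))"
    by (intro emeasure_mono per_box_subset_cbox) simp
  also have "\<dots> < \<infinity>" by (rule emeasure_lborel_cbox_finite)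
  finally show ?thesis .
qed

interpretation per_box: finite_measure "lborel_on (per_box :: 'a::euclidean_space set)"
  by (intro finite_measure_lborel_on per_box_measurable emeasure_per_box_finite)

text \<open>Stated for backward shifts because translating \<open>u\<close> by \<open>h b\<close>
  amounts, under the integral, to translating the test function by \<open>- h b\<close>.\<close>

lemma smooth_FTC:
  fixes \<phi> :: "'a::euclidean_space \<Rightarrow> real"
  assumes "smooth \<phi>" "0 \<le> h"
  shows "(LINT s|lborel_on {0..h}. frechet_derivative \<phi> (at (x + (- s) *\<^sub>R b)) b) = \<phi> x - \<phi> (x + (- h) *\<^sub>R b)"
proof -
  let ?D = "\<lambda>s. frechet_derivative \<phi> (at (x + (- s) *\<^sub>R b)) b"
  have cont: "continuous_on UNIV ?D"
    by (intro continuous_on_compose2[OF smooth_continuous_derivative[OF assms(1)]] continuous_intros) auto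
  have Dm: "?D \<in> borel_measurable borel"
    by (intro borel_measurable_continuous_onI cont)
  have "((\<lambda>s. - \<phi> (x + (- s) *\<^sub>R b)) has_real_derivative ?D s) (at s)" for s
  proof -
    have "(\<phi> has_derivative frechet_derivative \<phi> (at (x + (- s) *\<^sub>R b))) (at (x + (- s) *\<^sub>R b))"
      using smooth_differentiable[OF assms(1)] frechet_derivative_works by blast
    moreover have "((\<lambda>s. x + (- s) *\<^sub>R b) has_derivative (\<lambda>t. (- t) *\<^sub>R b)) (at s)"
      by (auto intro!: derivative_eq_intros)
    ultimately have der: "((\<lambda>s. \<phi> (x + (- s) *\<^sub>R b)) has_derivative
        (\<lambda>t. frechet_derivative \<phi> (at (x + (- s) *\<^sub>R b)) ((- t) *\<^sub>R b))) (at s)"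
      by (rule has_derivative_compose[rotated])
    moreover have "frechet_derivative \<phi> (at (x + (- s) *\<^sub>R b)) ((- t) *\<^sub>R b) = - ?D s * t" for t
      using linear_cmul[OF linear_frechet_derivative[OF smooth_differentiable[OF assms(1)]], of _ "- t" b]
      by simp
    ultimately have "((\<lambda>s. \<phi> (x + (- s) *\<^sub>R b)) has_real_derivative - ?D s) (at s)"
      by (intro has_derivative_imp_has_field_derivative[OF der]) simp
    then show ?thesis using DERIV_minus by fastforce
  qed
  then have "((\<lambda>s. - \<phi> (x + (- s) *\<^sub>R b)) has_vector_derivative ?D s) (at s within {0..h})" for s
    using has_real_derivative_iff_has_vector_derivative has_vector_derivative_at_within by blast
  then have "(LINT s:{0..h}|lborel. ?D s) = - \<phi> (x + (- h) *\<^sub>R b) - - \<phi> (x + (- 0) *\<^sub>R b)"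
    unfolding set_lebesgue_integral_def
    by (intro integral_FTC_Icc assms(2) continuous_on_subset[OF cont]) auto
  moreover have "(LINT s|lborel_on {0..h}. ?D s) = (LINT s:{0..h}|lborel. ?D s)"
    by (rule integral_lborel_on[OF _ Dm]) simp
  ultimately show ?thesis by simp
qed

lemma abs_mult_le_abs_mult:
  fixes a b c :: real
  shows "\<bar>b\<bar> \<le> \<bar>c\<bar> \<Longrightarrow> \<bar>a * b\<bar> \<le> \<bar>c * a\<bar>"
  by (simp add: abs_mult mult.commute[of "\<bar>a\<bar>"] mult_right_mono)

text \<open>Tonelli with \<open>x\<close> integrated first: a bound of the inner integral that is
  uniform in \<open>s\<close> suffices because \<open>N\<close> is finite. It is asked for almost
  every \<open>s\<close>, since translation invariance of the box integral will be available for
  \<open>0 \<le> s \<le> 2\<close>.\<close>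

lemma integrable_pair_bounded:
  fixes k :: "'a \<times> 'b \<Rightarrow> real"
  assumes "finite_measure M" "finite_measure N" and [measurable]: "k \<in> borel_measurable (M \<Otimes>\<^sub>M N)"
    and le: "AE s in N. (\<integral>\<^sup>+x. norm (k (x, s)) \<partial>M) \<le> ennreal I"
  shows "integrable (M \<Otimes>\<^sub>M N) k"
proof (rule integrableI_bounded)
  interpret M: finite_measure M by fact
  interpret N: finite_measure N by fact
  interpret pair_sigma_finite M N ..
  have "(\<integral>\<^sup>+z. norm (k z) \<partial>(M \<Otimes>\<^sub>M N)) = (\<integral>\<^sup>+s. \<integral>\<^sup>+x. norm (k (x, s)) \<partial>M \<partial>N)"
    by (intro nn_integral_snd[symmetric]) measurable
  also have "\<dots> \<le> (\<integral>\<^sup>+s. ennreal I \<partial>N)"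
    by (intro nn_integral_mono_AE le)
  also have "\<dots> < \<infinity>"
    using N.emeasure_finite by (simp add: ennreal_mult_eq_top_iff less_top[symmetric])
  finally show "(\<integral>\<^sup>+z. norm (k z) \<partial>(M \<Otimes>\<^sub>M N)) < \<infinity>" .
qed simp

text \<open>Duality: tested against \<open>\<phi>\<close>, the difference of \<open>u\<close>
  becomes a difference of \<open>\<phi>\<close>, which is a line integral of its classical
  derivative. The weak identity, applied to each translate of \<open>\<phi>\<close>, moves this
  derivative onto \<open>w\<close>, and translating back produces the line integral of
  \<open>w\<close>. Hence \<open>F\<close>, the defect of the claimed formula, is orthogonal to all
  test functions.\<close>

lemma weak_derivative_line_integral:
  fixes u w :: "'a::euclidean_space \<Rightarrow> real"
  assumes [measurable]: "u \<in> borel_measurable borel" "w \<in> borel_measurable borel"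
    and pu: "periodic u" and pw: "periodic w"
    and iu: "integrable (lborel_on per_box) u" and iw: "integrable (lborel_on per_box) w"
    and b: "b \<in> Basis" and h: "0 \<le> h" "h \<le> 2"
    and weak: "\<And>\<phi>. smooth \<phi> \<Longrightarrow> periodic \<phi> \<Longrightarrow>
      (LINT x|lborel_on per_box. u x * frechet_derivative \<phi> (at x) b) = - (LINT x|lborel_on per_box. w x * \<phi> x)"
  shows "AE x in lborel_on per_box. u (x + h *\<^sub>R b) - u x = (LINT s|lborel_on {0..h}. w (x + s *\<^sub>R b))"
proof -
  let ?\<mu> = "lborel_on (per_box :: 'a set)" and ?\<nu> = "lborel_on {0..h}"
  interpret N: finite_measure ?\<nu>
    using h by (intro finite_measure_lborel_on) auto
  interpret pair_sigma_finite ?\<mu> ?\<nu> ..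
  have N_AE: "AE s in ?\<nu>. 0 \<le> s \<and> s \<le> 2"
    using h by (subst AE_lborel_on) (auto intro!: AE_I2)
  have shift_le: "AE s in ?\<nu>. (\<integral>\<^sup>+x. ennreal (norm (w (x + s *\<^sub>R b))) \<partial>?\<mu>) \<le> (LINT x|?\<mu>. norm (w x))"
    using N_AE
  proof eventually_elim
    case (elim s)
    have "(\<integral>\<^sup>+x. ennreal (norm (w (x + s *\<^sub>R b))) \<partial>?\<mu>) = (\<integral>\<^sup>+x. ennreal (norm (w x)) \<partial>?\<mu>)"
      using elim pw b by (intro nn_integral_per_box_shift) (auto simp: periodic_def)
    also have "\<dots> = (LINT x|?\<mu>. norm (w x))"
      using iw by (intro nn_integral_eq_integral) auto
    finally show ?case by simp
  qed
  have W: "integrable (?\<mu> \<Otimes>\<^sub>M ?\<nu>) (\<lambda>(x, s). w (x + s *\<^sub>R b))"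
    using shift_le by (intro integrable_pair_bounded[where I="LINT x|?\<mu>. norm (w x)"]
        per_box.finite_measure_axioms N.finite_measure_axioms) (simp_all add: split_beta')
  define G where "G x = (LINT s|?\<nu>. w (x + s *\<^sub>R b))" for x
  have [measurable]: "G \<in> borel_measurable borel"
    unfolding G_def[abs_def] by measurable
  have iG: "integrable ?\<mu> G"
    unfolding G_def[abs_def] using W by (rule integrable_fst)
  have ius: "integrable ?\<mu> (\<lambda>x. u (x + h *\<^sub>R b))"
    using iu integrable_per_box_shift[OF _ pu b h] by simp
  define F where "F x = u (x + h *\<^sub>R b) - u x - G x" for x
  have [measurable]: "F \<in> borel_measurable borel"
    unfolding F_def[abs_def] by measurable
  have iF: "integrable ?\<mu> F"
    unfolding F_def[abs_def] using iG ius iu by (intro Bochner_Integration.integrable_diff)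
  have "AE x in lborel. x \<in> per_box \<longrightarrow> F x = 0"
  proof (rule periodic_du_Bois_Reymond)
    show "set_integrable lborel per_box F"
      using iF by (simp add: integrable_lborel_on)
    fix \<phi> :: "'a \<Rightarrow> real" assume \<phi>: "smooth \<phi>" "periodic \<phi>"
    let ?D = "\<lambda>x. frechet_derivative \<phi> (at x) b"
    have D: "continuous_on UNIV ?D" "periodic ?D"
      using smooth_continuous_derivative periodic_derivative \<phi> by blast+
    have [measurable]: "\<phi> \<in> borel_measurable borel" "?D \<in> borel_measurable borel"
      by (intro borel_measurable_continuous_onI smooth_continuous \<phi> D)+
    obtain C where C: "\<And>x. \<bar>\<phi> x\<bar> \<le> C"
      using periodic_continuous_bounded[OF \<phi>(2) smooth_continuous[OF \<phi>(1)]] by blast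
    obtain C' where C': "\<And>x. \<bar>?D x\<bar> \<le> C'"
      using periodic_continuous_bounded[OF D(2) D(1)] by blast
    have mult_int: "integrable ?\<mu> (\<lambda>x. f x * g x)"
      if "integrable ?\<mu> f" "g \<in> borel_measurable borel" "\<And>x. \<bar>g x\<bar> \<le> K" for f g :: "'a \<Rightarrow> real" and K
    proof (rule Bochner_Integration.integrable_bound)
      show "integrable ?\<mu> (\<lambda>x. K * f x)" using that by simp
      show "(\<lambda>x. f x * g x) \<in> borel_measurable ?\<mu>" using that by measurable
      have "\<bar>g x\<bar> \<le> \<bar>K\<bar>" for x using that(3) abs_ge_self order_trans by blast
      then show "AE x in ?\<mu>. norm (f x * g x) \<le> norm (K * f x)"
        by (intro AE_I2) (simp add: abs_mult_le_abs_mult)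
    qed
    \<comment> \<open>\<open>WD\<close> and \<open>W\<phi>\<close> justify the two exchanges of
      integration, before and after the weak identity is used.\<close>
    have WD: "integrable (?\<mu> \<Otimes>\<^sub>M ?\<nu>) (\<lambda>(x, s). u x * ?D (x + (- s) *\<^sub>R b))"
    proof (rule integrable_pair_bounded[where I="LINT x|?\<mu>. norm (C' * u x)"])
      show "AE s in ?\<nu>. (\<integral>\<^sup>+x. ennreal (norm (case (x, s) of (x, s) \<Rightarrow> u x * ?D (x + (- s) *\<^sub>R b))) \<partial>?\<mu>)
          \<le> ennreal (LINT x|?\<mu>. norm (C' * u x))"
      proof (rule AE_I2)
        fix s
        have "(\<integral>\<^sup>+x. ennreal (norm (u x * ?D (x + (- s) *\<^sub>R b))) \<partial>?\<mu>) \<le> (\<integral>\<^sup>+x. ennreal (norm (C' * u x)) \<partial>?\<mu>)"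
        proof (intro nn_integral_mono ennreal_leI)
          fix x
          have "\<bar>?D (x + (- s) *\<^sub>R b)\<bar> \<le> \<bar>C'\<bar>" using C' abs_ge_self order_trans by blast
          then show "norm (u x * ?D (x + (- s) *\<^sub>R b)) \<le> norm (C' * u x)"
            by (simp add: abs_mult_le_abs_mult)
        qed
        also have "\<dots> = (LINT x|?\<mu>. norm (C' * u x))"
          using iu by (intro nn_integral_eq_integral) auto
        finally show "(\<integral>\<^sup>+x. ennreal (norm (case (x, s) of (x, s) \<Rightarrow> u x * ?D (x + (- s) *\<^sub>R b))) \<partial>?\<mu>)
          \<le> ennreal (LINT x|?\<mu>. norm (C' * u x))" by simp
      qed
    qed (use per_box.finite_measure_axioms N.finite_measure_axioms in \<open>simp_all\<close>)
    have W\<phi>: "integrable (?\<mu> \<Otimes>\<^sub>M ?\<nu>) (\<lambda>(x, s). w (x + s *\<^sub>R b) * \<phi> x)"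
    proof (rule Bochner_Integration.integrable_bound)
      show "integrable (?\<mu> \<Otimes>\<^sub>M ?\<nu>) (\<lambda>z. C * (case z of (x, s) \<Rightarrow> w (x + s *\<^sub>R b)))"
        using W by simp
      have "\<bar>\<phi> x\<bar> \<le> \<bar>C\<bar>" for x using C abs_ge_self order_trans by blast
      then show "AE z in ?\<mu> \<Otimes>\<^sub>M ?\<nu>. norm (case z of (x, s) \<Rightarrow> w (x + s *\<^sub>R b) * \<phi> x)
          \<le> norm (C * (case z of (x, s) \<Rightarrow> w (x + s *\<^sub>R b)))"
        by (intro AE_I2) (simp add: split_beta' abs_mult_le_abs_mult)
    qed measurable
    have "(LINT x|?\<mu>. u (x + h *\<^sub>R b) * \<phi> x) = (LINT x|?\<mu>. u (x + h *\<^sub>R b) * \<phi> ((x + h *\<^sub>R b) + (- h) *\<^sub>R b))"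
      by simp
    also have "\<dots> = (LINT x|?\<mu>. u x * \<phi> (x + (- h) *\<^sub>R b))"
      using pu periodic_shift[OF \<phi>(2), of "(- h) *\<^sub>R b"] b h
      by (intro integral_per_box_shift[where f="\<lambda>x. u x * \<phi> (x + (- h) *\<^sub>R b)"]) (auto simp: periodic_def)
    finally have shifted: "(LINT x|?\<mu>. u (x + h *\<^sub>R b) * \<phi> x) = (LINT x|?\<mu>. u x * \<phi> (x + (- h) *\<^sub>R b))" .
    have iu\<phi>: "integrable ?\<mu> (\<lambda>x. u x * \<phi> (x + v))" for v
      using C by (intro mult_int[OF iu]) measurable
    have "(LINT x|?\<mu>. u x * \<phi> x) - (LINT x|?\<mu>. u (x + h *\<^sub>R b) * \<phi> x) =
        (LINT x|?\<mu>. u x * \<phi> x - u x * \<phi> (x + (- h) *\<^sub>R b))"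
      unfolding shifted using iu\<phi>[of 0] iu\<phi>[of "(- h) *\<^sub>R b"]
      by (intro Bochner_Integration.integral_diff[symmetric]) simp_all
    also have "\<dots> = (LINT x|?\<mu>. LINT s|?\<nu>. u x * ?D (x + (- s) *\<^sub>R b))"
      by (simp only: integral_mult_right_zero smooth_FTC[OF \<phi>(1) h(1)] right_diff_distrib)
    also have "\<dots> = (LINT s|?\<nu>. LINT x|?\<mu>. u x * ?D (x + (- s) *\<^sub>R b))"
      using WD by (rule Fubini_integral[symmetric])
    also have "\<dots> = (LINT s|?\<nu>. - (LINT x|?\<mu>. w (x + s *\<^sub>R b) * \<phi> x))"
    proof (rule integral_cong_AE)
      show "AE s in ?\<nu>. (LINT x|?\<mu>. u x * ?D (x + (- s) *\<^sub>R b)) = - (LINT x|?\<mu>. w (x + s *\<^sub>R b) * \<phi> x)"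
        using N_AE
      proof eventually_elim
        case (elim s)
        have "(LINT x|?\<mu>. u x * ?D (x + (- s) *\<^sub>R b)) = - (LINT x|?\<mu>. w x * \<phi> (x + (- s) *\<^sub>R b))"
          using weak[OF smooth_shift[OF \<phi>(1)] periodic_shift[OF \<phi>(2)], of "(- s) *\<^sub>R b"]
            frechet_derivative_shift[OF smooth_differentiable[OF \<phi>(1)], of "(- s) *\<^sub>R b"] by simp
        also have "(LINT x|?\<mu>. w x * \<phi> (x + (- s) *\<^sub>R b)) =
            (LINT x|?\<mu>. w (x + s *\<^sub>R b) * \<phi> ((x + s *\<^sub>R b) + (- s) *\<^sub>R b))"
          using pw periodic_shift[OF \<phi>(2), of "(- s) *\<^sub>R b"] b elim
          by (intro integral_per_box_shift[where f="\<lambda>x. w x * \<phi> (x + (- s) *\<^sub>R b)", symmetric])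
             (auto simp: periodic_def)
        finally show ?case by simp
      qed
    qed measurable
    also have "\<dots> = - (LINT x|?\<mu>. LINT s|?\<nu>. w (x + s *\<^sub>R b) * \<phi> x)"
      using Fubini_integral[OF W\<phi>] by simp
    also have "\<dots> = - (LINT x|?\<mu>. G x * \<phi> x)"
      by (simp add: G_def)
    finally have "(LINT x|?\<mu>. u (x + h *\<^sub>R b) * \<phi> x) - (LINT x|?\<mu>. u x * \<phi> x) - (LINT x|?\<mu>. G x * \<phi> x) = 0"
      by simp
    moreover have "integrable ?\<mu> (\<lambda>x. f x * \<phi> x)" if "integrable ?\<mu> f" for f
      using C by (intro mult_int that) measurable
    ultimately have "(LINT x|?\<mu>. F x * \<phi> x) = 0"
      using iu ius iG by (simp add: F_def left_diff_distrib)
    then show "(LINT x:per_box|lborel. F x * \<phi> x) = 0"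
      by (simp add: integral_lborel_on)
  qed
  then show ?thesis
    by (simp add: AE_lborel_on F_def G_def)
qed

section \<open>Integrability of the weight\<close>

lemma ennreal_le_suminf:
  fixes f :: "nat \<Rightarrow> ennreal"
  shows "f j \<le> (\<Sum>j. f j)"
  using sum_le_suminf[of f "{j}"] by simp

text \<open>Dyadic layers: where \<open>2^-(j+1) \<le> d < 2^-j\<close> the integrand is at most
  \<open>q^(j+1)\<close>, and this layer has measure at most \<open>C 2^-j\<close>. The sum is
  geometric with ratio \<open>q / 2 = 2^(\<sigma> - 1)\<close>, which is below 1 because
  \<open>\<sigma> < 1\<close>.\<close>

lemma nn_integral_powr_finite:
  fixes d :: "'a \<Rightarrow> real"
  assumes "finite_measure M" and [measurable]: "d \<in> borel_measurable M" and d0: "\<And>x. 0 \<le> d x"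
    and C: "0 \<le> C" "\<And>\<epsilon>. 0 < \<epsilon> \<Longrightarrow> \<epsilon> \<le> 1 \<Longrightarrow> emeasure M {x \<in> space M. d x < \<epsilon>} \<le> ennreal (C * \<epsilon>)"
    and \<sigma>: "0 \<le> \<sigma>" "\<sigma> < 1"
  shows "(\<integral>\<^sup>+x. ennreal (d x powr - \<sigma>) \<partial>M) < \<infinity>"
proof -
  interpret finite_measure M by fact
  define q where "q = 2 powr \<sigma>"
  have q: "0 < q" "q < 2"
    using \<sigma> powr_less_mono[of \<sigma> 1 2] by (auto simp: q_def)
  let ?S = "\<lambda>j x. ennreal (q ^ Suc j) * indicator {x \<in> space M. d x < (1/2) ^ j} x"
  have pw: "ennreal (d x powr - \<sigma>) \<le> 1 + (\<Sum>j. ?S j x)" if x: "x \<in> space M" for x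
  \<comment> \<open>Since \<open>0 powr _ = 0\<close>, the zero set of \<open>d\<close> belongs to
    the harmless case.\<close>
  proof (cases "d x = 0 \<or> 1 \<le> d x")
    case True
    then have "d x powr - \<sigma> \<le> 1"
      using \<sigma> powr_mono2'[of "- \<sigma>" 1 "d x"] by auto
    then have "ennreal (d x powr - \<sigma>) \<le> 1" by simp
    also have "\<dots> \<le> 1 + (\<Sum>j. ?S j x)" by simp
    finally show ?thesis .
  next
    case False
    then have dx: "0 < d x" "d x < 1" using d0[of x] by auto
    then have "\<exists>m. (1/2) ^ m < d x"
      using real_arch_pow_inv[of "d x" "1/2"] by auto
    then have ex: "\<exists>m. (1/2) ^ m \<le> d x" by (meson less_imp_le)
    define m where "m = (LEAST m. (1/2 :: real) ^ m \<le> d x)"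
    have m: "(1/2) ^ m \<le> d x" unfolding m_def using LeastI_ex[OF ex] .
    then have "m \<noteq> 0" using dx by (intro notI) simp
    then obtain j where j: "m = Suc j" by (cases m) auto
    have "\<not> (1/2) ^ j \<le> d x" using not_less_Least[of j "\<lambda>m. (1/2 :: real) ^ m \<le> d x"] j by (auto simp: m_def)
    then have dj: "d x < (1/2) ^ j" by simp
    have "d x powr - \<sigma> \<le> ((1/2) ^ Suc j) powr - \<sigma>"
      using m \<sigma> j by (intro powr_mono2') auto
    also have "((1/2 :: real) ^ Suc j) = 2 powr - real (Suc j)"
      by (simp add: powr_minus powr_realpow power_one_over inverse_eq_divide del: power_Suc of_nat_Suc)
    also have "(2 powr - real (Suc j)) powr - \<sigma> = q ^ Suc j"
      unfolding q_def by (simp add: powr_powr powr_power mult.commute del: power_Suc of_nat_Suc)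
    finally have "ennreal (d x powr - \<sigma>) \<le> ennreal (q ^ Suc j)" by (rule ennreal_leI)
    also have "\<dots> = ?S j x" using dj x by simp
    also have "\<dots> \<le> (\<Sum>j. ?S j x)"
      by (rule ennreal_le_suminf)
    also have "\<dots> \<le> 1 + (\<Sum>j. ?S j x)" by simp
    finally show ?thesis .
  qed
  have "(\<integral>\<^sup>+x. ennreal (d x powr - \<sigma>) \<partial>M) \<le> (\<integral>\<^sup>+x. 1 + (\<Sum>j. ?S j x) \<partial>M)"
    by (intro nn_integral_mono pw)
  also have "\<dots> = emeasure M (space M) + (\<Sum>j. \<integral>\<^sup>+x. ?S j x \<partial>M)"
    by (subst nn_integral_add) (simp_all add: nn_integral_suminf)
  also have "\<dots> \<le> emeasure M (space M) + (\<Sum>j. ennreal (C * q * (q / 2) ^ j))"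
  proof (intro add_left_mono suminf_le summableI)
    fix j
    have "(\<integral>\<^sup>+x. ?S j x \<partial>M) = ennreal (q ^ Suc j) * emeasure M {x \<in> space M. d x < (1/2) ^ j}"
      by (subst nn_integral_cmult_indicator) simp_all
    also have "\<dots> \<le> ennreal (q ^ Suc j) * ennreal (C * (1/2) ^ j)"
      by (intro mult_left_mono C(2)) (auto simp: power_le_one)
    also have "\<dots> = ennreal (C * q * (q / 2) ^ j)"
      using q C(1) by (simp add: power_divide mult_ac flip: ennreal_mult)
    finally show "(\<integral>\<^sup>+x. ?S j x \<partial>M) \<le> ennreal (C * q * (q / 2) ^ j)" .
  qed
  also have "(\<Sum>j. ennreal (C * q * (q / 2) ^ j)) = ennreal (C * q * (1 / (1 - q / 2)))"
    using q C(1) by (intro suminf_ennreal_eq sums_mult geometric_sums) auto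
  also have "emeasure M (space M) + \<dots> < \<infinity>"
    using emeasure_finite by (simp add: less_top[symmetric])
  finally show ?thesis .
qed

section \<open>Covering numbers and neighbourhoods of the interface\<close>

lemma emeasure_lborel_cball_le:
  fixes y :: "'a::euclidean_space"
  assumes "0 \<le> s"
  shows "emeasure lborel (cball y s) \<le> ennreal ((2 * s) ^ DIM('a))"
proof -
  have "cball y s \<subseteq> cbox (y - s *\<^sub>R One) (y + s *\<^sub>R One)"
  proof
    fix x assume x: "x \<in> cball y s"
    have "\<bar>(x - y) \<bullet> b\<bar> \<le> s" if "b \<in> Basis" for b
      using Basis_le_norm[OF that, of "x - y"] x by (simp add: dist_norm norm_minus_commute)
    then show "x \<in> cbox (y - s *\<^sub>R One) (y + s *\<^sub>R One)"
      by (force simp: mem_box inner_diff_left inner_add_left abs_le_iff)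
  qed
  then have "emeasure lborel (cball y s) \<le> emeasure lborel (cbox (y - s *\<^sub>R One) (y + s *\<^sub>R One))"
    by (intro emeasure_mono) auto
  also have "\<dots> = ennreal (\<Prod>b\<in>(Basis :: 'a set). 2 * s)"
    using assms by (subst emeasure_lborel_cbox_eq) (auto simp: inner_diff_left inner_add_left intro!: arg_cong[where f=ennreal] prod.cong)
  finally show ?thesis by simp
qed

text \<open>A point within \<open>\<epsilon>\<close> of the set is within
  \<open>2 \<epsilon>\<close> of a centre of the cover, and such a ball lies in a cube of side
  \<open>4 \<epsilon>\<close>.\<close>

lemma emeasure_infdist_less:
  fixes \<Gamma> :: "'a::euclidean_space set"
  assumes "\<Gamma> \<noteq> {}" "finite F" "\<Gamma> \<subseteq> (\<Union>y\<in>F. cball y \<epsilon>)" "0 < \<epsilon>"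
  shows "emeasure lborel {x. infdist x \<Gamma> < \<epsilon>} \<le> ennreal (real (card F) * (4 * \<epsilon>) ^ DIM('a))"
proof -
  have "{x. infdist x \<Gamma> < \<epsilon>} \<subseteq> (\<Union>y\<in>F. cball y (2 * \<epsilon>))"
  proof
    fix x assume "x \<in> {x. infdist x \<Gamma> < \<epsilon>}"
    then have "(INF a\<in>\<Gamma>. dist x a) < \<epsilon>" using assms(1) by (simp add: infdist_def)
    then obtain a where a: "a \<in> \<Gamma>" "dist x a < \<epsilon>"
      using cInf_lessD[of "dist x ` \<Gamma>" \<epsilon>] assms(1) by auto
    then obtain y where y: "y \<in> F" "dist y a \<le> \<epsilon>" using assms(3) by auto
    have "dist y x \<le> 2 * \<epsilon>" using a(2) y(2) dist_triangle[of y x a] by (simp add: dist_commute)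
    with y(1) show "x \<in> (\<Union>y\<in>F. cball y (2 * \<epsilon>))" by auto
  qed
  then have "emeasure lborel {x. infdist x \<Gamma> < \<epsilon>} \<le> emeasure lborel (\<Union>y\<in>F. cball y (2 * \<epsilon>))"
    using assms(2) by (intro emeasure_mono) auto
  also have "\<dots> \<le> (\<Sum>y\<in>F. emeasure lborel (cball y (2 * \<epsilon>)))"
    using assms(2) by (intro emeasure_subadditive_finite) auto
  also have "\<dots> \<le> (\<Sum>y\<in>F. ennreal ((2 * (2 * \<epsilon>)) ^ DIM('a)))"
    using assms(4) by (intro sum_mono emeasure_lborel_cball_le) simp
  also have "\<dots> = ennreal (real (card F) * (4 * \<epsilon>) ^ DIM('a))"
    using assms(4) by (simp add: ennreal_mult ennreal_of_nat_eq_real_of_nat)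
  finally show ?thesis .
qed

lemma smooth_lipschitz_unit_interval:
  fixes \<gamma> :: "real \<Rightarrow> 'a::euclidean_space"
  assumes "smooth \<gamma>"
  obtains L where "0 < L" "\<And>s t. s \<in> {0..1} \<Longrightarrow> t \<in> {0..1} \<Longrightarrow> dist (\<gamma> s) (\<gamma> t) \<le> L * \<bar>s - t\<bar>"
proof -
  let ?D = "\<lambda>t. frechet_derivative \<gamma> (at t)"
  have "bounded ((\<lambda>t. ?D t 1) ` {0..1})"
    by (intro compact_imp_bounded compact_continuous_image
        continuous_on_subset[OF smooth_continuous_derivative[OF assms]]) auto
  then obtain L where L: "0 < L" "\<And>t. t \<in> {0..1} \<Longrightarrow> norm (?D t 1) \<le> L"
    unfolding bounded_pos by auto
  have der: "(\<gamma> has_derivative ?D t) (at t)" for t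
    using smooth_differentiable[OF assms] frechet_derivative_works by blast
  have "norm (\<gamma> s - \<gamma> t) \<le> L * norm (s - t)" if "s \<in> {0..1}" "t \<in> {0..1}" for s t
  proof (rule differentiable_bound[of "{0..1}" \<gamma> ?D])
    fix t :: real assume t: "t \<in> {0..1}"
    show "(\<gamma> has_derivative ?D t) (at t within {0..1})"
      using der by (rule has_derivative_at_withinI)
    show "onorm (?D t) \<le> L"
    proof (rule onorm_le)
      fix h
      have "?D t h = h *\<^sub>R ?D t 1"
        using linear_cmul[OF linear_frechet_derivative[OF smooth_differentiable[OF assms]], of t h 1] by simp
      then show "norm (?D t h) \<le> L * norm h"
        using L(2)[OF t] by (simp add: mult.commute[of "\<bar>h\<bar>"] mult_right_mono)
    qed
  qed (use that in auto)
  then show ?thesis using L(1) that by (auto simp: dist_norm)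
qed

text \<open>Codimension one, expressed by covering numbers: in dimension \<open>n\<close> about
  \<open>\<epsilon>^(1 - n)\<close> balls suffice. In dimension one the interface is two points; in
  the plane a curve that is Lipschitz on a compact parameter interval is cut into about
  \<open>L / \<epsilon>\<close> short arcs.\<close>

lemma interface_covering:
  fixes \<Gamma> :: "'a::euclidean_space set"
  assumes "DIM('a) \<in> {1, 2}" "interface \<Gamma>"
  obtains C where "0 \<le> C" "\<And>\<epsilon>. 0 < \<epsilon> \<Longrightarrow> \<epsilon> \<le> 1 \<Longrightarrow>
    \<exists>F. finite F \<and> \<Gamma> \<subseteq> (\<Union>y\<in>F. cball y \<epsilon>) \<and> real (card F) * \<epsilon> ^ DIM('a) \<le> C * \<epsilon>"
proof (cases "DIM('a) = 1")
  case True
  then obtain b :: 'a where b: "Basis = {b}" by (auto simp: card_1_singleton_iff)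
  then have \<Gamma>: "\<Gamma> = {(-1/2) *\<^sub>R b, (1/2) *\<^sub>R b}"
    using assms(2) True by (auto simp: interface_def)
  have *: "finite \<Gamma> \<and> \<Gamma> \<subseteq> (\<Union>y\<in>\<Gamma>. cball y \<epsilon>) \<and> real (card \<Gamma>) * \<epsilon> ^ DIM('a) \<le> 2 * \<epsilon>" if "0 < \<epsilon>" for \<epsilon>
  proof -
    have "card \<Gamma> \<le> 2" unfolding \<Gamma> by (rule order_trans[OF card_insert_le_m1]) auto
    with that True show ?thesis by (auto simp: \<Gamma>)
  qed
  show ?thesis
  proof (rule that[of 2])
    show "\<exists>F. finite F \<and> \<Gamma> \<subseteq> (\<Union>y\<in>F. cball y \<epsilon>) \<and> real (card F) * \<epsilon> ^ DIM('a) \<le> 2 * \<epsilon>"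
      if "0 < \<epsilon>" for \<epsilon> using *[OF that] by (rule exI)
  qed simp
next
  case False
  then have dim: "DIM('a) = 2" using assms(1) by auto
  from assms(2) False obtain \<gamma> :: "real \<Rightarrow> 'a" where \<gamma>: "smooth \<gamma>" "\<Gamma> = \<gamma> ` {0..<1}"
    by (auto simp: interface_def smooth_closed_curve_def)
  obtain L where L: "0 < L" "\<And>s t. s \<in> {0..1} \<Longrightarrow> t \<in> {0..1} \<Longrightarrow> dist (\<gamma> s) (\<gamma> t) \<le> L * \<bar>s - t\<bar>"
    using smooth_lipschitz_unit_interval[OF \<gamma>(1)] by blast
  have "\<exists>F. finite F \<and> \<Gamma> \<subseteq> (\<Union>y\<in>F. cball y \<epsilon>) \<and> real (card F) * \<epsilon> ^ DIM('a) \<le> (L + 1) * \<epsilon>"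
    if \<epsilon>: "0 < \<epsilon>" "\<epsilon> \<le> 1" for \<epsilon>
  proof -
    \<comment> \<open>Neighbouring parameters are \<open>1 / m\<close> apart, so their images are at
      most \<open>L / m \<le> \<epsilon>\<close> apart. Rounding up costs one more ball, absorbed
      into the constant \<open>L + 1\<close> by \<open>\<epsilon> \<le> 1\<close>.\<close>
    define m where "m = nat \<lceil>L / \<epsilon>\<rceil>"
    have m: "L / \<epsilon> \<le> real m" "real m \<le> L / \<epsilon> + 1"
      using L(1) \<epsilon> by (auto simp: m_def)
    have m0: "0 < real m" by (rule less_le_trans[OF divide_pos_pos[OF L(1) \<epsilon>(1)] m(1)])
    let ?F = "(\<lambda>i. \<gamma> (real i / real m)) ` {..<m}"
    have "\<Gamma> \<subseteq> (\<Union>y\<in>?F. cball y \<epsilon>)"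
    proof
      fix x assume "x \<in> \<Gamma>"
      then obtain t where t: "x = \<gamma> t" "0 \<le> t" "t < 1" using \<gamma>(2) by auto
      define i where "i = nat \<lfloor>t * real m\<rfloor>"
      have i: "real i \<le> t * real m" "t * real m < real i + 1"
        using t m0 by (auto simp: i_def)
      have tm: "t * real m < real m" using t m0 by simp
      have im: "i < m" using i(1) tm by linarith
      have "real i / real m \<le> t" "t \<le> real i / real m + 1 / real m"
        using i m0 by (simp_all add: divide_le_eq le_divide_eq flip: add_divide_distrib)
      then have "\<bar>real i / real m - t\<bar> \<le> 1 / real m" by linarith
      then have "L * \<bar>real i / real m - t\<bar> \<le> L * (1 / real m)"
        using L(1) by (intro mult_left_mono) auto
      also have "\<dots> \<le> \<epsilon>" using m(1) \<epsilon>(1) m0 by (simp add: field_simps)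
      finally have "dist (\<gamma> (real i / real m)) x \<le> \<epsilon>"
        unfolding t(1) using L(2)[of "real i / real m" t] t(2,3) im by (simp add: divide_le_eq)
      then show "x \<in> (\<Union>y\<in>?F. cball y \<epsilon>)" using im by auto
    qed
    moreover have "real (card ?F) * \<epsilon> ^ DIM('a) \<le> (L + 1) * \<epsilon>"
    proof -
      have "card ?F \<le> m" using card_image_le[of "{..<m}" "\<lambda>i. \<gamma> (real i / real m)"] by simp
      then have "real (card ?F) * \<epsilon>\<^sup>2 \<le> (L / \<epsilon> + 1) * \<epsilon>\<^sup>2"
        using m(2) by (intro mult_right_mono) auto
      also have "\<dots> = L * \<epsilon> + \<epsilon> * \<epsilon>" using \<epsilon>(1) by (simp add: power2_eq_square distrib_right)
      also have "\<dots> \<le> L * \<epsilon> + 1 * \<epsilon>" using \<epsilon> by (intro add_left_mono mult_right_mono) auto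
      finally show ?thesis by (simp add: dim distrib_right)
    qed
    ultimately show ?thesis by blast
  qed
  then show ?thesis using L(1) by (intro that[of "L + 1"]) auto
qed

lemma dist_pow_measurable [measurable]: "dist_pow \<Gamma> \<sigma> \<in> borel_measurable borel"
proof -
  have "(\<lambda>x. infdist x \<Gamma>) \<in> borel_measurable borel"
    by (intro borel_measurable_continuous_onI continuous_intros)
  then show ?thesis unfolding dist_pow_def[abs_def] by measurable
qed

text \<open>Coverings by balls make the measure of an \<open>\<epsilon>\<close>-neighbourhood at
  most linear in \<open>\<epsilon>\<close>, which is the hypothesis of the dyadic estimate.
  Positivity is a separate claim: as \<open>inverse 0 = 0\<close>, finiteness of the integral does
  not exclude a weight that vanishes on a large set.\<close>

lemma interface_weight:
  fixes \<Gamma> :: "'a::euclidean_space set"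
  assumes "DIM('a) \<in> {1, 2}" "interface \<Gamma>" and \<sigma>: "0 \<le> \<sigma>" "\<sigma> < 1"
  shows "(\<integral>\<^sup>+x. ennreal (inverse (dist_pow \<Gamma> \<sigma> x)) \<partial>lborel_on per_box) < \<infinity>"
    and "AE x in lborel_on per_box. 0 < dist_pow \<Gamma> \<sigma> x"
proof -
  let ?M = "lborel_on (per_box :: 'a set)"
  have ne: "\<Gamma> \<noteq> {}"
  proof (cases "DIM('a) = 1")
    case True
    obtain b :: 'a where "b \<in> Basis" using nonempty_Basis by blast
    then have "(1/2) *\<^sub>R b \<in> \<Gamma>" using True assms(2) by (auto simp: interface_def)
    then show ?thesis by blast
  next
    case False
    then show ?thesis using assms(2) by (auto simp: interface_def smooth_closed_curve_def)
  qed
  have [measurable]: "(\<lambda>x. infdist x \<Gamma>) \<in> borel_measurable borel"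
    by (intro borel_measurable_continuous_onI continuous_intros)
  obtain C where C: "0 \<le> C" "\<And>\<epsilon>. 0 < \<epsilon> \<Longrightarrow> \<epsilon> \<le> 1 \<Longrightarrow>
    \<exists>F. finite F \<and> \<Gamma> \<subseteq> (\<Union>y\<in>F. cball y \<epsilon>) \<and> real (card F) * \<epsilon> ^ DIM('a) \<le> C * \<epsilon>"
    using interface_covering[OF assms(1,2)] by blast
  define C' where "C' = 4 ^ DIM('a) * C"
  have small: "emeasure ?M {x \<in> space ?M. infdist x \<Gamma> < \<epsilon>} \<le> ennreal (C' * \<epsilon>)" if \<epsilon>: "0 < \<epsilon>" "\<epsilon> \<le> 1" for \<epsilon>
  proof -
    obtain F where F: "finite F" "\<Gamma> \<subseteq> (\<Union>y\<in>F. cball y \<epsilon>)" "real (card F) * \<epsilon> ^ DIM('a) \<le> C * \<epsilon>"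
      using C(2)[OF \<epsilon>] by blast
    have "emeasure ?M {x \<in> space ?M. infdist x \<Gamma> < \<epsilon>} \<le> emeasure lborel {x. infdist x \<Gamma> < \<epsilon>}"
      by (subst emeasure_lborel_on) (auto intro!: emeasure_mono)
    also have "\<dots> \<le> ennreal (real (card F) * (4 * \<epsilon>) ^ DIM('a))"
      by (rule emeasure_infdist_less[OF ne F(1,2) \<epsilon>(1)])
    also have "\<dots> \<le> ennreal (C' * \<epsilon>)"
    proof (rule ennreal_leI)
      have "real (card F) * (4 * \<epsilon>) ^ DIM('a) = 4 ^ DIM('a) * (real (card F) * \<epsilon> ^ DIM('a))"
        by (simp add: power_mult_distrib)
      also have "\<dots> \<le> 4 ^ DIM('a) * (C * \<epsilon>)" by (intro mult_left_mono F(3)) simp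
      finally show "real (card F) * (4 * \<epsilon>) ^ DIM('a) \<le> C' * \<epsilon>" by (simp add: C'_def mult.assoc)
    qed
    finally show ?thesis .
  qed
  have C': "0 \<le> C'" using C(1) by (simp add: C'_def)
  show "(\<integral>\<^sup>+x. ennreal (inverse (dist_pow \<Gamma> \<sigma> x)) \<partial>?M) < \<infinity>"
  proof (cases "\<sigma> = 0")
    case True
    then show ?thesis using per_box.emeasure_finite by (simp add: dist_pow_def less_top[symmetric])
  next
    case False
    then have "inverse (dist_pow \<Gamma> \<sigma> x) = infdist x \<Gamma> powr - \<sigma>" for x
      by (simp add: dist_pow_def powr_minus)
    then show ?thesis
      using nn_integral_powr_finite[OF per_box.finite_measure_axioms _ infdist_nonneg C' small \<sigma>]
      by simp
  qed
  \<comment> \<open>The zero set lies in every neighbourhood of radius \<open>2^-j\<close>, and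
    their measures tend to 0.\<close>
  have "emeasure ?M {x. infdist x \<Gamma> = 0} \<le> ennreal (C' * (1/2) ^ j)" for j :: nat
  proof -
    have "emeasure ?M {x. infdist x \<Gamma> = 0} \<le> emeasure ?M {x \<in> space ?M. infdist x \<Gamma> < (1/2) ^ j}"
      by (intro emeasure_mono) auto
    also have "\<dots> \<le> ennreal (C' * (1/2) ^ j)" by (intro small) (auto simp: power_le_one)
    finally show ?thesis .
  qed
  moreover have "(\<lambda>j. ennreal (C' * (1/2) ^ j)) \<longlonglongrightarrow> ennreal (C' * 0)"
    by (intro tendsto_ennrealI tendsto_mult tendsto_const LIMSEQ_power_zero) auto
  ultimately have "emeasure ?M {x. infdist x \<Gamma> = 0} \<le> ennreal (C' * 0)"
    by (intro LIMSEQ_le_const) auto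
  then have "AE x in ?M. infdist x \<Gamma> \<noteq> 0"
    by (intro AE_I[where N="{x. infdist x \<Gamma> = 0}"]) auto
  then show "AE x in ?M. 0 < dist_pow \<Gamma> \<sigma> x"
    by eventually_elim (use infdist_nonneg in \<open>auto simp: dist_pow_def less_le\<close>)
qed

section \<open>The Poincare inequality on a square\<close>

lemma borel_measurable_fst_snd [measurable (raw)]:
  fixes f :: "'a \<Rightarrow> 'b::second_countable_topology \<times> 'c::second_countable_topology"
  assumes "f \<in> borel_measurable M"
  shows "(\<lambda>w. fst (f w)) \<in> borel_measurable M" "(\<lambda>w. snd (f w)) \<in> borel_measurable M"
  by (auto intro!: measurable_compose[OF assms] borel_measurable_continuous_onI continuous_intros)

lemma nn_integral_lborel_on_Times:
  fixes f :: "real \<times> real \<Rightarrow> ennreal"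
  assumes [measurable]: "f \<in> borel_measurable borel" "J \<in> sets borel" "K \<in> sets borel"
  shows "(\<integral>\<^sup>+z. f z \<partial>lborel_on (J \<times> K)) = (\<integral>\<^sup>+x. \<integral>\<^sup>+y. f (x, y) \<partial>lborel_on K \<partial>lborel_on J)"
proof -
  have JK [measurable]: "J \<times> K \<in> sets borel"
    by (metis assms(2,3) borel_prod pair_measureI)
  have "(\<integral>\<^sup>+z. f z \<partial>lborel_on (J \<times> K)) = (\<integral>\<^sup>+z. f z * indicator (J \<times> K) z \<partial>(lborel \<Otimes>\<^sub>M lborel))"
    by (simp add: nn_integral_lborel_on lborel_prod)
  also have "\<dots> = (\<integral>\<^sup>+x. \<integral>\<^sup>+y. f (x, y) * indicator (J \<times> K) (x, y) \<partial>lborel \<partial>lborel)"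
    by (intro lborel.nn_integral_fst[symmetric]) (simp add: lborel_prod)
  also have "\<dots> = (\<integral>\<^sup>+x. (\<integral>\<^sup>+y. f (x, y) * indicator K y \<partial>lborel) * indicator J x \<partial>lborel)"
    by (auto intro!: nn_integral_cong split: split_indicator)
  also have "\<dots> = (\<integral>\<^sup>+x. \<integral>\<^sup>+y. f (x, y) \<partial>lborel_on K \<partial>lborel_on J)"
    by (simp add: nn_integral_lborel_on)
  finally show ?thesis .
qed

section \<open>Exchanging almost-everywhere quantifiers\<close>

lemma AE_lborel_commute:
  fixes P :: "'a::euclidean_space \<Rightarrow> 'b::euclidean_space \<Rightarrow> bool"
  assumes P: "Measurable.pred borel (\<lambda>z. P (fst z) (snd z))"
    and ae: "AE x in lborel. AE y in lborel. P x y"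
  shows "AE y in lborel. AE x in lborel. P x y"
proof -
  have "{z \<in> space (lborel \<Otimes>\<^sub>M lborel). P (fst z) (snd z)} \<in> sets (lborel \<Otimes>\<^sub>M lborel)"
    using P unfolding lborel_prod by (simp add: pred_def)
  from lborel_pair.AE_commute[OF this] ae show ?thesis by simp
qed

lemma AE_lborel_swap:
  fixes P :: "real \<times> real \<Rightarrow> bool"
  assumes "AE z in lborel. P z"
  shows "AE z in lborel. P (snd z, fst z)"
proof -
  have "AE z in lborel \<Otimes>\<^sub>M lborel. P z" using assms by (simp only: lborel_prod)
  then have "AE z in distr (lborel \<Otimes>\<^sub>M lborel) (lborel \<Otimes>\<^sub>M lborel) (\<lambda>(x, y). (y, x)). P z"
    by (simp only: lborel_pair.distr_pair_swap[symmetric])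
  from AE_distrD[OF measurable_pair_swap' this]
  have "AE z in lborel \<Otimes>\<^sub>M lborel. P (snd z, fst z)" by (simp add: split_beta')
  then show ?thesis by (simp only: lborel_prod)
qed

text \<open>Each \<open>h\<close> comes with its own null set, so no single point need be good for
  all \<open>h\<close>. Measurability of \<open>Q\<close> allows Fubini: almost every point is good
  for almost every \<open>h\<close>, and substituting \<open>x' = x + h\<close> frees the second
  abscissa. The three quantifier orders are those that the fourfold integral over pairs of points
  asks for.\<close>

lemma AE_translate_coordinate:
  fixes Q :: "real \<Rightarrow> real \<Rightarrow> real \<Rightarrow> bool"
  assumes meas: "Measurable.pred borel (\<lambda>(x, x', y). Q x x' y)"
    and ae: "\<And>h. AE z in lborel. Q (fst z) (fst z + h) (snd z)"
  shows "AE x in lborel. AE y in lborel. AE x' in lborel. Q x x' y"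
    and "AE x in lborel. AE x' in lborel. AE y in lborel. Q x x' y"
    and "AE y in lborel. AE x in lborel. AE x' in lborel. Q x x' y"
proof -
  have Qm: "Measurable.pred (M :: 'b measure) (\<lambda>w. Q (a w) (b w) (c w))"
    if "a \<in> borel_measurable M" "b \<in> borel_measurable M" "c \<in> borel_measurable M" for M a b c
  proof -
    have "(\<lambda>w. (a w, b w, c w)) \<in> M \<rightarrow>\<^sub>M borel"
      using that by measurable
    from measurable_compose[OF this meas] show ?thesis by simp
  qed
  have "AE h in lborel. AE z in lborel. Q (fst z) (fst z + h) (snd z)"
    using ae by simp
  then have "AE z in lborel. AE h in lborel. Q (fst z) (fst z + h) (snd z)"
    by (rule AE_lborel_commute[rotated]) (intro Qm; measurable)
  then have Z: "AE z in lborel. AE x' in lborel. Q (fst z) x' (snd z)"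
  proof eventually_elim
    case (elim z)
    from AE_lborel_shift[OF this, of "- fst z"] show ?case by simp
  qed
  have S: "AE z in lborel \<Otimes>\<^sub>M lborel. AE x' in lborel. Q (fst z) x' (snd z)"
    using Z by (simp only: lborel_prod)
  show 1: "AE x in lborel. AE y in lborel. AE x' in lborel. Q x x' y"
    using lborel_pair.AE_pair[OF S] by simp
  show "AE x in lborel. AE x' in lborel. AE y in lborel. Q x x' y"
    using 1
  proof eventually_elim
    case (elim x)
    then show ?case
      by (rule AE_lborel_commute[rotated]) (intro Qm; measurable)
  qed
  have "AE z in lborel \<Otimes>\<^sub>M lborel. AE x' in lborel. Q (snd z) x' (fst z)"
    using AE_lborel_swap[OF Z] by (simp only: lborel_prod fst_conv snd_conv)
  from lborel_pair.AE_pair[OF this]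
  show "AE y in lborel. AE x in lborel. AE x' in lborel. Q x x' y" by simp
qed

text \<open>Only the first coordinate moves; the other direction is the same predicate for the
  functions with swapped arguments. Increments up to 2 join any two points of the box that lie on
  such a line.\<close>

definition line_bound :: "(real \<times> real \<Rightarrow> real) \<Rightarrow> (real \<times> real \<Rightarrow> real) \<Rightarrow> bool" where
  "line_bound u G \<longleftrightarrow> (\<forall>h. 0 \<le> h \<and> h \<le> 2 \<longrightarrow>
     (AE (x, y) in lborel. x \<in> {-1..<1} \<longrightarrow> y \<in> {-1..<1} \<longrightarrow>
        ennreal \<bar>u (x + h, y) - u (x, y)\<bar> \<le> (\<integral>\<^sup>+s\<in>{0..h}. ennreal (G (x + s, y)) \<partial>lborel)))"

text \<open>The integral over the segment between \<open>x\<close> and \<open>x'\<close> is enlarged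
  to all of \<open>J\<close>, so that the bound depends on \<open>y\<close> alone; this is what
  later separates the variables. As \<open>J\<close> is an interval, the segment stays
  inside.\<close>

lemma line_bound_AE:
  fixes u G :: "real \<times> real \<Rightarrow> real"
  assumes [measurable]: "u \<in> borel_measurable borel" "G \<in> borel_measurable borel"
    and lb: "line_bound u G" and J: "is_interval J" "J \<subseteq> {-1..<1}" and K: "K \<subseteq> {-1..<1}"
    and [measurable]: "J \<in> sets borel" "K \<in> sets borel"
  defines "P \<equiv> \<lambda>x x' y. ennreal \<bar>u (x, y) - u (x', y)\<bar> \<le> (\<integral>\<^sup>+s. ennreal (G (s, y)) \<partial>lborel_on J)"
  shows "AE x in lborel_on J. AE y in lborel_on K. AE x' in lborel_on J. P x x' y"
    and "AE x in lborel_on J. AE x' in lborel_on J. AE y in lborel_on K. P x x' y"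
    and "AE y in lborel_on K. AE x in lborel_on J. AE x' in lborel_on J. P x x' y"
proof -
  define Q where "Q x x' y \<longleftrightarrow> (x \<in> J \<longrightarrow> x' \<in> J \<longrightarrow> y \<in> K \<longrightarrow>
     ennreal \<bar>u (x, y) - u (x', y)\<bar> \<le> (\<integral>\<^sup>+s. ennreal (G (s, y)) * indicator J s \<partial>lborel))" for x x' y
  have PQ: "P x x' y \<longleftrightarrow> ennreal \<bar>u (x, y) - u (x', y)\<bar> \<le> (\<integral>\<^sup>+s. ennreal (G (s, y)) * indicator J s \<partial>lborel)"
    for x x' y unfolding P_def by (subst nn_integral_lborel_on) measurable
  have Qm: "Measurable.pred borel (\<lambda>(x, x', y). Q x x' y)"
    unfolding Q_def split_beta' by measurable
  have line: "(\<integral>\<^sup>+s\<in>{0..h}. ennreal (G (x + s, y)) \<partial>lborel) \<le> (\<integral>\<^sup>+s. ennreal (G (s, y)) * indicator J s \<partial>lborel)"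
    if "x \<in> J" "x + h \<in> J" for x y h
  proof -
    have "(\<integral>\<^sup>+s\<in>{0..h}. ennreal (G (x + s, y)) \<partial>lborel) \<le>
        (\<integral>\<^sup>+s. ennreal (G (s + x, y)) * indicator J (s + x) \<partial>lborel)"
    proof (intro nn_integral_mono)
      fix s
      have "s + x \<in> J" if "s \<in> {0..h}"
        using mem_is_interval_1_I[OF J(1) \<open>x \<in> J\<close> \<open>x + h \<in> J\<close>, of "s + x"] that by simp
      then show "ennreal (G (x + s, y)) * indicator {0..h} s \<le> ennreal (G (s + x, y)) * indicator J (s + x)"
        by (auto split: split_indicator simp: add.commute)
    qed
    also have "\<dots> = (\<integral>\<^sup>+s. ennreal (G (s, y)) * indicator J s \<partial>lborel)"
      by (rule nn_integral_lborel_shift[where f="\<lambda>s. ennreal (G (s, y)) * indicator J s"]) measurable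
    finally show ?thesis .
  qed
  \<comment> \<open>An increment above 2 cannot join two points of \<open>J\<close>. Both orders of
    the end points are recorded, so that a translation of the first coordinate settles negative
    increments afterwards.\<close>
  have pos: "AE z in lborel. Q (fst z + h) (fst z) (snd z) \<and> Q (fst z) (fst z + h) (snd z)" if h: "0 \<le> h" for h
  proof (cases "h \<le> 2")
    case True
    then have "AE z in lborel. fst z \<in> {-1..<1} \<longrightarrow> snd z \<in> {-1..<1} \<longrightarrow>
        ennreal \<bar>u (fst z + h, snd z) - u (fst z, snd z)\<bar> \<le> (\<integral>\<^sup>+s\<in>{0..h}. ennreal (G (fst z + s, snd z)) \<partial>lborel)"
      using lb h by (auto simp: line_bound_def split_beta')
    then show ?thesis
    proof eventually_elim
      case (elim z)
      show ?case
        unfolding Q_def using elim J(2) K line[of "fst z" h "snd z"]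
        by (auto intro: order_trans simp: abs_minus_commute)
    qed
  next
    case False
    have "\<not> (x \<in> J \<and> x + h \<in> J)" for x
      using subsetD[OF J(2), of x] subsetD[OF J(2), of "x + h"] False by auto
    then show ?thesis by (auto simp: Q_def)
  qed
  have "AE z in lborel. Q (fst z) (fst z + h) (snd z)" for h
  proof (cases "0 \<le> h")
    case True
    then show ?thesis using pos by fastforce
  next
    case False
    have "AE z in lborel. Q (fst z + - h) (fst z) (snd z)"
      using pos[of "- h"] False by auto
    from AE_lborel_shift[OF this, of "(h, 0)"] show ?thesis by simp
  qed
  note AE = AE_translate_coordinate[OF Qm this]
  show "AE x in lborel_on J. AE y in lborel_on K. AE x' in lborel_on J. P x x' y"
    unfolding AE_lborel_on[OF \<open>J \<in> sets borel\<close>] AE_lborel_on[OF \<open>K \<in> sets borel\<close>]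
    using AE(1) by (auto simp: Q_def PQ elim!: eventually_mono)
  show "AE x in lborel_on J. AE x' in lborel_on J. AE y in lborel_on K. P x x' y"
    unfolding AE_lborel_on[OF \<open>J \<in> sets borel\<close>] AE_lborel_on[OF \<open>K \<in> sets borel\<close>]
    using AE(2) by (auto simp: Q_def PQ elim!: eventually_mono)
  show "AE y in lborel_on K. AE x in lborel_on J. AE x' in lborel_on J. P x x' y"
    unfolding AE_lborel_on[OF \<open>J \<in> sets borel\<close>] AE_lborel_on[OF \<open>K \<in> sets borel\<close>]
    using AE(3) by (auto simp: Q_def PQ elim!: eventually_mono)
qed

text \<open>
  The two chains through the corners \<open>(y\<^sub>1, x\<^sub>2)\<close> and \<open>(x\<^sub>1, y\<^sub>2)\<close> give two bounds of
  \<open>\<bar>u (x\<^sub>1, x\<^sub>2) - u (y\<^sub>1, y\<^sub>2)\<bar>\<close>; each of the four terms of their product is a product of functions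
  of different variables.
\<close>
lemma nn_integral_corner_bound:
  fixes M N :: "real measure" and f :: "real \<Rightarrow> real \<Rightarrow> real"
  assumes [measurable]: "A \<in> borel_measurable N" "B \<in> borel_measurable M"
    and r: "emeasure M (space M) = r" "emeasure N (space N) = r"
    and g: "(\<integral>\<^sup>+y. A y \<partial>N) = g" "(\<integral>\<^sup>+x. B x \<partial>M) = g"
    and A1: "AE x1 in M. AE x2 in N. AE y1 in M. ennreal \<bar>f x1 x2 - f y1 x2\<bar> \<le> A x2"
    and A2: "AE x1 in M. AE y1 in M. AE y2 in N. ennreal \<bar>f x1 y2 - f y1 y2\<bar> \<le> A y2"
    and B1: "AE x1 in M. AE x2 in N. AE y2 in N. ennreal \<bar>f x1 x2 - f x1 y2\<bar> \<le> B x1"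
    and B2: "AE x2 in N. AE y1 in M. AE y2 in N. ennreal \<bar>f y1 x2 - f y1 y2\<bar> \<le> B y1"
  shows "(\<integral>\<^sup>+x1. \<integral>\<^sup>+x2. \<integral>\<^sup>+y1. \<integral>\<^sup>+y2. ennreal ((f x1 x2 - f y1 y2)\<^sup>2) \<partial>N \<partial>M \<partial>N \<partial>M) \<le> 4 * r\<^sup>2 * g\<^sup>2"
proof -
  have corner: "ennreal ((f x1 x2 - f y1 y2)\<^sup>2) \<le> (A x2 + B y1) * (B x1 + A y2)"
    if "ennreal \<bar>f x1 x2 - f y1 x2\<bar> \<le> A x2" "ennreal \<bar>f x1 y2 - f y1 y2\<bar> \<le> A y2"
      "ennreal \<bar>f x1 x2 - f x1 y2\<bar> \<le> B x1" "ennreal \<bar>f y1 x2 - f y1 y2\<bar> \<le> B y1" for x1 x2 y1 y2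
  proof -
    let ?d = "\<bar>f x1 x2 - f y1 y2\<bar>"
    have "ennreal ?d \<le> ennreal (\<bar>f x1 x2 - f y1 x2\<bar> + \<bar>f y1 x2 - f y1 y2\<bar>)"
      by (intro ennreal_leI) linarith
    also have "\<dots> \<le> A x2 + B y1"
      using that by (simp add: add_mono)
    finally have 1: "ennreal ?d \<le> A x2 + B y1" .
    have "ennreal ?d \<le> ennreal (\<bar>f x1 x2 - f x1 y2\<bar> + \<bar>f x1 y2 - f y1 y2\<bar>)"
      by (intro ennreal_leI) linarith
    also have "\<dots> \<le> B x1 + A y2"
      using that by (simp add: add_mono)
    finally have 2: "ennreal ?d \<le> B x1 + A y2" .
    have "ennreal ((f x1 x2 - f y1 y2)\<^sup>2) = ennreal ?d * ennreal ?d"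
      by (simp add: power2_eq_square flip: ennreal_mult abs_mult)
    also have "\<dots> \<le> (A x2 + B y1) * (B x1 + A y2)"
      using 1 2 by (intro mult_mono) auto
    finally show ?thesis .
  qed
  have "(\<integral>\<^sup>+x1. \<integral>\<^sup>+x2. \<integral>\<^sup>+y1. \<integral>\<^sup>+y2. ennreal ((f x1 x2 - f y1 y2)\<^sup>2) \<partial>N \<partial>M \<partial>N \<partial>M) \<le>
      (\<integral>\<^sup>+x1. \<integral>\<^sup>+x2. \<integral>\<^sup>+y1. \<integral>\<^sup>+y2. (A x2 + B y1) * (B x1 + A y2) \<partial>N \<partial>M \<partial>N \<partial>M)"
  \<comment> \<open>The exceptional sets are peeled off in the order of integration;
    \<open>B2\<close> does not involve \<open>x1\<close> and enters only with
    \<open>x2\<close>.\<close>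
  proof (rule nn_integral_mono_AE, use A1 A2 B1 in eventually_elim)
    case x1: (elim x1)
    show ?case
    proof (rule nn_integral_mono_AE, use x1(1,3) B2 in eventually_elim)
      case x2: (elim x2)
      show ?case
      proof (rule nn_integral_mono_AE, use x2(1,3) x1(2) in eventually_elim)
        case y1: (elim y1)
        show ?case
        proof (rule nn_integral_mono_AE, use x2(2) y1(2,3) in eventually_elim)
          case (elim y2)
          then show ?case using y1(1) by (intro corner)
        qed
      qed
    qed
  qed
  \<comment> \<open>Each of the four products depends on two of the four variables, which contribute
    \<open>g\<close> each; the two free variables contribute \<open>r\<close> each. Hence the total
    \<open>4 * r^2 * g^2\<close>.\<close>
  also have "\<dots> = (\<integral>\<^sup>+x1. \<integral>\<^sup>+x2. \<integral>\<^sup>+y1. (A x2 + B y1) * (r * B x1 + g) \<partial>M \<partial>N \<partial>M)"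
    by (simp add: nn_integral_cmult nn_integral_add r g mult.commute)
  also have "\<dots> = (\<integral>\<^sup>+x1. \<integral>\<^sup>+x2. (r * A x2 + g) * (r * B x1 + g) \<partial>N \<partial>M)"
    by (simp add: nn_integral_multc nn_integral_add r g mult.commute)
  also have "\<dots> = (\<integral>\<^sup>+x1. (r * g + r * g) * (r * B x1 + g) \<partial>M)"
    by (simp add: nn_integral_multc nn_integral_cmult nn_integral_add r g mult.commute)
  also have "\<dots> = (r * g + r * g) * (r * g + r * g)"
    by (simp add: nn_integral_cmult nn_integral_multc nn_integral_add r g mult.commute)
  also have "\<dots> = 4 * r\<^sup>2 * g\<^sup>2"
    by (simp add: power2_eq_square algebra_simps flip: mult_2)
  finally show ?thesis .
qed

text \<open>The two one-variable bounds are the integrals of \<open>G\<close> along horizontal and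
  vertical lines of the cell. By Tonelli both integrate to the integral of \<open>G\<close> over the
  cell, so the right-hand side contains its square.\<close>

lemma cell_estimate:
  fixes u G :: "real \<times> real \<Rightarrow> real"
  assumes [measurable]: "u \<in> borel_measurable borel" "G \<in> borel_measurable borel"
    and lb: "line_bound u G" "line_bound (\<lambda>z. u (snd z, fst z)) (\<lambda>z. G (snd z, fst z))"
    and J: "is_interval J" "J \<subseteq> {-1..<1}" and K: "is_interval K" "K \<subseteq> {-1..<1}"
    and [measurable]: "J \<in> sets borel" "K \<in> sets borel"
    and r: "emeasure lborel J = r" "emeasure lborel K = r"
  shows "(\<integral>\<^sup>+p. \<integral>\<^sup>+q. ennreal ((u p - u q)\<^sup>2) \<partial>lborel_on (J \<times> K) \<partial>lborel_on (J \<times> K))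
    \<le> 4 * r\<^sup>2 * (\<integral>\<^sup>+z. ennreal (G z) \<partial>lborel_on (J \<times> K))\<^sup>2"
proof -
  let ?M = "lborel_on J" and ?N = "lborel_on K"
  have fin: "emeasure lborel S < \<infinity>" if "S \<subseteq> {-1..<1}" "S \<in> sets borel" for S :: "real set"
  proof -
    have "emeasure lborel S \<le> emeasure lborel {-1..<1::real}"
      using that by (intro emeasure_mono) auto
    also have "\<dots> < \<infinity>" by simp
    finally show ?thesis .
  qed
  interpret M: finite_measure ?M by (intro finite_measure_lborel_on fin J) measurable
  interpret N: finite_measure ?N by (intro finite_measure_lborel_on fin K) measurable
  interpret pair_sigma_finite ?M ?N ..
  let ?A = "\<lambda>y. \<integral>\<^sup>+s. ennreal (G (s, y)) \<partial>?M" and ?B = "\<lambda>x. \<integral>\<^sup>+t. ennreal (G (x, t)) \<partial>?N"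
  let ?g = "\<integral>\<^sup>+z. ennreal (G z) \<partial>lborel_on (J \<times> K)"
  note h = line_bound_AE[OF _ _ lb(1) J K(2), simplified] line_bound_AE[OF _ _ lb(2) K J(2), simplified]
  have "(\<integral>\<^sup>+p. \<integral>\<^sup>+q. ennreal ((u p - u q)\<^sup>2) \<partial>lborel_on (J \<times> K) \<partial>lborel_on (J \<times> K)) =
      (\<integral>\<^sup>+x1. \<integral>\<^sup>+x2. \<integral>\<^sup>+y1. \<integral>\<^sup>+y2. ennreal ((u (x1, x2) - u (y1, y2))\<^sup>2) \<partial>?N \<partial>?M \<partial>?N \<partial>?M)"
  proof -
    have "(\<lambda>p. \<integral>\<^sup>+q. ennreal ((u p - u q)\<^sup>2) \<partial>lborel_on (J \<times> K)) =
        (\<lambda>p. \<integral>\<^sup>+y1. \<integral>\<^sup>+y2. ennreal ((u p - u (y1, y2))\<^sup>2) \<partial>?N \<partial>?M)"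
      by (rule ext, rule nn_integral_lborel_on_Times) measurable
    then show ?thesis
      by (simp add: nn_integral_lborel_on_Times)
  qed
  also have "\<dots> \<le> 4 * r\<^sup>2 * ?g\<^sup>2"
  proof (rule nn_integral_corner_bound[where A="?A" and B="?B"])
    show "(\<integral>\<^sup>+x. ?B x \<partial>?M) = ?g"
      by (simp add: nn_integral_lborel_on_Times)
    then show "(\<integral>\<^sup>+y. ?A y \<partial>?N) = ?g"
      using Fubini'[of "\<lambda>x y. ennreal (G (x, y))"] by simp
    show "emeasure ?M (space ?M) = r" "emeasure ?N (space ?N) = r"
      by (simp_all add: emeasure_lborel_on r)
  qed (use h in \<open>simp_all\<close>)
  finally show ?thesis .
qed

text \<open>Variance identity, by expanding the square. It trades the double integral for the
  \<open>L^2\<close> norm and the mean, so that once the left-hand side is bounded only one number,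
  the integral of \<open>f\<close>, remains to be controlled.\<close>

lemma double_integral_square_diff:
  fixes f :: "'a \<Rightarrow> real"
  assumes "finite_measure M" and f: "integrable M f" and f2: "integrable M (\<lambda>x. (f x)\<^sup>2)"
  shows "(\<integral>\<^sup>+p. \<integral>\<^sup>+q. ennreal ((f p - f q)\<^sup>2) \<partial>M \<partial>M) =
    ennreal (2 * measure M (space M) * (LINT x|M. (f x)\<^sup>2) - 2 * (LINT x|M. f x)\<^sup>2)"
proof -
  interpret finite_measure M by fact
  let ?m = "measure M (space M)" and ?s = "LINT x|M. f x" and ?t = "LINT x|M. (f x)\<^sup>2"
  have inner: "integrable M (\<lambda>q. (f p - f q)\<^sup>2)" "(LINT q|M. (f p - f q)\<^sup>2) = ?m * (f p)\<^sup>2 - 2 * ?s * f p + ?t" for p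
    using f f2 by (simp_all add: power2_diff mult.assoc)
  have "(\<integral>\<^sup>+q. ennreal ((f p - f q)\<^sup>2) \<partial>M) = ennreal (?m * (f p)\<^sup>2 - 2 * ?s * f p + ?t)" for p
    using nn_integral_eq_integral[OF inner(1)[of p]] inner(2)[of p] by simp
  then have "(\<integral>\<^sup>+p. \<integral>\<^sup>+q. ennreal ((f p - f q)\<^sup>2) \<partial>M \<partial>M) =
      (\<integral>\<^sup>+p. ennreal (?m * (f p)\<^sup>2 - 2 * ?s * f p + ?t) \<partial>M)" by simp
  also have "\<dots> = ennreal (LINT p|M. ?m * (f p)\<^sup>2 - 2 * ?s * f p + ?t)"
  proof (rule nn_integral_eq_integral)
    have "0 \<le> (LINT q|M. (f p - f q)\<^sup>2)" for p by (rule integral_nonneg_AE) simp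
    then show "AE p in M. 0 \<le> ?m * (f p)\<^sup>2 - 2 * ?s * f p + ?t" by (simp add: inner(2))
  qed (use f f2 in simp)
  also have "(LINT p|M. ?m * (f p)\<^sup>2 - 2 * ?s * f p + ?t) = 2 * ?m * ?t - 2 * ?s\<^sup>2"
  proof -
    have "(LINT p|M. ?m * (f p)\<^sup>2 - 2 * ?s * f p + ?t) = ?m * ?t - 2 * ?s * ?s + ?m * ?t"
      using f f2 by simp
    then show ?thesis by (simp add: power2_eq_square)
  qed
  finally show ?thesis .
qed

section \<open>The grid of cells\<close>

definition cell :: "nat \<Rightarrow> nat \<Rightarrow> real set" where
  "cell n i = {-1 + 2 * real i / real n ..< -1 + 2 * real (Suc i) / real n}"

abbreviation unit_square :: "(real \<times> real) set" where
  "unit_square \<equiv> {-1..<1} \<times> {-1..<1}"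

lemma cell_measurable [measurable]: "cell n i \<in> sets borel"
  by (simp add: cell_def)

lemma cell_is_interval: "is_interval (cell n i)"
  by (simp add: cell_def is_interval_co)

lemma emeasure_cell: "emeasure lborel (cell n i) = ennreal (2 / real n)"
  unfolding cell_def by (subst emeasure_lborel_Ico) (auto simp: add_divide_distrib algebra_simps)

lemma cell_subset: "i < n \<Longrightarrow> cell n i \<subseteq> {-1..<1}"
proof -
  assume "i < n"
  then have "2 * real (Suc i) / real n \<le> 2" by (simp add: field_simps)
  then show ?thesis by (auto simp: cell_def intro: order_trans)
qed

lemma cell_iff:
  assumes "0 < n" "-1 \<le> x"
  shows "x \<in> cell n i \<longleftrightarrow> i = nat \<lfloor>(x + 1) * real n / 2\<rfloor>"
proof -
  have "x \<in> cell n i \<longleftrightarrow> real i \<le> (x + 1) * real n / 2 \<and> (x + 1) * real n / 2 < real i + 1"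
    using assms by (auto simp: cell_def field_simps)
  also have "\<dots> \<longleftrightarrow> \<lfloor>(x + 1) * real n / 2\<rfloor> = int i"
    by (auto simp: floor_eq_iff)
  also have "\<dots> \<longleftrightarrow> i = nat \<lfloor>(x + 1) * real n / 2\<rfloor>"
    using assms by auto
  finally show ?thesis .
qed

text \<open>Half-open cells tile the half-open interval exactly, so this holds at every point and
  common edges need no separate treatment.\<close>

lemma sum_indicator_cell:
  assumes "0 < n"
  shows "(\<Sum>i<n. indicator (cell n i) x) = (indicator {-1..<1} x :: ennreal)"
proof (cases "-1 \<le> x \<and> x < 1")
  case True
  let ?i = "nat \<lfloor>(x + 1) * real n / 2\<rfloor>"
  have i: "?i < n"
  proof -
    have "(x + 1) * real n < 2 * real n" using True assms by simp
    then have "\<lfloor>(x + 1) * real n / 2\<rfloor> < int n" by (simp add: floor_less_iff)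
    then show ?thesis using assms by simp
  qed
  have "(\<Sum>i<n. indicator (cell n i) x :: ennreal) = (\<Sum>i<n. if i = ?i then 1 else 0)"
    using True assms by (intro sum.cong) (auto simp: indicator_def cell_iff)
  also have "\<dots> = 1" using i by simp
  finally show ?thesis using True by simp
next
  case False
  then have "x \<notin> cell n i" if "i < n" for i using cell_subset[OF that] by auto
  with False show ?thesis by (auto simp: indicator_def)
qed

lemma nn_integral_cells:
  fixes f :: "real \<times> real \<Rightarrow> ennreal"
  assumes [measurable]: "f \<in> borel_measurable borel" and n: "0 < n"
  shows "(\<Sum>i<n. \<Sum>j<n. \<integral>\<^sup>+z. f z \<partial>lborel_on (cell n i \<times> cell n j)) = (\<integral>\<^sup>+z. f z \<partial>lborel_on unit_square)"
proof -
  have [measurable]: "J \<times> K \<in> sets borel" if "J \<in> sets borel" "K \<in> sets borel" for J K :: "real set"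
    using that by (metis borel_prod pair_measureI)
  have ind: "indicator (J \<times> K) z = (indicator J (fst z) * indicator K (snd z) :: ennreal)"
    for J K :: "real set" and z
    by (cases z) (auto simp: indicator_def)
  have c: "(\<integral>\<^sup>+z. f z \<partial>lborel_on (cell n i \<times> cell n j)) =
      (\<integral>\<^sup>+z. f z * (indicator (cell n i) (fst z) * indicator (cell n j) (snd z)) \<partial>lborel)" for i j
    by (subst nn_integral_lborel_on) (simp_all add: ind)
  have "(\<Sum>i<n. \<Sum>j<n. \<integral>\<^sup>+z. f z \<partial>lborel_on (cell n i \<times> cell n j)) =
      (\<Sum>i<n. \<integral>\<^sup>+z. (\<Sum>j<n. f z * (indicator (cell n i) (fst z) * indicator (cell n j) (snd z))) \<partial>lborel)"
    unfolding c by (intro sum.cong refl nn_integral_sum[symmetric]) measurable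
  also have "\<dots> = (\<integral>\<^sup>+z. (\<Sum>i<n. \<Sum>j<n. f z * (indicator (cell n i) (fst z) * indicator (cell n j) (snd z))) \<partial>lborel)"
    by (intro nn_integral_sum[symmetric]) measurable
  also have "\<dots> = (\<integral>\<^sup>+z. f z * indicator unit_square z \<partial>lborel)"
    by (simp only: ind sum_indicator_cell[OF n] sum_distrib_left[symmetric] sum_distrib_right[symmetric])
  finally show ?thesis by (simp add: nn_integral_lborel_on)
qed

section \<open>Compactness in the plane\<close>

lemma borel_Times [measurable]:
  "J \<in> sets borel \<Longrightarrow> K \<in> sets borel \<Longrightarrow>
    (J \<times> K :: ('a::second_countable_topology \<times> 'b::second_countable_topology) set) \<in> sets borel"
  by (metis borel_prod pair_measureI)

lemma nn_integral_lborel_on_mono_set: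
  assumes [measurable]: "f \<in> borel_measurable borel" "A \<in> sets borel" "B \<in> sets borel" and "A \<subseteq> B"
  shows "(\<integral>\<^sup>+x. f x \<partial>lborel_on A) \<le> (\<integral>\<^sup>+x. f x \<partial>lborel_on B)"
  using \<open>A \<subseteq> B\<close> by (auto simp: nn_integral_lborel_on intro!: nn_integral_mono split: split_indicator)

lemma emeasure_lborel_on_cells:
  "emeasure (lborel_on (cell n i \<times> cell n j)) UNIV = ennreal ((2 / real n)\<^sup>2)"
proof -
  have "emeasure (lborel_on (cell n i \<times> cell n j)) UNIV = (\<integral>\<^sup>+z. 1 \<partial>lborel_on (cell n i \<times> cell n j))"
    by simp
  also have "\<dots> = (\<integral>\<^sup>+x. \<integral>\<^sup>+y. 1 \<partial>lborel_on (cell n j) \<partial>lborel_on (cell n i))"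
    by (rule nn_integral_lborel_on_Times) measurable
  also have "\<dots> = ennreal ((2 / real n)\<^sup>2)"
    by (simp add: emeasure_lborel_on emeasure_cell power2_eq_square flip: ennreal_mult)
  finally show ?thesis .
qed

lemma finite_measure_cells: "finite_measure (lborel_on (cell n i \<times> cell n j))"
  by (rule finite_measureI) (simp add: emeasure_lborel_on_cells)

text \<open>Absolute continuity of the integral, uniformly over the cells of one grid.
  \<open>V\<close> is cut at a height \<open>k\<close>: the excess over \<open>k\<close> has small
  integral on the whole square, and the bounded part contributes at most \<open>k\<close> times the
  area of a cell.\<close>

lemma small_cells:
  fixes V :: "real \<times> real \<Rightarrow> real"
  assumes [measurable]: "V \<in> borel_measurable borel" and V0: "\<And>z. 0 \<le> V z"
    and fin: "(\<integral>\<^sup>+z. ennreal (V z) \<partial>lborel_on unit_square) < \<infinity>" and e: "0 < e"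
  obtains n where "0 < n" "\<And>i j. i < n \<Longrightarrow> j < n \<Longrightarrow> (\<integral>\<^sup>+z. ennreal (V z) \<partial>lborel_on (cell n i \<times> cell n j)) \<le> ennreal e"
proof -
  let ?M = "lborel_on unit_square"
  have V: "integrable ?M V"
    using fin V0 by (intro integrableI_nonneg) auto
  have "(\<lambda>k::nat. LINT z|?M. max (V z - real k) 0) \<longlonglongrightarrow> (LINT z|?M. 0)"
  proof (rule integral_dominated_convergence[OF _ _ V])
    show "AE z in ?M. (\<lambda>k. max (V z - real k) 0) \<longlonglongrightarrow> 0"
    proof (rule AE_I2)
      fix z
      have "\<forall>\<^sub>F k in sequentially. max (V z - real k) 0 = 0"
        using eventually_ge_at_top[of "nat \<lceil>V z\<rceil>"] by eventually_elim (simp add: max_def; linarith)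
      then show "(\<lambda>k. max (V z - real k) 0) \<longlonglongrightarrow> 0" by (rule tendsto_eventually)
    qed
    show "AE z in ?M. norm (max (V z - real k) 0) \<le> V z" for k
      using V0 by (intro AE_I2) auto
  qed measurable
  then have "\<forall>\<^sub>F k in sequentially. (LINT z|?M. max (V z - real k) 0) < e / 2"
    using e by (intro order_tendstoD) auto
  then obtain k :: nat where k: "(LINT z|?M. max (V z - real k) 0) < e / 2"
    by (auto simp: eventually_sequentially)
  have ik: "integrable ?M (\<lambda>z. max (V z - real k) 0)"
    by (rule Bochner_Integration.integrable_bound[OF V]) (use V0 in auto)
  have k2: "(\<integral>\<^sup>+z. ennreal (max (V z - real k) 0) \<partial>?M) \<le> ennreal (e / 2)"
    using k by (subst nn_integral_eq_integral[OF ik]) (auto intro: ennreal_leI)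
  \<comment> \<open>From \<open>n \<ge> 8 k / e\<close> and \<open>n \<ge> 1\<close> follows
    \<open>n^2 \<ge> 8 k / e\<close>, which gives \<open>k (2 / n)^2 \<le> e / 2\<close>.\<close>
  obtain n :: nat where "max 1 (8 * real k / e) < real n"
    using reals_Archimedean2 by blast
  then have n: "8 * real k / e < real n" and n1: "1 \<le> real n" and n0: "0 < n"
    by auto
  have kn: "real k * (2 / real n)\<^sup>2 \<le> e / 2"
  proof -
    have "8 * real k \<le> e * real n" using n e by (simp add: field_simps)
    also have "\<dots> \<le> e * (real n * real n)"
      using n1 e by (intro mult_left_mono) (auto simp: mult_le_cancel_left1)
    finally show ?thesis using n0 by (simp add: field_simps power2_eq_square)
  qed
  show ?thesis
  proof (rule that[OF n0])
    fix i j assume ij: "i < n" "j < n"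
    let ?Q = "lborel_on (cell n i \<times> cell n j)"
    have "(\<integral>\<^sup>+z. ennreal (V z) \<partial>?Q) \<le> (\<integral>\<^sup>+z. ennreal (real k) + ennreal (max (V z - real k) 0) \<partial>?Q)"
      by (intro nn_integral_mono) (auto simp flip: ennreal_plus intro!: ennreal_leI)
    also have "\<dots> = ennreal (real k) * ennreal ((2 / real n)\<^sup>2) + (\<integral>\<^sup>+z. ennreal (max (V z - real k) 0) \<partial>?Q)"
      by (subst nn_integral_add) (simp_all add: emeasure_lborel_on_cells)
    also have "\<dots> \<le> ennreal (e / 2) + ennreal (e / 2)"
    proof (rule add_mono)
      show "ennreal (real k) * ennreal ((2 / real n)\<^sup>2) \<le> ennreal (e / 2)"
        using kn by (simp flip: ennreal_mult add: ennreal_leI)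
      have "(\<integral>\<^sup>+z. ennreal (max (V z - real k) 0) \<partial>?Q) \<le> (\<integral>\<^sup>+z. ennreal (max (V z - real k) 0) \<partial>?M)"
        using cell_subset[OF ij(1)] cell_subset[OF ij(2)] by (intro nn_integral_lborel_on_mono_set) auto
      with k2 show "(\<integral>\<^sup>+z. ennreal (max (V z - real k) 0) \<partial>?Q) \<le> ennreal (e / 2)" by simp
    qed
    also have "\<dots> = ennreal e" using e by (simp flip: ennreal_plus)
    finally show "(\<integral>\<^sup>+z. ennreal (V z) \<partial>?Q) \<le> ennreal e" .
  qed
qed

lemma nn_integral_square_le:
  fixes G H V :: "'a \<Rightarrow> real"
  assumes [measurable]: "G \<in> borel_measurable M" "H \<in> borel_measurable M" "V \<in> borel_measurable M"
    and nonneg: "\<And>z. 0 \<le> H z" "\<And>z. 0 \<le> V z" and le: "AE z in M. (G z)\<^sup>2 \<le> H z * V z"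
  shows "(\<integral>\<^sup>+z. ennreal (G z) \<partial>M)\<^sup>2 \<le> (\<integral>\<^sup>+z. ennreal (H z) \<partial>M) * (\<integral>\<^sup>+z. ennreal (V z) \<partial>M)"
proof -
  have "(\<integral>\<^sup>+z. ennreal (G z) \<partial>M) \<le> (\<integral>\<^sup>+z. ennreal (sqrt (H z)) * ennreal (sqrt (V z)) \<partial>M)"
  proof (rule nn_integral_mono_AE, use le in eventually_elim)
    case (elim z)
    then have "\<bar>G z\<bar> \<le> sqrt (H z * V z)" by (simp add: real_le_rsqrt)
    then have "ennreal (G z) \<le> ennreal (sqrt (H z) * sqrt (V z))"
      by (intro ennreal_leI) (simp add: real_sqrt_mult)
    then show ?case by (simp add: ennreal_mult nonneg)
  qed
  then have "(\<integral>\<^sup>+z. ennreal (G z) \<partial>M)\<^sup>2 \<le> (\<integral>\<^sup>+z. ennreal (sqrt (H z)) * ennreal (sqrt (V z)) \<partial>M)\<^sup>2"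
    by (intro power_mono) auto
  also have "\<dots> \<le> (\<integral>\<^sup>+z. (ennreal (sqrt (H z)))\<^sup>2 \<partial>M) * (\<integral>\<^sup>+z. (ennreal (sqrt (V z)))\<^sup>2 \<partial>M)"
    by (intro Cauchy_Schwarz_nn_integral) measurable
  finally show ?thesis by (simp add: nonneg ennreal_power)
qed

text \<open>In the application \<open>G\<close> is the length of the gradient, \<open>H\<close> the
  energy density and \<open>V\<close> the reciprocal of the weight, all in plane coordinates. The
  last condition is the pointwise form of what Cauchy-Schwarz integrates.\<close>

definition energy_controlled ::
    "(real \<times> real \<Rightarrow> real) \<Rightarrow> (real \<times> real \<Rightarrow> real) \<Rightarrow> (real \<times> real \<Rightarrow> real) \<Rightarrow> (real \<times> real \<Rightarrow> real) \<Rightarrow> bool" where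
  "energy_controlled V u G H \<longleftrightarrow>
     u \<in> borel_measurable borel \<and> G \<in> borel_measurable borel \<and> H \<in> borel_measurable borel \<and> (\<forall>z. 0 \<le> H z) \<and>
     line_bound u G \<and> line_bound (\<lambda>z. u (snd z, fst z)) (\<lambda>z. G (snd z, fst z)) \<and>
     (AE z in lborel_on unit_square. (G z)\<^sup>2 \<le> H z * V z)"

lemma energy_controlled_cell:
  fixes V :: "real \<times> real \<Rightarrow> real"
  assumes u: "energy_controlled V u G H" and [measurable]: "V \<in> borel_measurable borel" and V: "\<And>z. 0 \<le> V z"
    and ij: "i < n" "j < n"
    and small: "(\<integral>\<^sup>+z. ennreal (V z) \<partial>lborel_on (cell n i \<times> cell n j)) \<le> ennreal \<theta>"
  shows "(\<integral>\<^sup>+p. \<integral>\<^sup>+q. ennreal ((u p - u q)\<^sup>2) \<partial>lborel_on (cell n i \<times> cell n j) \<partial>lborel_on (cell n i \<times> cell n j))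
    \<le> 4 * ennreal ((2 / real n)\<^sup>2) * ((\<integral>\<^sup>+z. ennreal (H z) \<partial>lborel_on (cell n i \<times> cell n j)) * ennreal \<theta>)"
proof -
  let ?Q = "lborel_on (cell n i \<times> cell n j)"
  have [measurable]: "u \<in> borel_measurable borel" "G \<in> borel_measurable borel" "H \<in> borel_measurable borel"
    and H: "\<And>z. 0 \<le> H z"
    and lb: "line_bound u G" "line_bound (\<lambda>z. u (snd z, fst z)) (\<lambda>z. G (snd z, fst z))"
    and le: "AE z in lborel_on unit_square. (G z)\<^sup>2 \<le> H z * V z"
    using u by (auto simp: energy_controlled_def)
  have "AE z in ?Q. (G z)\<^sup>2 \<le> H z * V z"
    using le cell_subset[OF ij(1)] cell_subset[OF ij(2)]
    by (subst (asm) AE_lborel_on, measurable, subst AE_lborel_on, measurable) (auto elim!: eventually_mono)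
  then have "(\<integral>\<^sup>+z. ennreal (G z) \<partial>?Q)\<^sup>2 \<le> (\<integral>\<^sup>+z. ennreal (H z) \<partial>?Q) * (\<integral>\<^sup>+z. ennreal (V z) \<partial>?Q)"
    by (intro nn_integral_square_le H V) measurable
  also have "\<dots> \<le> (\<integral>\<^sup>+z. ennreal (H z) \<partial>?Q) * ennreal \<theta>"
    using small by (rule mult_left_mono) simp
  finally have G: "(\<integral>\<^sup>+z. ennreal (G z) \<partial>?Q)\<^sup>2 \<le> (\<integral>\<^sup>+z. ennreal (H z) \<partial>?Q) * ennreal \<theta>" .
  have "(\<integral>\<^sup>+p. \<integral>\<^sup>+q. ennreal ((u p - u q)\<^sup>2) \<partial>?Q \<partial>?Q)
      \<le> 4 * (ennreal (2 / real n))\<^sup>2 * (\<integral>\<^sup>+z. ennreal (G z) \<partial>?Q)\<^sup>2"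
    by (intro cell_estimate lb cell_is_interval cell_subset ij emeasure_cell) measurable
  also have "\<dots> \<le> 4 * (ennreal (2 / real n))\<^sup>2 * ((\<integral>\<^sup>+z. ennreal (H z) \<partial>?Q) * ennreal \<theta>)"
    using G by (rule mult_left_mono) simp
  finally show ?thesis by (simp add: ennreal_power)
qed

lemma square_integrable_cells:
  fixes u :: "real \<times> real \<Rightarrow> real"
  assumes [measurable]: "u \<in> borel_measurable borel"
    and L2: "(\<integral>\<^sup>+z. ennreal ((u z)\<^sup>2) \<partial>lborel_on unit_square) < \<infinity>" and ij: "i < n" "j < n"
  shows "integrable (lborel_on (cell n i \<times> cell n j)) (\<lambda>z. (u z)\<^sup>2)"
    and "integrable (lborel_on (cell n i \<times> cell n j)) u"
proof -
  let ?Q = "lborel_on (cell n i \<times> cell n j)"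
  interpret finite_measure ?Q by (rule finite_measure_cells)
  have "(\<integral>\<^sup>+z. ennreal ((u z)\<^sup>2) \<partial>?Q) \<le> (\<integral>\<^sup>+z. ennreal ((u z)\<^sup>2) \<partial>lborel_on unit_square)"
    using cell_subset[OF ij(1)] cell_subset[OF ij(2)] by (intro nn_integral_lborel_on_mono_set) auto
  with L2 show i2: "integrable ?Q (\<lambda>z. (u z)\<^sup>2)"
    by (intro integrableI_nonneg) auto
  show "integrable ?Q u"
    by (rule square_integrable_imp_integrable[OF _ i2]) simp
qed

text \<open>The Poincare estimate is used for \<open>u\<close> and \<open>v\<close> separately and
  combined by \<open>(a - b)^2 \<le> 2 a^2 + 2 b^2\<close>, so no gradient of the difference is
  formed. The variance identity carries the factor \<open>2 (2 / n)^2\<close>, twice the area of the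
  cell; dividing by it cancels the area in the energy term, where no power of \<open>n\<close>
  survives.\<close>

lemma energy_controlled_diff_cell:
  fixes V :: "real \<times> real \<Rightarrow> real"
  assumes u: "energy_controlled V u G H" and v: "energy_controlled V v G' H'"
    and Vm: "V \<in> borel_measurable borel" and V: "\<And>z. 0 \<le> V z"
    and uL2: "(\<integral>\<^sup>+z. ennreal ((u z)\<^sup>2) \<partial>lborel_on unit_square) < \<infinity>"
    and vL2: "(\<integral>\<^sup>+z. ennreal ((v z)\<^sup>2) \<partial>lborel_on unit_square) < \<infinity>"
    and ij: "i < n" "j < n" and \<theta>: "0 \<le> \<theta>"
    and small: "(\<integral>\<^sup>+z. ennreal (V z) \<partial>lborel_on (cell n i \<times> cell n j)) \<le> ennreal \<theta>"
  shows "(\<integral>\<^sup>+z. ennreal ((u z - v z)\<^sup>2) \<partial>lborel_on (cell n i \<times> cell n j)) \<le>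
      ennreal (4 * \<theta>) * ((\<integral>\<^sup>+z. ennreal (H z) \<partial>lborel_on (cell n i \<times> cell n j)) + (\<integral>\<^sup>+z. ennreal (H' z) \<partial>lborel_on (cell n i \<times> cell n j)))
      + ennreal (((LINT z|lborel_on (cell n i \<times> cell n j). u z) - (LINT z|lborel_on (cell n i \<times> cell n j). v z))\<^sup>2 * (real n / 2)\<^sup>2)"
proof -
  let ?Q = "lborel_on (cell n i \<times> cell n j)"
  let ?r2 = "(2 / real n)\<^sup>2" and ?d = "(LINT z|?Q. u z) - (LINT z|?Q. v z)"
  let ?E = "\<integral>\<^sup>+z. ennreal (H z) \<partial>?Q" and ?E' = "\<integral>\<^sup>+z. ennreal (H' z) \<partial>?Q"
  interpret finite_measure ?Q by (rule finite_measure_cells)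
  have n: "0 < n" using ij by simp
  have m: "measure ?Q (space ?Q) = ?r2"
    by (simp add: measure_def emeasure_lborel_on_cells)
  have um[measurable]: "u \<in> borel_measurable borel" and vm[measurable]: "v \<in> borel_measurable borel"
    using u v by (auto simp: energy_controlled_def)
  note iu = square_integrable_cells[OF um uL2 ij] and iv = square_integrable_cells[OF vm vL2 ij]
  have iw: "integrable ?Q (\<lambda>z. u z - v z)" using iu(2) iv(2) by simp
  have iw2: "integrable ?Q (\<lambda>z. (u z - v z)\<^sup>2)"
  proof (rule Bochner_Integration.integrable_bound)
    show "integrable ?Q (\<lambda>z. 2 * (u z)\<^sup>2 + 2 * (v z)\<^sup>2)" using iu(1) iv(1) by simp
    have "(u z - v z)\<^sup>2 \<le> 2 * (u z)\<^sup>2 + 2 * (v z)\<^sup>2" for z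
      using zero_le_power2[of "u z + v z"] by (simp add: power2_eq_square algebra_simps)
    then show "AE z in ?Q. norm ((u z - v z)\<^sup>2) \<le> norm (2 * (u z)\<^sup>2 + 2 * (v z)\<^sup>2)" by simp
  qed simp
  define D where "D f = (\<integral>\<^sup>+p. \<integral>\<^sup>+q. ennreal ((f p - f q)\<^sup>2) \<partial>?Q \<partial>?Q)" for f :: "real \<times> real \<Rightarrow> real"
  have Dw: "D (\<lambda>z. u z - v z) = ennreal (2 * ?r2 * (LINT z|?Q. (u z - v z)\<^sup>2) - 2 * ?d\<^sup>2)"
  proof -
    have "(LINT z|?Q. u z - v z) = ?d"
      by (rule Bochner_Integration.integral_diff[OF iu(2) iv(2)])
    then show ?thesis
      unfolding D_def double_integral_square_diff[OF finite_measure_axioms iw iw2] m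
      by metis
  qed
  have nn: "(\<integral>\<^sup>+z. ennreal ((u z - v z)\<^sup>2) \<partial>?Q) = ennreal (LINT z|?Q. (u z - v z)\<^sup>2)"
    by (rule nn_integral_eq_integral[OF iw2]) simp
  have "ennreal (2 * ?r2) * (\<integral>\<^sup>+z. ennreal ((u z - v z)\<^sup>2) \<partial>?Q) = ennreal (2 * ?r2 * (LINT z|?Q. (u z - v z)\<^sup>2))"
    unfolding nn by (rule ennreal_mult'[symmetric]) simp
  also have "\<dots> \<le> D (\<lambda>z. u z - v z) + ennreal (2 * ?d\<^sup>2)"
    unfolding Dw by (subst ennreal_plus_if) (auto intro!: ennreal_leI)
  also have "D (\<lambda>z. u z - v z) \<le> 2 * D u + 2 * D v"
  proof -
    have "ennreal (((u p - v p) - (u q - v q))\<^sup>2) \<le> 2 * ennreal ((u p - u q)\<^sup>2) + 2 * ennreal ((v p - v q)\<^sup>2)" for p q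
    proof -
      have "((u p - v p) - (u q - v q))\<^sup>2 \<le> 2 * (u p - u q)\<^sup>2 + 2 * (v p - v q)\<^sup>2"
        using zero_le_power2[of "(u p - u q) + (v p - v q)"] by (simp add: power2_eq_square algebra_simps)
      then have "ennreal (((u p - v p) - (u q - v q))\<^sup>2) \<le> ennreal (2 * (u p - u q)\<^sup>2 + 2 * (v p - v q)\<^sup>2)"
        by (rule ennreal_leI)
      then show ?thesis by (simp add: ennreal_mult)
    qed
    then have "D (\<lambda>z. u z - v z) \<le> (\<integral>\<^sup>+p. \<integral>\<^sup>+q. 2 * ennreal ((u p - u q)\<^sup>2) + 2 * ennreal ((v p - v q)\<^sup>2) \<partial>?Q \<partial>?Q)"
      unfolding D_def by (intro nn_integral_mono)
    also have "\<dots> = 2 * D u + 2 * D v"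
      unfolding D_def by (simp add: nn_integral_add nn_integral_cmult)
    finally show ?thesis .
  qed
  also have "2 * D u + 2 * D v \<le> 2 * (4 * ennreal ?r2 * (?E * ennreal \<theta>)) + 2 * (4 * ennreal ?r2 * (?E' * ennreal \<theta>))"
    unfolding D_def by (intro add_mono mult_left_mono energy_controlled_cell[OF u Vm V ij small] energy_controlled_cell[OF v Vm V ij small]) auto
  also have "\<dots> + ennreal (2 * ?d\<^sup>2) = ennreal (2 * ?r2) * (ennreal (4 * \<theta>) * (?E + ?E') + ennreal (?d\<^sup>2 * (real n / 2)\<^sup>2))"
  proof -
    have "ennreal (2 * ?r2) * ennreal (?d\<^sup>2 * (real n / 2)\<^sup>2) = ennreal (2 * ?d\<^sup>2)"
      using n by (simp add: power_divide power2_eq_square flip: ennreal_mult)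
    moreover have "ennreal (2 * ?r2) = 2 * ennreal ?r2" "ennreal (4 * \<theta>) = 4 * ennreal \<theta>"
      using \<theta> by (simp_all add: ennreal_mult)
    ultimately show ?thesis
      by (simp add: distrib_left distrib_right) (simp add: mult_ac)
  qed
  finally have "ennreal (2 * ?r2) * (\<integral>\<^sup>+z. ennreal ((u z - v z)\<^sup>2) \<partial>?Q) \<le>
      ennreal (2 * ?r2) * (ennreal (4 * \<theta>) * (?E + ?E') + ennreal (?d\<^sup>2 * (real n / 2)\<^sup>2))"
    by (meson add_right_mono)
  then show ?thesis
    by (subst (asm) ennreal_mult_le_mult_iff) (use n in auto)
qed

text \<open>The subsequence has to be chosen before \<open>e\<close>, hence before the grid. All
  grids together have only countably many cells, so one diagonal subsequence makes the cell
  integrals converge for every grid at once.\<close>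

theorem plane_compactness:
  fixes u G H :: "nat \<Rightarrow> real \<times> real \<Rightarrow> real" and V :: "real \<times> real \<Rightarrow> real"
  assumes ctl: "\<And>k. energy_controlled V (u k) (G k) (H k)"
    and Vm: "V \<in> borel_measurable borel" and V: "\<And>z. 0 \<le> V z"
    and Vfin: "(\<integral>\<^sup>+z. ennreal (V z) \<partial>lborel_on unit_square) < \<infinity>"
    and L2: "\<And>k. (\<integral>\<^sup>+z. ennreal ((u k z)\<^sup>2) \<partial>lborel_on unit_square) \<le> ennreal B"
    and E: "\<And>k. (\<integral>\<^sup>+z. ennreal (H k z) \<partial>lborel_on unit_square) \<le> ennreal B"
  obtains r where "strict_mono (r :: nat \<Rightarrow> nat)"
    "\<And>e. 0 < e \<Longrightarrow> \<exists>n0. \<forall>k\<ge>n0. \<forall>l\<ge>n0.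
      (\<integral>\<^sup>+z. ennreal ((u (r k) z - u (r l) z)\<^sup>2) \<partial>lborel_on unit_square) \<le> ennreal e"
proof -
  have um[measurable]: "u k \<in> borel_measurable borel" and Hm[measurable]: "H k \<in> borel_measurable borel" for k
    using ctl[of k] by (auto simp: energy_controlled_def)
  have L2': "(\<integral>\<^sup>+z. ennreal ((u k z)\<^sup>2) \<partial>lborel_on unit_square) < \<infinity>" for k
    using L2[of k] by (simp add: order_le_less_trans)
  define f where "f k = (\<lambda>(n, i, j). if i < n \<and> j < n then LINT z|lborel_on (cell n i \<times> cell n j). u k z else 0)" for k
  \<comment> \<open>From \<open>\<bar>t\<bar> \<le> 1 + t^2\<close>, integrated over a cell, whose
    area is at most 4.\<close>
  have fb: "norm (f k p) \<le> 4 + \<bar>B\<bar>" for k and p :: "nat \<times> nat \<times> nat"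
  proof -
    obtain n i j where p: "p = (n, i, j)" by (cases p)
    show ?thesis
    proof (cases "i < n \<and> j < n")
      case True
      then have ij: "i < n" "j < n" by auto
      let ?Q = "lborel_on (cell n i \<times> cell n j)"
      interpret finite_measure ?Q by (rule finite_measure_cells)
      note iu = square_integrable_cells[OF um[of k] L2'[of k] ij]
      have "\<bar>LINT z|?Q. u k z\<bar> \<le> (LINT z|?Q. 1 + (u k z)\<^sup>2)"
      proof (rule integral_abs_bound[THEN order_trans], rule integral_mono)
        show "\<bar>u k z\<bar> \<le> 1 + (u k z)\<^sup>2" for z
        proof -
          have "0 \<le> (u k z)\<^sup>2 + 1 - 2 * \<bar>u k z\<bar>"
            using zero_le_power2[of "\<bar>u k z\<bar> - 1"] by (simp add: power2_diff)
          then show ?thesis using abs_ge_zero[of "u k z"] by linarith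
        qed
      qed (use iu in auto)
      also have "\<dots> = (2 / real n)\<^sup>2 + (LINT z|?Q. (u k z)\<^sup>2)"
        using iu by (simp add: measure_def emeasure_lborel_on_cells)
      also have "(2 / real n)\<^sup>2 \<le> 2\<^sup>2"
        using ij by (intro power_mono) (auto simp: field_simps)
      also have "(LINT z|?Q. (u k z)\<^sup>2) \<le> \<bar>B\<bar>"
      proof -
        have "ennreal (LINT z|?Q. (u k z)\<^sup>2) = (\<integral>\<^sup>+z. ennreal ((u k z)\<^sup>2) \<partial>?Q)"
          by (rule nn_integral_eq_integral[OF iu(1), symmetric]) simp
        also have "\<dots> \<le> (\<integral>\<^sup>+z. ennreal ((u k z)\<^sup>2) \<partial>lborel_on unit_square)"
          using cell_subset[OF ij(1)] cell_subset[OF ij(2)] by (intro nn_integral_lborel_on_mono_set) auto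
        also have "\<dots> \<le> ennreal \<bar>B\<bar>"
          using L2[of k] by (rule order_trans) (simp add: ennreal_leI)
        finally show ?thesis by (subst (asm) ennreal_le_iff) auto
      qed
      finally show ?thesis using True by (simp add: f_def p)
    qed (auto simp: f_def p)
  qed
  obtain r where r: "strict_mono (r :: nat \<Rightarrow> nat)" "\<And>p. p \<in> UNIV \<Longrightarrow> \<exists>l. (\<lambda>k. f (r k) p) \<longlonglongrightarrow> l"
    using function_convergent_subsequence[of UNIV f, OF _ fb] by auto
  show ?thesis
  proof (rule that[OF r(1)])
    fix e :: real assume e: "0 < e"
    \<comment> \<open>The energy terms add up to at most
      \<open>8 \<theta> \<bar>B\<bar> \<le> e / 2\<close>, and the summand 1 keeps the denominator
      positive when \<open>B = 0\<close>. The other \<open>e / 2\<close> is left for the cell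
      integrals.\<close>
    define \<theta> where "\<theta> = e / (16 * (\<bar>B\<bar> + 1))"
    have \<theta>: "0 < \<theta>" using e by (simp add: \<theta>_def)
    obtain n where n: "0 < n"
      and small: "\<And>i j. i < n \<Longrightarrow> j < n \<Longrightarrow> (\<integral>\<^sup>+z. ennreal (V z) \<partial>lborel_on (cell n i \<times> cell n j)) \<le> ennreal \<theta>"
      using small_cells[OF Vm V Vfin \<theta>] by blast
    define S where "S k l = (\<Sum>i<n. \<Sum>j<n. (f (r k) (n, i, j) - f (r l) (n, i, j))\<^sup>2 * (real n / 2)\<^sup>2)" for k l
    have "\<exists>n0. \<forall>k\<ge>n0. \<forall>l\<ge>n0. S k l < e / 2"
    proof -
      obtain L where L: "\<And>p. (\<lambda>k. f (r k) p) \<longlonglongrightarrow> L p" using r(2) by (metis UNIV_I)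
      \<comment> \<open>The product filter lets both indices tend to infinity independently, which
        merges finitely many Cauchy conditions into one threshold.\<close>
      have "((\<lambda>x. S (fst x) (snd x)) \<longlongrightarrow> (\<Sum>i<n. \<Sum>j<n. (L (n, i, j) - L (n, i, j))\<^sup>2 * (real n / 2)\<^sup>2)) (sequentially \<times>\<^sub>F sequentially)"
        unfolding S_def
        by (intro tendsto_intros filterlim_compose[OF L] filterlim_fst filterlim_snd)
      then have "((\<lambda>x. S (fst x) (snd x)) \<longlongrightarrow> 0) (sequentially \<times>\<^sub>F sequentially)" by simp
      then have "\<forall>\<^sub>F x in sequentially \<times>\<^sub>F sequentially. S (fst x) (snd x) < e / 2"
        using e by (intro order_tendstoD) auto
      then show ?thesis
        unfolding eventually_prod_sequentially by (auto simp: order_trans)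
    qed
    then obtain n0 where n0: "\<And>k l. k \<ge> n0 \<Longrightarrow> l \<ge> n0 \<Longrightarrow> S k l < e / 2" by blast
    have "(\<integral>\<^sup>+z. ennreal ((u (r k) z - u (r l) z)\<^sup>2) \<partial>lborel_on unit_square) \<le> ennreal e"
      if kl: "k \<ge> n0" "l \<ge> n0" for k l
    proof -
      let ?E = "\<lambda>k i j. \<integral>\<^sup>+z. ennreal (H (r k) z) \<partial>lborel_on (cell n i \<times> cell n j)"
      let ?d = "\<lambda>i j. (f (r k) (n, i, j) - f (r l) (n, i, j))\<^sup>2 * (real n / 2)\<^sup>2"
      have "(\<integral>\<^sup>+z. ennreal ((u (r k) z - u (r l) z)\<^sup>2) \<partial>lborel_on unit_square) =
          (\<Sum>i<n. \<Sum>j<n. \<integral>\<^sup>+z. ennreal ((u (r k) z - u (r l) z)\<^sup>2) \<partial>lborel_on (cell n i \<times> cell n j))"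
        by (intro nn_integral_cells[symmetric] n) measurable
      also have "\<dots> \<le> (\<Sum>i<n. \<Sum>j<n. ennreal (4 * \<theta>) * (?E k i j + ?E l i j) + ennreal (?d i j))"
      proof (intro sum_mono)
        fix i j assume "i \<in> {..<n}" "j \<in> {..<n}"
        then have ij: "i < n" "j < n" by auto
        show "(\<integral>\<^sup>+z. ennreal ((u (r k) z - u (r l) z)\<^sup>2) \<partial>lborel_on (cell n i \<times> cell n j)) \<le>
            ennreal (4 * \<theta>) * (?E k i j + ?E l i j) + ennreal (?d i j)"
          using energy_controlled_diff_cell[OF ctl[of "r k"] ctl[of "r l"] Vm V L2' L2' ij less_imp_le[OF \<theta>] small[OF ij]]
          by (simp add: f_def ij)
      qed
      also have "\<dots> = ennreal (4 * \<theta>) * ((\<Sum>i<n. \<Sum>j<n. ?E k i j) + (\<Sum>i<n. \<Sum>j<n. ?E l i j)) + ennreal (S k l)"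
        by (simp add: S_def sum.distrib sum_distrib_left distrib_left sum_nonneg flip: sum_ennreal)
      also have "\<dots> \<le> ennreal (4 * \<theta>) * (ennreal \<bar>B\<bar> + ennreal \<bar>B\<bar>) + ennreal (e / 2)"
      proof (intro add_mono mult_left_mono)
        have "(\<Sum>i<n. \<Sum>j<n. ?E k i j) \<le> ennreal \<bar>B\<bar>" for k
        proof -
          have "(\<Sum>i<n. \<Sum>j<n. ?E k i j) \<le> ennreal B"
            by (subst nn_integral_cells) (use n E in auto)
          also have "\<dots> \<le> ennreal \<bar>B\<bar>" by (simp add: ennreal_leI)
          finally show ?thesis .
        qed
        then show "(\<Sum>i<n. \<Sum>j<n. ?E k i j) \<le> ennreal \<bar>B\<bar>" "(\<Sum>i<n. \<Sum>j<n. ?E l i j) \<le> ennreal \<bar>B\<bar>" by blast+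
        show "ennreal (S k l) \<le> ennreal (e / 2)" using n0[OF kl] by (intro ennreal_leI) simp
      qed simp
      also have "\<dots> = ennreal (8 * \<theta> * \<bar>B\<bar> + e / 2)"
        using \<theta> e by (simp flip: ennreal_plus ennreal_mult)
      also have "\<dots> \<le> ennreal e"
      proof (rule ennreal_leI)
        have "\<theta> * (16 * (\<bar>B\<bar> + 1)) = e" by (simp add: \<theta>_def)
        then have "16 * (\<theta> * \<bar>B\<bar>) + 16 * \<theta> = e" by (simp add: algebra_simps)
        then show "8 * \<theta> * \<bar>B\<bar> + e / 2 \<le> e" using \<theta> by (simp add: mult.assoc)
      qed
      finally show ?thesis .
    qed
    then show "\<exists>n0. \<forall>k\<ge>n0. \<forall>l\<ge>n0.
      (\<integral>\<^sup>+z. ennreal ((u (r k) z - u (r l) z)\<^sup>2) \<partial>lborel_on unit_square) \<le> ennreal e"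
      by blast
  qed
qed

section \<open>Representatives and limits\<close>

text \<open>Completeness of \<open>L^2\<close> with the limit function left open: it may be any
  measurable pointwise limit of the subsequence, which later permits a periodic choice. On a finite
  measure space Cauchy in \<open>L^2\<close> gives Cauchy in \<open>L^1\<close>, hence an almost
  everywhere convergent subsequence; Fatou along it yields convergence of the whole
  sequence.\<close>

lemma L2_limit:
  fixes f :: "nat \<Rightarrow> 'a \<Rightarrow> real"
  assumes "finite_measure M" and [measurable]: "\<And>k. f k \<in> borel_measurable M"
    and L2: "\<And>k. integrable M (\<lambda>x. (f k x)\<^sup>2)"
    and Cauchy: "\<And>e. 0 < e \<Longrightarrow> \<exists>n0. \<forall>k\<ge>n0. \<forall>l\<ge>n0. (\<integral>\<^sup>+x. ennreal ((f k x - f l x)\<^sup>2) \<partial>M) \<le> ennreal e"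
  obtains s where "strict_mono (s :: nat \<Rightarrow> nat)" "AE x in M. Cauchy (\<lambda>i. f (s i) x)"
    "\<And>v. v \<in> borel_measurable M \<Longrightarrow> (AE x in M. (\<lambda>i. f (s i) x) \<longlonglongrightarrow> v x) \<Longrightarrow>
      integrable M (\<lambda>x. (v x)\<^sup>2) \<and> (\<lambda>k. LINT x|M. (f k x - v x)\<^sup>2) \<longlonglongrightarrow> 0"
proof -
  interpret finite_measure M by fact
  have if1: "integrable M (f k)" for k
    by (rule square_integrable_imp_integrable[OF _ L2]) measurable
  have sq_le: "(a - b)\<^sup>2 \<le> 2 * a\<^sup>2 + 2 * b\<^sup>2" for a b :: real
    using zero_le_power2[of "a + b"] by (simp add: power2_eq_square algebra_simps)
  have diff_int: "integrable M (\<lambda>x. (a x - b x)\<^sup>2)"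
    if "integrable M (\<lambda>x. (a x)\<^sup>2)" "integrable M (\<lambda>x. (b x)\<^sup>2)" "a \<in> borel_measurable M" "b \<in> borel_measurable M"
    for a b :: "'a \<Rightarrow> real"
  proof (rule Bochner_Integration.integrable_bound)
    show "integrable M (\<lambda>x. 2 * (a x)\<^sup>2 + 2 * (b x)\<^sup>2)" using that by simp
    show "(\<lambda>x. (a x - b x)\<^sup>2) \<in> borel_measurable M" using that(3,4) by measurable
    show "AE x in M. norm ((a x - b x)\<^sup>2) \<le> norm (2 * (a x)\<^sup>2 + 2 * (b x)\<^sup>2)"
      using sq_le by simp
  qed
  have L1: "\<exists>N. \<forall>i\<ge>N. \<forall>j\<ge>N. (LINT x|M. norm (f i x - f j x)) < t" if t: "0 < t" for t
  proof -
    let ?m = "measure M (space M)"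
    have m: "0 < ?m + 1" using measure_nonneg[of M "space M"] by linarith
    \<comment> \<open>Cauchy-Schwarz bounds the square of the \<open>L^1\<close> distance by
      \<open>e\<close> times the total mass; the summand 1 makes the final inequality strict and
      covers total mass zero.\<close>
    define e where "e = t\<^sup>2 / (?m + 1)"
    have e: "0 < e" and em: "e * (?m + 1) = t\<^sup>2" using t m by (auto simp: e_def)
    obtain n0 where n0: "\<And>k l. k \<ge> n0 \<Longrightarrow> l \<ge> n0 \<Longrightarrow> (\<integral>\<^sup>+x. ennreal ((f k x - f l x)\<^sup>2) \<partial>M) \<le> ennreal e"
      using Cauchy[OF e] by blast
    have "(LINT x|M. norm (f i x - f j x)) < t" if "i \<ge> n0" "j \<ge> n0" for i j
    proof -
      let ?X = "LINT x|M. norm (f i x - f j x)"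
      have X0: "0 \<le> ?X" by simp
      have X: "ennreal ?X = (\<integral>\<^sup>+x. ennreal (norm (f i x - f j x)) \<partial>M)"
        using if1 by (intro nn_integral_eq_integral[symmetric]) auto
      have "ennreal (?X\<^sup>2) = (\<integral>\<^sup>+x. ennreal (norm (f i x - f j x)) * 1 \<partial>M)\<^sup>2"
        by (simp only: mult_1_right X[symmetric] ennreal_power[OF X0])
      also have "\<dots> \<le> (\<integral>\<^sup>+x. (ennreal (norm (f i x - f j x)))\<^sup>2 \<partial>M) * (\<integral>\<^sup>+x. 1\<^sup>2 \<partial>M)"
        by (intro Cauchy_Schwarz_nn_integral) measurable
      also have "\<dots> = (\<integral>\<^sup>+x. ennreal ((f i x - f j x)\<^sup>2) \<partial>M) * ennreal ?m"
        by (simp add: ennreal_power emeasure_eq_measure)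
      also have "\<dots> \<le> ennreal e * ennreal ?m"
        using n0[OF that] by (rule mult_right_mono) simp
      also have "\<dots> = ennreal (e * ?m)"
        by (rule ennreal_mult[symmetric]) (use e in auto)
      finally have "?X\<^sup>2 \<le> e * ?m" using e by (subst (asm) ennreal_le_iff) (auto intro: mult_nonneg_nonneg)
      also have "e * ?m < e * (?m + 1)" using e by (intro mult_strict_left_mono) auto
      also have "\<dots> = t\<^sup>2" by (rule em)
      finally have "?X\<^sup>2 < t\<^sup>2" .
      then show ?thesis by (rule power2_less_imp_less) (use t in simp)
    qed
    then show ?thesis by blast
  qed
  obtain s where s: "strict_mono s" "AE x in M. Cauchy (\<lambda>i. f (s i) x)"
    using cauchy_L1_AE_cauchy_subseq[OF if1 L1] by blast
  show ?thesis
  proof (rule that[OF s])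
    fix v assume v[measurable]: "v \<in> borel_measurable M" and lim: "AE x in M. (\<lambda>i. f (s i) x) \<longlonglongrightarrow> v x"
    have Fatou: "\<exists>n0. \<forall>k\<ge>n0. (\<integral>\<^sup>+x. ennreal ((f k x - v x)\<^sup>2) \<partial>M) \<le> ennreal e" if e: "0 < e" for e
    proof -
      obtain n0 where n0: "\<And>k l. k \<ge> n0 \<Longrightarrow> l \<ge> n0 \<Longrightarrow> (\<integral>\<^sup>+x. ennreal ((f k x - f l x)\<^sup>2) \<partial>M) \<le> ennreal e"
        using Cauchy[OF e] by blast
      have "(\<integral>\<^sup>+x. ennreal ((f k x - v x)\<^sup>2) \<partial>M) \<le> ennreal e" if k: "k \<ge> n0" for k
      proof -
        have "(\<integral>\<^sup>+x. ennreal ((f k x - v x)\<^sup>2) \<partial>M) = (\<integral>\<^sup>+x. liminf (\<lambda>i. ennreal ((f k x - f (s i) x)\<^sup>2)) \<partial>M)"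
        proof (rule nn_integral_cong_AE, use lim in eventually_elim)
          case (elim x)
          then have "(\<lambda>i. ennreal ((f k x - f (s i) x)\<^sup>2)) \<longlonglongrightarrow> ennreal ((f k x - v x)\<^sup>2)"
            by (intro tendsto_intros)
          then show ?case by (intro lim_imp_Liminf[symmetric]) auto
        qed
        also have "\<dots> \<le> liminf (\<lambda>i. \<integral>\<^sup>+x. ennreal ((f k x - f (s i) x)\<^sup>2) \<partial>M)"
          by (intro nn_integral_liminf) measurable
        also have "\<dots> \<le> ennreal e"
        proof (rule Liminf_le)
          show "\<forall>\<^sub>F i in sequentially. (\<integral>\<^sup>+x. ennreal ((f k x - f (s i) x)\<^sup>2) \<partial>M) \<le> ennreal e"
            using eventually_ge_at_top[of n0]
            by eventually_elim (use n0[OF k] seq_suble[OF s(1)] order_trans in blast)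
        qed simp
        finally show ?thesis .
      qed
      then show ?thesis by blast
    qed
    have iv: "integrable M (\<lambda>x. (v x)\<^sup>2)"
    proof -
      obtain k where k: "(\<integral>\<^sup>+x. ennreal ((f k x - v x)\<^sup>2) \<partial>M) \<le> ennreal 1"
        using Fatou[of 1] by auto
      have "integrable M (\<lambda>x. (f k x - v x)\<^sup>2)"
        using k by (intro integrableI_nonneg) (auto simp: order_le_less_trans)
      from diff_int[OF L2[of k] this] show ?thesis by simp
    qed
    moreover have "(\<lambda>k. LINT x|M. (f k x - v x)\<^sup>2) \<longlonglongrightarrow> 0"
    proof (rule LIMSEQ_I)
      fix e :: real assume e: "0 < e"
      then obtain n0 where n0: "\<And>k. k \<ge> n0 \<Longrightarrow> (\<integral>\<^sup>+x. ennreal ((f k x - v x)\<^sup>2) \<partial>M) \<le> ennreal (e / 2)"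
        using Fatou[of "e / 2"] by auto
      have "norm ((LINT x|M. (f k x - v x)\<^sup>2) - 0) < e" if "k \<ge> n0" for k
      proof -
        have "ennreal (LINT x|M. (f k x - v x)\<^sup>2) = (\<integral>\<^sup>+x. ennreal ((f k x - v x)\<^sup>2) \<partial>M)"
          by (rule nn_integral_eq_integral[OF diff_int[OF L2 iv], symmetric]) auto
        also note n0[OF that]
        finally have "(LINT x|M. (f k x - v x)\<^sup>2) \<le> e / 2"
          using e by (subst (asm) ennreal_le_iff) auto
        then show ?thesis using e by simp
      qed
      then show "\<exists>n0. \<forall>k\<ge>n0. norm ((LINT x|M. (f k x - v x)\<^sup>2) - 0) < e" by blast
    qed
    ultimately show "integrable M (\<lambda>x. (v x)\<^sup>2) \<and> (\<lambda>k. LINT x|M. (f k x - v x)\<^sup>2) \<longlonglongrightarrow> 0" ..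
  qed
qed

text \<open>The function spaces are defined with the completed measure, while Tonelli is run on
  Borel representatives; this passes between the two.\<close>

lemma
  fixes f f' :: "'a::euclidean_space \<Rightarrow> 'b::euclidean_space"
  assumes f: "f \<in> borel_measurable lebesgue" and [measurable]: "f' \<in> borel_measurable borel"
    and eq: "AE x in lborel. f x = f' x"
  shows set_integrable_lebesgue_borel:
      "set_integrable lebesgue per_box f \<longleftrightarrow> integrable (lborel_on per_box) f'"
    and set_integral_lebesgue_borel:
      "set_lebesgue_integral lebesgue per_box f = integral\<^sup>L (lborel_on per_box) f'"
proof -
  have f'm: "(\<lambda>x. indicator per_box x *\<^sub>R f' x) \<in> borel_measurable lborel" by measurable
  have f'l: "(\<lambda>x. indicator per_box x *\<^sub>R f' x) \<in> borel_measurable lebesgue"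
    by (rule measurable_completion[OF f'm])
  have fl: "(\<lambda>x. indicator per_box x *\<^sub>R f x) \<in> borel_measurable lebesgue"
    by (intro borel_measurable_scaleR f borel_measurable_indicator) (metis per_box_measurable sets_completionI_sets sets_lborel)
  have ae: "AE x in lebesgue. indicator per_box x *\<^sub>R f x = indicator per_box x *\<^sub>R f' x"
    by (rule AE_completion) (use eq in eventually_elim, simp)
  show "set_integrable lebesgue per_box f \<longleftrightarrow> integrable (lborel_on per_box) f'"
    using integrable_cong_AE[OF fl f'l ae] integrable_completion[OF f'm]
    by (simp add: integrable_lborel_on set_integrable_def)
  show "set_lebesgue_integral lebesgue per_box f = integral\<^sup>L (lborel_on per_box) f'"
    using integral_cong_AE[OF fl f'l ae] integral_completion[OF f'm]
    by (simp add: integral_lborel_on set_lebesgue_integral_def)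
qed

text \<open>Collects what the plane argument needs, in terms of Borel functions. The lower bound of
  \<open>\<alpha>\<close> replaces the weight by the explicit \<open>dist_pow\<close>, at the price
  of the factor \<open>c\<close> in the energy.\<close>

lemma H1_per_representative:
  fixes u :: "'a::euclidean_space \<Rightarrow> real"
  assumes u: "u \<in> H1_per \<alpha>" and c: "1 \<le> c" and \<alpha>0: "\<And>x. 0 \<le> \<alpha> x"
    and low: "\<And>x. x \<in> per_box \<Longrightarrow> 1 / c * dist_pow \<Gamma> \<sigma> x \<le> \<alpha> x"
  obtains u' g where "u' \<in> borel_measurable borel" "(g :: 'a \<Rightarrow> 'a) \<in> borel_measurable borel"
    "AE x in lborel. u x = u' x"
    "\<And>b h. b \<in> Basis \<Longrightarrow> 0 \<le> h \<Longrightarrow> h \<le> 2 \<Longrightarrow> AE x in lborel_on per_box.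
      ennreal \<bar>u' (x + h *\<^sub>R b) - u' x\<bar> \<le> (\<integral>\<^sup>+s\<in>{0..h}. ennreal (norm (g (x + s *\<^sub>R b))) \<partial>lborel)"
    "integrable (lborel_on per_box) (\<lambda>x. (u' x)\<^sup>2)"
    "(\<integral>\<^sup>+x. ennreal ((u' x)\<^sup>2) \<partial>lborel_on per_box) \<le> ennreal ((H1_norm \<alpha> u)\<^sup>2)"
    "(\<integral>\<^sup>+x. ennreal (dist_pow \<Gamma> \<sigma> x * (norm (g x))\<^sup>2) \<partial>lborel_on per_box) \<le> ennreal (c * (H1_norm \<alpha> u)\<^sup>2)"
proof -
  let ?M = "lborel_on (per_box :: 'a set)"
  let ?g = "per_gradient u"
  have u_per: "periodic u" and um: "u \<in> borel_measurable lebesgue"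
    and u2: "set_integrable lebesgue per_box (\<lambda>x. (u x)\<^sup>2)"
    and ex: "\<exists>g. has_per_gradient u g"
    and en: "set_integrable lebesgue per_box (\<lambda>x. \<alpha> x * (norm (?g x))\<^sup>2)"
    using u by (auto simp: H1_per_def L2_per_def)
  have "has_per_gradient u ?g"
    unfolding per_gradient_def using ex by (rule someI_ex)
  then have g_per: "periodic ?g" and gm: "?g \<in> borel_measurable lebesgue"
    and gi: "set_integrable lebesgue per_box ?g"
    and weak: "\<And>\<phi> b. smooth \<phi> \<Longrightarrow> periodic \<phi> \<Longrightarrow> b \<in> Basis \<Longrightarrow>
        set_lebesgue_integral lebesgue per_box (\<lambda>x. u x * frechet_derivative \<phi> (at x) b) =
        - set_lebesgue_integral lebesgue per_box (\<lambda>x. (?g x \<bullet> b) * \<phi> x)"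
    by (auto simp: has_per_gradient_def L1_per_def)
  obtain u' where u': "u' \<in> borel_measurable borel" "periodic u'" "AE x in lborel. u x = u' x"
    using periodic_ex_borel[OF um u_per] .
  obtain g where g: "g \<in> borel_measurable borel" "periodic g" "AE x in lborel. ?g x = g x"
    using periodic_ex_borel[OF gm g_per] .
  note [measurable] = u'(1) g(1)
  have iu2: "integrable ?M (\<lambda>x. (u' x)\<^sup>2)"
    using u2 by (subst (asm) set_integrable_lebesgue_borel[where f'="\<lambda>x. (u' x)\<^sup>2"])
       (use um u' in \<open>auto elim!: eventually_mono\<close>)
  have iu: "integrable ?M u'"
    by (rule per_box.square_integrable_imp_integrable[OF _ iu2]) simp
  have ig: "integrable ?M g"
    using gi set_integrable_lebesgue_borel[OF gm g(1,3)] by simp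
  show ?thesis
  proof (rule that[OF u'(1) g(1) u'(3) _ iu2])
    fix b :: 'a and h :: real assume b: "b \<in> Basis" and h: "0 \<le> h" "h \<le> 2"
    let ?N = "lborel_on {0..h}"
    have "AE x in ?M. u' (x + h *\<^sub>R b) - u' x = (LINT s|?N. g (x + s *\<^sub>R b) \<bullet> b)"
    proof (rule weak_derivative_line_integral[where w="\<lambda>x. g x \<bullet> b"])
      show "periodic (\<lambda>x. g x \<bullet> b)" using g(2) by (auto simp: periodic_def)
      show "integrable ?M (\<lambda>x. g x \<bullet> b)" using ig by simp
      fix \<phi> :: "'a \<Rightarrow> real" assume \<phi>: "smooth \<phi>" "periodic \<phi>"
      have cont: "\<phi> \<in> borel_measurable borel" "(\<lambda>x. frechet_derivative \<phi> (at x) b) \<in> borel_measurable borel"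
        by (intro borel_measurable_continuous_onI smooth_continuous smooth_continuous_derivative \<phi>)+
      have contl: "\<phi> \<in> borel_measurable lebesgue" "(\<lambda>x. frechet_derivative \<phi> (at x) b) \<in> borel_measurable lebesgue"
        using cont by (auto intro: measurable_completion simp: measurable_lborel1)
      have "(LINT x|?M. u' x * frechet_derivative \<phi> (at x) b) =
          set_lebesgue_integral lebesgue per_box (\<lambda>x. u x * frechet_derivative \<phi> (at x) b)"
        by (rule set_integral_lebesgue_borel[symmetric])
           (use cont contl um u'(3) in \<open>auto elim!: eventually_mono\<close>)
      also have "\<dots> = - set_lebesgue_integral lebesgue per_box (\<lambda>x. (?g x \<bullet> b) * \<phi> x)"
        by (rule weak[OF \<phi> b])
      also have "set_lebesgue_integral lebesgue per_box (\<lambda>x. (?g x \<bullet> b) * \<phi> x) = (LINT x|?M. (g x \<bullet> b) * \<phi> x)"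
        by (rule set_integral_lebesgue_borel)
           (use cont contl gm g(3) in \<open>auto elim!: eventually_mono\<close>)
      finally show "(LINT x|?M. u' x * frechet_derivative \<phi> (at x) b) = - (LINT x|?M. (g x \<bullet> b) * \<phi> x)" .
    qed (use u' iu b h in auto)
    then show "AE x in ?M. ennreal \<bar>u' (x + h *\<^sub>R b) - u' x\<bar> \<le> (\<integral>\<^sup>+s\<in>{0..h}. ennreal (norm (g (x + s *\<^sub>R b))) \<partial>lborel)"
    proof eventually_elim
      case (elim x)
      have "ennreal \<bar>u' (x + h *\<^sub>R b) - u' x\<bar> = ennreal (norm (LINT s|?N. g (x + s *\<^sub>R b) \<bullet> b))"
        by (simp add: elim)
      also have "\<dots> \<le> (\<integral>\<^sup>+s. ennreal (norm (g (x + s *\<^sub>R b) \<bullet> b)) \<partial>?N)"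
      proof (cases "integrable ?N (\<lambda>s. g (x + s *\<^sub>R b) \<bullet> b)")
        case True
        then show ?thesis by (rule integral_norm_bound_ennreal)
      next
        \<comment> \<open>The Bochner integral of a non-integrable function is 0 by convention, so
          the bound is trivial here.\<close>
        case False
        then show ?thesis by (simp add: not_integrable_integral_eq)
      qed
      also have "\<dots> \<le> (\<integral>\<^sup>+s. ennreal (norm (g (x + s *\<^sub>R b))) \<partial>?N)"
        using b by (intro nn_integral_mono ennreal_leI) (simp add: Basis_le_norm)
      also have "\<dots> = (\<integral>\<^sup>+s\<in>{0..h}. ennreal (norm (g (x + s *\<^sub>R b))) \<partial>lborel)"
        by (rule nn_integral_lborel_on) measurable
      finally show ?case .
    qed
  next
    have "(H1_norm \<alpha> u)\<^sup>2 = (L2_norm u)\<^sup>2 + (L2_norm (\<lambda>x. sqrt (\<alpha> x) *\<^sub>R ?g x))\<^sup>2"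
      by (simp add: H1_norm_def)
    also have "(L2_norm u)\<^sup>2 = (LINT x|?M. (u' x)\<^sup>2)"
    proof -
      have "(LINT x:per_box|lebesgue. (u x)\<^sup>2) = (LINT x|?M. (u' x)\<^sup>2)"
        by (rule set_integral_lebesgue_borel) (use um u' in \<open>auto elim!: eventually_mono\<close>)
      then show ?thesis by (simp add: L2_norm_def)
    qed
    also have "(L2_norm (\<lambda>x. sqrt (\<alpha> x) *\<^sub>R ?g x))\<^sup>2 = (LINT x:per_box|lebesgue. \<alpha> x * (norm (?g x))\<^sup>2)"
      using \<alpha>0 by (simp add: L2_norm_def power_mult_distrib set_lebesgue_integral_def)
    finally have N: "(H1_norm \<alpha> u)\<^sup>2 = (LINT x|?M. (u' x)\<^sup>2) + (LINT x:per_box|lebesgue. \<alpha> x * (norm (?g x))\<^sup>2)" .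
    have e0: "0 \<le> (LINT x:per_box|lebesgue. \<alpha> x * (norm (?g x))\<^sup>2)"
      unfolding set_lebesgue_integral_def using \<alpha>0 by (intro integral_nonneg_AE) simp
    show "(\<integral>\<^sup>+x. ennreal ((u' x)\<^sup>2) \<partial>?M) \<le> ennreal ((H1_norm \<alpha> u)\<^sup>2)"
      using e0 by (subst nn_integral_eq_integral[OF iu2]) (auto simp: N intro: ennreal_leI)
    let ?k = "\<lambda>x. indicator per_box x *\<^sub>R (\<alpha> x * (norm (?g x))\<^sup>2)"
    have ik: "integrable lebesgue (\<lambda>x. c * ?k x)"
      using en by (simp add: set_integrable_def)
    have "(\<integral>\<^sup>+x. ennreal (dist_pow \<Gamma> \<sigma> x * (norm (g x))\<^sup>2) \<partial>?M) =
        (\<integral>\<^sup>+x. ennreal (dist_pow \<Gamma> \<sigma> x * (norm (g x))\<^sup>2) * indicator per_box x \<partial>lborel)"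
      by (rule nn_integral_lborel_on) measurable
    also have "\<dots> = (\<integral>\<^sup>+x. ennreal (dist_pow \<Gamma> \<sigma> x * (norm (g x))\<^sup>2) * indicator per_box x \<partial>lebesgue)"
      by (rule nn_integral_completion[symmetric])
    also have "\<dots> \<le> (\<integral>\<^sup>+x. ennreal (c * ?k x) \<partial>lebesgue)"
    proof (rule nn_integral_mono_AE, rule AE_completion, use g(3) in eventually_elim)
      case (elim x)
      have "dist_pow \<Gamma> \<sigma> x * (norm (g x))\<^sup>2 \<le> c * (\<alpha> x * (norm (g x))\<^sup>2)" if "x \<in> per_box"
      proof -
        have "dist_pow \<Gamma> \<sigma> x \<le> c * \<alpha> x" using low[OF that] c by (simp add: field_simps)
        then have "dist_pow \<Gamma> \<sigma> x * (norm (g x))\<^sup>2 \<le> c * \<alpha> x * (norm (g x))\<^sup>2"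
          by (rule mult_right_mono) simp
        then show ?thesis by (simp add: mult.assoc)
      qed
      then show ?case by (auto simp: elim intro: ennreal_leI split: split_indicator)
    qed
    also have "\<dots> = ennreal (LINT x|lebesgue. c * ?k x)"
      using c \<alpha>0 by (intro nn_integral_eq_integral[OF ik] AE_I2) auto
    also have "\<dots> = ennreal (c * (LINT x:per_box|lebesgue. \<alpha> x * (norm (?g x))\<^sup>2))"
      by (simp add: set_lebesgue_integral_def)
    also have "\<dots> \<le> ennreal (c * (H1_norm \<alpha> u)\<^sup>2)"
      using c by (intro ennreal_leI mult_left_mono) (auto simp: N)
    finally show "(\<integral>\<^sup>+x. ennreal (dist_pow \<Gamma> \<sigma> x * (norm (g x))\<^sup>2) \<partial>?M) \<le> ennreal (c * (H1_norm \<alpha> u)\<^sup>2)" .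
  qed
qed

section \<open>Reduction to the plane\<close>

text \<open>The exceptional set is contained in a Borel null set, and the integral identity applied
  to its indicator makes the preimage null. The factor \<open>\<kappa>\<close> absorbs the dummy
  coordinate of dimension one.\<close>

lemma AE_chart:
  fixes T :: "'b::euclidean_space \<Rightarrow> 'a::euclidean_space"
  assumes [measurable]: "T \<in> borel_measurable borel" "A \<in> sets borel" "S \<in> sets borel"
    and nn: "\<And>f. f \<in> borel_measurable borel \<Longrightarrow>
      (\<integral>\<^sup>+z. f (T z) \<partial>lborel_on S) = \<kappa> * (\<integral>\<^sup>+x. f x \<partial>lborel_on A)"
    and ae: "AE x in lborel_on A. P x"
  shows "AE z in lborel_on S. P (T z)"
proof -
  obtain N where N: "{x \<in> space (lborel_on A). \<not> P x} \<subseteq> N" "emeasure (lborel_on A) N = 0" "N \<in> sets (lborel_on A)"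
    using ae by (rule AE_E)
  then have [measurable]: "N \<in> sets borel" by simp
  have "(\<integral>\<^sup>+z. indicator N (T z) \<partial>lborel_on S) = \<kappa> * (\<integral>\<^sup>+x. indicator N x \<partial>lborel_on A)"
    by (rule nn) measurable
  also have "\<dots> = 0" using N by simp
  finally have "AE z in lborel_on S. (indicator N (T z) :: ennreal) = 0"
    by (subst (asm) nn_integral_0_iff_AE) auto
  then show ?thesis
    by eventually_elim (use N(1) in \<open>auto simp: indicator_def split: if_splits\<close>)
qed

lemma lborel_chart_1:
  fixes b :: "'a::euclidean_space"
  assumes B: "Basis = {b}"
  shows "lborel = distr lborel borel (\<lambda>s::real. s *\<^sub>R b)"
proof (rule lborel_eqI)
  fix l u :: 'a assume lu: "\<And>b. b \<in> Basis \<Longrightarrow> l \<bullet> b \<le> u \<bullet> b"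
  have bb: "b \<bullet> b = 1" using B by (metis inner_same_Basis insertI1)
  have "(\<lambda>s. s *\<^sub>R b) -` box l u = {l \<bullet> b<..<u \<bullet> b}"
    using bb by (auto simp: mem_box B)
  then show "emeasure (distr lborel borel (\<lambda>s::real. s *\<^sub>R b)) (box l u) = (\<Prod>b\<in>Basis. (u - l) \<bullet> b)"
    using lu by (simp add: emeasure_distr B inner_diff_left)
qed simp

lemma lborel_chart_2:
  fixes b c :: "'a::euclidean_space"
  assumes B: "Basis = {b, c}" and bc: "b \<noteq> c"
  shows "lborel = distr lborel borel (\<lambda>z::real \<times> real. fst z *\<^sub>R b + snd z *\<^sub>R c)"
proof (rule lborel_eqI)
  let ?T = "\<lambda>z::real \<times> real. fst z *\<^sub>R b + snd z *\<^sub>R c"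
  fix l u :: 'a assume lu: "\<And>b. b \<in> Basis \<Longrightarrow> l \<bullet> b \<le> u \<bullet> b"
  have in_b: "b \<in> Basis" "c \<in> Basis" using B by auto
  then have ip: "b \<bullet> b = 1" "c \<bullet> c = 1" "b \<bullet> c = 0" "c \<bullet> b = 0"
    using bc by (auto simp: inner_Basis)
  have "?T -` box l u = {l \<bullet> b<..<u \<bullet> b} \<times> {l \<bullet> c<..<u \<bullet> c}"
    by (auto simp: mem_box B inner_add_left ip)
  moreover have "emeasure lborel ({l \<bullet> b<..<u \<bullet> b} \<times> {l \<bullet> c<..<u \<bullet> c}) = ennreal ((u - l) \<bullet> b * ((u - l) \<bullet> c))"
  proof -
    have "emeasure lborel ({l \<bullet> b<..<u \<bullet> b} \<times> {l \<bullet> c<..<u \<bullet> c}) =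
        emeasure (lborel \<Otimes>\<^sub>M lborel) ({l \<bullet> b<..<u \<bullet> b} \<times> {l \<bullet> c<..<u \<bullet> c})"
      by (simp only: lborel_prod)
    also have "\<dots> = emeasure lborel {l \<bullet> b<..<u \<bullet> b} * emeasure lborel {l \<bullet> c<..<u \<bullet> c}"
      by (rule lborel.emeasure_pair_measure_Times) auto
    also have "\<dots> = ennreal ((u - l) \<bullet> b * ((u - l) \<bullet> c))"
      using lu in_b by (simp add: inner_diff_left ennreal_mult)
    finally show ?thesis .
  qed
  ultimately show "emeasure (distr lborel borel ?T) (box l u) = (\<Prod>b\<in>Basis. (u - l) \<bullet> b)"
    using bc by (simp add: emeasure_distr B)
qed simp

text \<open>
  In dimension one the second coordinate of the chart is a dummy, so that one plane argument serves both
  dimensions.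
\<close>
lemma plane_chart:
  assumes "DIM('a::euclidean_space) \<in> {1, 2}"
  obtains b c :: "'a::euclidean_space" and \<kappa> :: real where "b \<in> Basis" "c \<in> Basis \<or> c = 0" "0 < \<kappa>"
    "\<And>f. f \<in> borel_measurable borel \<Longrightarrow>
      (\<integral>\<^sup>+z. f (fst z *\<^sub>R b + snd z *\<^sub>R c) \<partial>lborel_on unit_square) = ennreal \<kappa> * (\<integral>\<^sup>+x. f x \<partial>lborel_on per_box)"
proof (cases "DIM('a) = 1")
  case True
  then obtain b :: 'a where B: "Basis = {b}" by (auto simp: card_1_singleton_iff)
  then have bb: "b \<bullet> b = 1" by (metis inner_same_Basis insertI1)
  show ?thesis
  \<comment> \<open>The dummy coordinate contributes its length 2 as
    \<open>\<kappa>\<close>.\<close>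
  proof (rule that[of b 0 2])
    fix f :: "'a \<Rightarrow> ennreal" assume [measurable]: "f \<in> borel_measurable borel"
    have "(\<integral>\<^sup>+z. f (fst z *\<^sub>R b + snd z *\<^sub>R 0) \<partial>lborel_on unit_square) =
        (\<integral>\<^sup>+s. \<integral>\<^sup>+t. f (s *\<^sub>R b) \<partial>lborel_on {-1..<1::real} \<partial>lborel_on {-1..<1})"
      by (subst nn_integral_lborel_on_Times) simp_all
    also have "\<dots> = (\<integral>\<^sup>+s. ennreal 2 * f (s *\<^sub>R b) \<partial>lborel_on {-1..<1})"
      by (simp add: emeasure_lborel_on mult.commute)
    also have "\<dots> = ennreal 2 * (\<integral>\<^sup>+s. f (s *\<^sub>R b) \<partial>lborel_on {-1..<1})"
      by (rule nn_integral_cmult) measurable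
    also have "(\<integral>\<^sup>+s. f (s *\<^sub>R b) \<partial>lborel_on {-1..<1}) = (\<integral>\<^sup>+s. f (s *\<^sub>R b) * indicator per_box (s *\<^sub>R b) \<partial>lborel)"
      by (subst nn_integral_lborel_on) (auto intro!: nn_integral_cong simp: per_box_def B bb indicator_def)
    also have "\<dots> = (\<integral>\<^sup>+x. f x * indicator per_box x \<partial>distr lborel borel (\<lambda>s::real. s *\<^sub>R b))"
      by (rule nn_integral_distr[symmetric]) measurable
    also have "\<dots> = (\<integral>\<^sup>+x. f x \<partial>lborel_on per_box)"
      by (simp only: lborel_chart_1[OF B, symmetric]) (simp add: nn_integral_lborel_on)
    finally show "(\<integral>\<^sup>+z. f (fst z *\<^sub>R b + snd z *\<^sub>R 0) \<partial>lborel_on unit_square) = ennreal 2 * (\<integral>\<^sup>+x. f x \<partial>lborel_on per_box)" .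
  qed (use B in auto)
next
  case False
  then have "card (Basis :: 'a set) = 2" using assms by auto
  then obtain b c :: 'a where B: "Basis = {b, c}" and bc: "b \<noteq> c" by (auto simp: card_2_iff)
  then have in_b: "b \<in> Basis" "c \<in> Basis" by auto
  then have ip: "b \<bullet> b = 1" "c \<bullet> c = 1" "b \<bullet> c = 0" "c \<bullet> b = 0"
    using bc by (auto simp: inner_Basis)
  show ?thesis
  proof (rule that[of b c 1])
    fix f :: "'a \<Rightarrow> ennreal" assume [measurable]: "f \<in> borel_measurable borel"
    let ?T = "\<lambda>z::real \<times> real. fst z *\<^sub>R b + snd z *\<^sub>R c"
    have "(\<integral>\<^sup>+z. f (?T z) \<partial>lborel_on unit_square) = (\<integral>\<^sup>+z. f (?T z) * indicator per_box (?T z) \<partial>lborel)"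
      by (subst nn_integral_lborel_on) (auto intro!: nn_integral_cong simp: per_box_def B inner_add_left ip indicator_def)
    also have "\<dots> = (\<integral>\<^sup>+x. f x * indicator per_box x \<partial>distr lborel borel ?T)"
      by (rule nn_integral_distr[symmetric]) measurable
    also have "\<dots> = (\<integral>\<^sup>+x. f x \<partial>lborel_on per_box)"
      by (simp only: lborel_chart_2[OF B bc, symmetric]) (simp add: nn_integral_lborel_on)
    finally show "(\<integral>\<^sup>+z. f (?T z) \<partial>lborel_on unit_square) = ennreal 1 * (\<integral>\<^sup>+x. f x \<partial>lborel_on per_box)" by simp
  qed (use in_b in auto)
qed

text \<open>Moving a plane coordinate moves the point along \<open>b\<close> or \<open>c\<close>, so
  the line inequalities carry over. For \<open>c = 0\<close> nothing moves and the inequality in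
  that direction has left-hand side 0. Where the weight is positive, the energy density times its
  reciprocal is the squared length of the gradient.\<close>

lemma energy_controlled_chart:
  fixes u :: "'a::euclidean_space \<Rightarrow> real" and g :: "'a \<Rightarrow> 'a" and b c :: 'a
  assumes [measurable]: "u \<in> borel_measurable borel" "g \<in> borel_measurable borel" "\<rho> \<in> borel_measurable borel"
    and \<rho>0: "\<And>x. 0 \<le> \<rho> x" and \<rho>: "AE x in lborel_on per_box. 0 < \<rho> x"
    and bc: "b \<in> Basis" "c \<in> Basis \<or> c = 0"
    and nn: "\<And>f. f \<in> borel_measurable borel \<Longrightarrow>
      (\<integral>\<^sup>+z. f (fst z *\<^sub>R b + snd z *\<^sub>R c) \<partial>lborel_on unit_square) = \<kappa> * (\<integral>\<^sup>+x. f x \<partial>lborel_on per_box)"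
    and line: "\<And>b h. b \<in> Basis \<Longrightarrow> 0 \<le> h \<Longrightarrow> h \<le> 2 \<Longrightarrow> AE x in lborel_on per_box.
      ennreal \<bar>u (x + h *\<^sub>R b) - u x\<bar> \<le> (\<integral>\<^sup>+s\<in>{0..h}. ennreal (norm (g (x + s *\<^sub>R b))) \<partial>lborel)"
  defines "T \<equiv> \<lambda>z :: real \<times> real. fst z *\<^sub>R b + snd z *\<^sub>R c"
  shows "energy_controlled (\<lambda>z. inverse (\<rho> (T z))) (\<lambda>z. u (T z)) (\<lambda>z. norm (g (T z))) (\<lambda>z. \<rho> (T z) * (norm (g (T z)))\<^sup>2)"
proof -
  have [measurable]: "T \<in> borel_measurable borel" unfolding T_def by measurable
  have chart: "AE z in lborel_on unit_square. P (T z)" if "AE x in lborel_on per_box. P x" for P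
    by (rule AE_chart[OF _ _ _ _ that, where \<kappa>=\<kappa>]) (use nn in \<open>auto simp: T_def\<close>)
  have lineT: "AE z in lborel. z \<in> unit_square \<longrightarrow>
      ennreal \<bar>u (T z + h *\<^sub>R v) - u (T z)\<bar> \<le> (\<integral>\<^sup>+s\<in>{0..h}. ennreal (norm (g (T z + s *\<^sub>R v))) \<partial>lborel)"
    if v: "v \<in> Basis \<or> v = 0" and h: "0 \<le> h" "h \<le> 2" for v h
  proof (cases "v = 0")
    case False
    then have "AE x in lborel_on per_box.
      ennreal \<bar>u (x + h *\<^sub>R v) - u x\<bar> \<le> (\<integral>\<^sup>+s\<in>{0..h}. ennreal (norm (g (x + s *\<^sub>R v))) \<partial>lborel)"
      using v h by (intro line) auto
    from chart[OF this] show ?thesis by (subst (asm) AE_lborel_on) auto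
  qed simp
  have "line_bound (\<lambda>z. u (T z)) (\<lambda>z. norm (g (T z)))"
    unfolding line_bound_def
  proof (intro allI impI)
    fix h :: real assume h: "0 \<le> h \<and> h \<le> 2"
    have T: "T (x + s, y) = T (x, y) + s *\<^sub>R b" for x y s
      by (simp add: T_def scaleR_add_left)
    show "AE (x, y) in lborel. x \<in> {-1..<1} \<longrightarrow> y \<in> {-1..<1} \<longrightarrow>
        ennreal \<bar>u (T (x + h, y)) - u (T (x, y))\<bar> \<le> (\<integral>\<^sup>+s\<in>{0..h}. ennreal (norm (g (T (x + s, y)))) \<partial>lborel)"
      using lineT[of b h] bc h unfolding T by (auto elim!: eventually_mono)
  qed
  moreover have "line_bound (\<lambda>z. u (T (snd z, fst z))) (\<lambda>z. norm (g (T (snd z, fst z))))"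
    unfolding line_bound_def
  proof (intro allI impI)
    fix h :: real assume h: "0 \<le> h \<and> h \<le> 2"
    have T: "T (y, x + s) = T (y, x) + s *\<^sub>R c" for x y s
      by (simp add: T_def scaleR_add_left)
    have "AE z in lborel. (snd z, fst z) \<in> unit_square \<longrightarrow>
      ennreal \<bar>u (T (snd z, fst z) + h *\<^sub>R c) - u (T (snd z, fst z))\<bar> \<le>
        (\<integral>\<^sup>+s\<in>{0..h}. ennreal (norm (g (T (snd z, fst z) + s *\<^sub>R c))) \<partial>lborel)"
      using AE_lborel_swap[OF lineT[of c h]] bc h by simp
    then show "AE (x, y) in lborel. x \<in> {-1..<1} \<longrightarrow> y \<in> {-1..<1} \<longrightarrow>
        ennreal \<bar>u (T (snd (x + h, y), fst (x + h, y))) - u (T (snd (x, y), fst (x, y)))\<bar> \<le>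
        (\<integral>\<^sup>+s\<in>{0..h}. ennreal (norm (g (T (snd (x + s, y), fst (x + s, y))))) \<partial>lborel)"
      unfolding fst_conv snd_conv T by (auto elim!: eventually_mono)
  qed
  moreover have "AE z in lborel_on unit_square.
      (norm (g (T z)))\<^sup>2 \<le> \<rho> (T z) * (norm (g (T z)))\<^sup>2 * inverse (\<rho> (T z))"
    using chart[OF \<rho>]
  proof eventually_elim
    case (elim z)
    then have "\<rho> (T z) * (norm (g (T z)))\<^sup>2 * inverse (\<rho> (T z)) = (norm (g (T z)))\<^sup>2"
      by (simp add: field_simps)
    then show ?case by (simp only: order_refl)
  qed
  moreover have "\<forall>z. 0 \<le> \<rho> (T z) * (norm (g (T z)))\<^sup>2"
    using \<rho>0 by simp
  moreover have "(\<lambda>z. u (T z)) \<in> borel_measurable borel" "(\<lambda>z. norm (g (T z))) \<in> borel_measurable borel"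
    "(\<lambda>z. \<rho> (T z) * (norm (g (T z)))\<^sup>2) \<in> borel_measurable borel"
    by measurable
  ultimately show ?thesis
    unfolding energy_controlled_def by (intro conjI) assumption+
qed

section \<open>Compactness of the embedding\<close>

lemma dist_pow_nonneg: "0 \<le> dist_pow \<Gamma> \<sigma> x"
  by (simp add: dist_pow_def)

lemma H1_per_compactness:
  fixes \<alpha> :: "'a::euclidean_space \<Rightarrow> real"
  assumes dim: "DIM('a) \<in> {1, 2}" and int: "interface \<Gamma>" and \<sigma>: "0 \<le> \<sigma>" "\<sigma> < 1"
    and \<alpha>: "\<alpha> \<in> D_per \<Gamma> \<sigma>"
    and u: "\<And>k. u k \<in> H1_per \<alpha>" and bd: "bounded (range (\<lambda>k :: nat. H1_norm \<alpha> (u k)))"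
  obtains v r where "v \<in> L2_per" "strict_mono (r :: nat \<Rightarrow> nat)"
    "(\<lambda>k. L2_norm (\<lambda>x. u (r k) x - v x)) \<longlonglongrightarrow> 0"
proof -
  let ?M = "lborel_on (per_box :: 'a set)"
  let ?\<rho> = "dist_pow \<Gamma> \<sigma>"
  obtain c where c: "1 \<le> c" "\<And>x. x \<in> per_box \<Longrightarrow> 1 / c * ?\<rho> x \<le> \<alpha> x" and \<alpha>0: "\<And>x. 0 \<le> \<alpha> x"
    using \<alpha> by (auto simp: D_per_def)
  obtain K where K: "\<And>k. norm (H1_norm \<alpha> (u k)) \<le> K"
    using bd by (auto simp: bounded_iff)
  have K2: "(H1_norm \<alpha> (u k))\<^sup>2 \<le> K\<^sup>2" for k
    using K[of k] by (metis abs_le_square_iff abs_of_nonneg norm_ge_zero order_trans real_norm_def)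
  let ?P = "\<lambda>k u' g. u' \<in> borel_measurable borel \<and> (g :: 'a \<Rightarrow> 'a) \<in> borel_measurable borel \<and>
      (AE x in lborel. u k x = u' x) \<and>
      (\<forall>b\<in>Basis. \<forall>h. 0 \<le> h \<longrightarrow> h \<le> 2 \<longrightarrow> (AE x in ?M.
        ennreal \<bar>u' (x + h *\<^sub>R b) - u' x\<bar> \<le> (\<integral>\<^sup>+s\<in>{0..h}. ennreal (norm (g (x + s *\<^sub>R b))) \<partial>lborel))) \<and>
      integrable ?M (\<lambda>x. (u' x)\<^sup>2) \<and>
      (\<integral>\<^sup>+x. ennreal ((u' x)\<^sup>2) \<partial>?M) \<le> ennreal ((H1_norm \<alpha> (u k))\<^sup>2) \<and>
      (\<integral>\<^sup>+x. ennreal (?\<rho> x * (norm (g x))\<^sup>2) \<partial>?M) \<le> ennreal (c * (H1_norm \<alpha> (u k))\<^sup>2)"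
  have ex: "\<exists>u' g. ?P k u' g" for k
  proof (rule H1_per_representative[OF u[of k] c(1) \<alpha>0 c(2)])
    fix u' g assume *: "u' \<in> borel_measurable borel" "(g :: 'a \<Rightarrow> 'a) \<in> borel_measurable borel"
      "AE x in lborel. u k x = u' x"
      "\<And>b h. b \<in> Basis \<Longrightarrow> 0 \<le> h \<Longrightarrow> h \<le> 2 \<Longrightarrow> AE x in ?M.
        ennreal \<bar>u' (x + h *\<^sub>R b) - u' x\<bar> \<le> (\<integral>\<^sup>+s\<in>{0..h}. ennreal (norm (g (x + s *\<^sub>R b))) \<partial>lborel)"
      "integrable ?M (\<lambda>x. (u' x)\<^sup>2)"
      "(\<integral>\<^sup>+x. ennreal ((u' x)\<^sup>2) \<partial>?M) \<le> ennreal ((H1_norm \<alpha> (u k))\<^sup>2)"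
      "(\<integral>\<^sup>+x. ennreal (?\<rho> x * (norm (g x))\<^sup>2) \<partial>?M) \<le> ennreal (c * (H1_norm \<alpha> (u k))\<^sup>2)"
    show "\<exists>u' g. ?P k u' g"
      by (intro exI[of _ u'] exI[of _ g] conjI ballI allI impI *)
  qed
  \<comment> \<open>Representatives are fixed for all \<open>k\<close> at once, so that countably
    many null sets merge into one.\<close>
  have "\<forall>k. \<exists>u' g. ?P k u' g" by (intro allI ex)
  from choice[OF this] obtain w where "\<forall>k. \<exists>g. ?P k (w k) g" ..
  from choice[OF this] obtain g where "\<forall>k. ?P k (w k) (g k)" ..
  note wg = spec[OF this]
  note wg1 = wg[THEN conjunct2, THEN conjunct2]
  note wg2 = wg1[THEN conjunct2, THEN conjunct2]
  have wm[measurable]: "w k \<in> borel_measurable borel" and gm[measurable]: "g k \<in> borel_measurable borel" for k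
    by (rule wg[THEN conjunct1], rule wg[THEN conjunct2, THEN conjunct1])
  have uw: "AE x in lborel. \<forall>k. u k x = w k x"
    unfolding AE_all_countable by (intro allI wg1[THEN conjunct1])
  have line: "AE x in ?M. ennreal \<bar>w k (x + h *\<^sub>R b) - w k x\<bar> \<le>
      (\<integral>\<^sup>+s\<in>{0..h}. ennreal (norm (g k (x + s *\<^sub>R b))) \<partial>lborel)"
    if "b \<in> Basis" "0 \<le> h" "h \<le> 2" for k b h
    using wg1[THEN conjunct2, THEN conjunct1, of k] that by blast
  have w2: "integrable ?M (\<lambda>x. (w k x)\<^sup>2)"
    and wb: "(\<integral>\<^sup>+x. ennreal ((w k x)\<^sup>2) \<partial>?M) \<le> ennreal ((H1_norm \<alpha> (u k))\<^sup>2)"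
    and gb: "(\<integral>\<^sup>+x. ennreal (?\<rho> x * (norm (g k x))\<^sup>2) \<partial>?M) \<le> ennreal (c * (H1_norm \<alpha> (u k))\<^sup>2)" for k
    by (rule wg2[THEN conjunct1], rule wg2[THEN conjunct2, THEN conjunct1], rule wg2[THEN conjunct2, THEN conjunct2])
  obtain b d :: 'a and \<kappa> :: real where bd: "b \<in> Basis" "d \<in> Basis \<or> d = 0" and \<kappa>: "0 < \<kappa>"
    and nn: "\<And>f. f \<in> borel_measurable borel \<Longrightarrow>
      (\<integral>\<^sup>+z. f (fst z *\<^sub>R b + snd z *\<^sub>R d) \<partial>lborel_on unit_square) = ennreal \<kappa> * (\<integral>\<^sup>+x. f x \<partial>?M)"
    using plane_chart[OF dim] by blast
  define T where "T z = fst z *\<^sub>R b + snd z *\<^sub>R d" for z :: "real \<times> real"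
  have [measurable]: "T \<in> borel_measurable borel" unfolding T_def[abs_def] by measurable
  have nnT: "(\<integral>\<^sup>+z. f (T z) \<partial>lborel_on unit_square) = ennreal \<kappa> * (\<integral>\<^sup>+x. f x \<partial>?M)"
    if "f \<in> borel_measurable borel" for f
    using nn[OF that] by (simp add: T_def)
  have ctl: "energy_controlled (\<lambda>z. inverse (?\<rho> (T z))) (\<lambda>z. w k (T z)) (\<lambda>z. norm (g k (T z)))
      (\<lambda>z. ?\<rho> (T z) * (norm (g k (T z)))\<^sup>2)" for k
    unfolding T_def
    by (rule energy_controlled_chart[OF _ _ _ dist_pow_nonneg interface_weight(2)[OF dim int \<sigma>] bd nn])
       (auto intro: line)
  \<comment> \<open>One constant serves both bounds: the \<open>L^2\<close> part has factor 1, the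
    energy part factor \<open>c\<close>, and \<open>1 \<le> c\<close>; the factor
    \<open>\<kappa>\<close> comes from the chart.\<close>
  define B where "B = \<kappa> * (c * K\<^sup>2)"
  have bound: "ennreal \<kappa> * X \<le> ennreal B" if "X \<le> ennreal (c' * (H1_norm \<alpha> (u k))\<^sup>2)" "0 \<le> c'" "c' \<le> c" for X c' k
  proof -
    have "c' * (H1_norm \<alpha> (u k))\<^sup>2 \<le> c * K\<^sup>2"
      using that K2[of k] by (intro mult_mono) auto
    then have "X \<le> ennreal (c * K\<^sup>2)" using that(1) ennreal_leI order_trans by blast
    then have "ennreal \<kappa> * X \<le> ennreal \<kappa> * ennreal (c * K\<^sup>2)" by (rule mult_left_mono) simp
    also have "\<dots> = ennreal B" using \<kappa> by (simp add: B_def ennreal_mult')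
    finally show ?thesis .
  qed
  let ?Cauchy = "\<lambda>r. \<forall>e>0. \<exists>n0. \<forall>k\<ge>n0. \<forall>l\<ge>n0.
      (\<integral>\<^sup>+z. ennreal ((w (r k) (T z) - w (r l) (T z))\<^sup>2) \<partial>lborel_on unit_square) \<le> ennreal e"
  have "\<exists>r. strict_mono (r :: nat \<Rightarrow> nat) \<and> ?Cauchy r"
  proof (rule plane_compactness[where u="\<lambda>k z. w k (T z)", OF ctl])
    show "(\<integral>\<^sup>+z. ennreal (inverse (?\<rho> (T z))) \<partial>lborel_on unit_square) < \<infinity>"
      using interface_weight(1)[OF dim int \<sigma>]
      by (subst nnT) (auto simp: ennreal_mult_less_top)
    show "(\<integral>\<^sup>+z. ennreal ((w k (T z))\<^sup>2) \<partial>lborel_on unit_square) \<le> ennreal B" for k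
      using wb[of k] c(1) by (subst nnT[of "\<lambda>x. ennreal ((w k x)\<^sup>2)"]) (auto intro!: bound[of _ 1 k])
    show "(\<integral>\<^sup>+z. ennreal (?\<rho> (T z) * (norm (g k (T z)))\<^sup>2) \<partial>lborel_on unit_square) \<le> ennreal B" for k
      using gb[of k] c(1) by (subst nnT[of "\<lambda>x. ennreal (?\<rho> x * (norm (g k x))\<^sup>2)"]) (auto intro!: bound[of _ c k])
    show "(\<lambda>z. inverse (?\<rho> (T z))) \<in> borel_measurable borel" by measurable
    show "0 \<le> inverse (?\<rho> (T z))" for z by (simp add: dist_pow_nonneg)
  qed blast
  then obtain r where r: "strict_mono (r :: nat \<Rightarrow> nat)" and Cauchy: "?Cauchy r" by blast
  have Cauchy': "\<exists>n0. \<forall>k\<ge>n0. \<forall>l\<ge>n0. (\<integral>\<^sup>+x. ennreal ((w (r k) x - w (r l) x)\<^sup>2) \<partial>?M) \<le> ennreal e"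
    if e: "0 < e" for e
  proof -
    \<comment> \<open>The chart multiplies integrals by \<open>\<kappa>\<close>, so accuracy
      \<open>\<kappa> e\<close> is requested in the plane.\<close>
    have "0 < \<kappa> * e" using e \<kappa> by simp
    from Cauchy[rule_format, OF this] obtain n0 where n0: "\<And>k l. k \<ge> n0 \<Longrightarrow> l \<ge> n0 \<Longrightarrow>
      (\<integral>\<^sup>+z. ennreal ((w (r k) (T z) - w (r l) (T z))\<^sup>2) \<partial>lborel_on unit_square) \<le> ennreal (\<kappa> * e)" by blast
    have "(\<integral>\<^sup>+x. ennreal ((w (r k) x - w (r l) x)\<^sup>2) \<partial>?M) \<le> ennreal e" if "k \<ge> n0" "l \<ge> n0" for k l
    proof -
      have "ennreal \<kappa> * (\<integral>\<^sup>+x. ennreal ((w (r k) x - w (r l) x)\<^sup>2) \<partial>?M) \<le> ennreal \<kappa> * ennreal e"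
        using n0[OF that] \<kappa> e nnT[of "\<lambda>x. ennreal ((w (r k) x - w (r l) x)\<^sup>2)"] by (simp add: ennreal_mult)
      then show ?thesis by (subst (asm) ennreal_mult_le_mult_iff) (use \<kappa> in auto)
    qed
    then show ?thesis by blast
  qed
  obtain s where s: "strict_mono s" "AE x in ?M. Cauchy (\<lambda>i. w (r (s i)) x)"
    and limit: "\<And>v. v \<in> borel_measurable ?M \<Longrightarrow> (AE x in ?M. (\<lambda>i. w (r (s i)) x) \<longlonglongrightarrow> v x) \<Longrightarrow>
      integrable ?M (\<lambda>x. (v x)\<^sup>2) \<and> (\<lambda>k. LINT x|?M. (w (r k) x - v x)\<^sup>2) \<longlonglongrightarrow> 0"
    by (rule L2_limit[where f="\<lambda>k. w (r k)", OF per_box.finite_measure_axioms _ w2 Cauchy']) auto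
  \<comment> \<open>The limit is taken of the original functions and not of \<open>w\<close>:
    \<open>lim\<close> depends only on the sequence of values, even where it diverges, so
    \<open>v\<close> is periodic everywhere. Almost everywhere on the box it is also the limit of
    the representatives.\<close>
  define v where "v x = lim (\<lambda>i. u (r (s i)) x)" for x
  have um: "u k \<in> borel_measurable lebesgue" and up: "periodic (u k)" for k
    using u[of k] by (auto simp: H1_per_def L2_per_def)
  have vm: "v \<in> borel_measurable lebesgue"
    unfolding v_def[abs_def] by (intro borel_measurable_lim_metric um)
  have vp: "periodic v"
    using up by (simp add: periodic_def v_def)
  obtain v' where v'[measurable]: "v' \<in> borel_measurable borel" and vv': "AE x in lborel. v x = v' x"
    using lebesgue_measurable_ex_borel[OF vm] .
  have "AE x in ?M. (\<lambda>i. w (r (s i)) x) \<longlonglongrightarrow> v' x"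
  proof -
    have "AE x in ?M. (\<forall>k. u k x = w k x) \<and> v x = v' x"
      using uw vv' by (subst AE_lborel_on) (auto elim!: eventually_elim2)
    then show ?thesis
      using s(2)
    proof eventually_elim
      case (elim x)
      then have "convergent (\<lambda>i. u (r (s i)) x)" by (simp add: Cauchy_convergent_iff)
      then have "(\<lambda>i. u (r (s i)) x) \<longlonglongrightarrow> v x" by (simp add: v_def convergent_LIMSEQ_iff)
      with elim show ?case by simp
    qed
  qed
  then have lim: "integrable ?M (\<lambda>x. (v' x)\<^sup>2)" "(\<lambda>k. LINT x|?M. (w (r k) x - v' x)\<^sup>2) \<longlonglongrightarrow> 0"
    using limit[of v'] by auto
  show ?thesis
  proof (rule that[OF _ r])
    have "set_integrable lebesgue per_box (\<lambda>x. (v x)\<^sup>2)"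
      using lim(1) by (subst set_integrable_lebesgue_borel[where f'="\<lambda>x. (v' x)\<^sup>2"])
        (use vm vv' in \<open>auto elim!: eventually_mono\<close>)
    then show "v \<in> L2_per" using vm vp by (simp add: L2_per_def)
    have "L2_norm (\<lambda>x. u (r k) x - v x) = sqrt (LINT x|?M. (w (r k) x - v' x)\<^sup>2)" for k
    proof -
      have "AE x in lborel. (u (r k) x - v x)\<^sup>2 = (w (r k) x - v' x)\<^sup>2"
        using uw vv' by eventually_elim simp
      then have "(LINT x:per_box|lebesgue. (u (r k) x - v x)\<^sup>2) = (LINT x|?M. (w (r k) x - v' x)\<^sup>2)"
        using um vm by (intro set_integral_lebesgue_borel) auto
      then show ?thesis by (simp add: L2_norm_def)
    qed
    then show "(\<lambda>k. L2_norm (\<lambda>x. u (r k) x - v x)) \<longlonglongrightarrow> 0"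
      using tendsto_real_sqrt[OF lim(2)] by simp
  qed
qed

lemma L2_norm_le_H1_norm: "L2_norm u \<le> H1_norm \<alpha> u"
  unfolding H1_norm_def by (intro real_le_rsqrt) simp

theorem lemma3p3:
  fixes \<alpha> :: "'a::euclidean_space \<Rightarrow> real" and \<Gamma> :: "'a set" and \<sigma> :: real
  assumes "DIM('a) \<in> {1, 2}"
    and "interface \<Gamma>"
    and "0 \<le> \<sigma>" "\<sigma> < 1"
    and "\<alpha> \<in> D_per \<Gamma> \<sigma>"
  shows "compact_embedding (H1_per \<alpha>) (H1_norm \<alpha>) L2_per L2_norm"
  unfolding compact_embedding_def
proof (intro conjI allI impI)
  show "H1_per \<alpha> \<subseteq> L2_per" by (auto simp: H1_per_def)
  show "\<exists>C. \<forall>u\<in>H1_per \<alpha>. L2_norm u \<le> C * H1_norm \<alpha> u"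
    by (intro exI[of _ 1]) (simp add: L2_norm_le_H1_norm)
next
  fix u :: "nat \<Rightarrow> 'a \<Rightarrow> real"
  assume u: "range u \<subseteq> H1_per \<alpha> \<and> bounded (range (\<lambda>k. H1_norm \<alpha> (u k)))"
  then have uk: "u k \<in> H1_per \<alpha>" for k by auto
  have bd: "bounded (range (\<lambda>k. H1_norm \<alpha> (u k)))" using u by blast
  obtain v r where "v \<in> L2_per" "strict_mono (r :: nat \<Rightarrow> nat)"
    "(\<lambda>k. L2_norm (\<lambda>x. u (r k) x - v x)) \<longlonglongrightarrow> 0"
    by (rule H1_per_compactness[OF assms uk bd])
  then show "\<exists>v\<in>L2_per. \<exists>r :: nat \<Rightarrow> nat. strict_mono r \<and> (\<lambda>k. L2_norm (\<lambda>x. u (r k) x - v x)) \<longlonglongrightarrow> 0"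
    by blast
qed

end
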